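(* Let $0 < \epsilon \le 1$ and let $d \in \mathbb{N}$ be fixed. Given a ground set $U$ with $|U| = n$ and a family $\mathcal{F}$ of subsets of $U$ each of size at most $d$, one can enumerate a hitting set for $\mathcal{F}$ of size at most $O((d/\epsilon) n^{\epsilon})$ times the minimum size of a hitting set for $\mathcal{F}$, in time $n^{O(d^2 + d/\epsilon)}$ using $O((d^2 + d/\epsilon)\log n)$ bits of space.
   Context: A hitting set for $\mathcal{F}$ is a subset of $U$ intersecting every set in $\mathcal{F}$ (the $d$-Hitting Set problem asks for a minimum one). Model of computation: word RAM with words of $O(\log n)$ bits; the input is read-only; output is written to a write-only stream; space is measured as the number of bits of auxiliary read-write memory used. *)

theory Defs
  imports Complex_Main
begin

definition hitting_set :: "'a set \<Rightarrow> 'a set set \<Rightarrow> 'a set \<Rightarrow> bool" where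
  "hitting_set U F H \<longleftrightarrow> H \<subseteq> U \<and> (\<forall>A\<in>F. A \<inter> H \<noteq> {})"

text \<open>Only meaningful if \<open>U\<close> is finite and some hitting set exists, that is, \<open>{} \<notin> F\<close>.\<close>

definition min_hitting_size :: "'a set \<Rightarrow> 'a set set \<Rightarrow> nat" where
  "min_hitting_size U F = (LEAST k. \<exists>H. hitting_set U F H \<and> card H = k)"

text \<open>
  A program is a finite list of instructions over an auxiliary memory of \<open>w\<close>-bit words, addressed
  by natural numbers and initially zero. There are no registers besides this memory: operands of
  instructions are addresses, so every word that a program reads or writes is paid for as
  auxiliary space. The input is an array of words that can only be read (with random access), the
  output is a stream to which words can only be appended. The control state (program counter)
  ranges over a set that depends on the program alone and is not counted as memory.
\<close>

datatype binop = Add | Sub | Mul | Div | Mod | And | Or | Xor | Shl | Shr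

datatype instr =
    Const nat nat
  | Op binop nat nat nat
  | Load nat nat
  | Store nat nat
  | Input nat nat
  | Output nat
  | Jump nat
  | JumpLess nat nat nat
  | JumpEq nat nat nat

type_synonym prog = "instr list"

text \<open>
  All results are reduced modulo \<open>2 ^ w\<close>; subtraction wraps around. Division by zero
  gives \<open>0\<close>, and \<open>x mod 0 = x\<close>.
\<close>

fun eval_op :: "nat \<Rightarrow> binop \<Rightarrow> nat \<Rightarrow> nat \<Rightarrow> nat" where
  "eval_op w Add x y = take_bit w (x + y)"
| "eval_op w Sub x y = take_bit w (x + 2 ^ w - y)"
| "eval_op w Mul x y = take_bit w (x * y)"
| "eval_op w Div x y = take_bit w (x div y)"
| "eval_op w Mod x y = take_bit w (x mod y)"
| "eval_op w And x y = take_bit w (Bit_Operations.and x y)"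
| "eval_op w Or x y = take_bit w (Bit_Operations.or x y)"
| "eval_op w Xor x y = take_bit w (Bit_Operations.xor x y)"
| "eval_op w Shl x y = take_bit w (push_bit y x)"
| "eval_op w Shr x y = take_bit w (drop_bit y x)"

record config =
  pc :: nat
  mem :: "nat \<Rightarrow> nat"
  out :: "nat list"

definition init_config :: config where
  "init_config = \<lparr>pc = 0, mem = (\<lambda>_. 0), out = []\<rparr>"

definition halted :: "prog \<Rightarrow> config \<Rightarrow> bool" where
  "halted P s \<longleftrightarrow> length P \<le> pc s"

definition input_word :: "nat \<Rightarrow> nat list \<Rightarrow> nat \<Rightarrow> nat" where
  "input_word w x i = (if i < length x then take_bit w (x ! i) else 0)"

fun exec :: "nat \<Rightarrow> nat list \<Rightarrow> instr \<Rightarrow> config \<Rightarrow> config" where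
  "exec w x (Const a k) s = s\<lparr>pc := pc s + 1, mem := (mem s)(a := take_bit w k)\<rparr>"
| "exec w x (Op f a b c) s =
     s\<lparr>pc := pc s + 1, mem := (mem s)(a := eval_op w f (mem s b) (mem s c))\<rparr>"
| "exec w x (Load a b) s = s\<lparr>pc := pc s + 1, mem := (mem s)(a := mem s (mem s b))\<rparr>"
| "exec w x (Store a b) s = s\<lparr>pc := pc s + 1, mem := (mem s)(mem s a := mem s b)\<rparr>"
| "exec w x (Input a b) s = s\<lparr>pc := pc s + 1, mem := (mem s)(a := input_word w x (mem s b))\<rparr>"
| "exec w x (Output a) s = s\<lparr>pc := pc s + 1, out := out s @ [mem s a]\<rparr>"
| "exec w x (Jump l) s = s\<lparr>pc := l\<rparr>"
| "exec w x (JumpLess a b l) s = s\<lparr>pc := (if mem s a < mem s b then l else pc s + 1)\<rparr>"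
| "exec w x (JumpEq a b l) s = s\<lparr>pc := (if mem s a = mem s b then l else pc s + 1)\<rparr>"

fun touched :: "instr \<Rightarrow> config \<Rightarrow> nat set" where
  "touched (Const a k) s = {a}"
| "touched (Op f a b c) s = {a, b, c}"
| "touched (Load a b) s = {a, b, mem s b}"
| "touched (Store a b) s = {a, b, mem s a}"
| "touched (Input a b) s = {a, b}"
| "touched (Output a) s = {a}"
| "touched (Jump l) s = {}"
| "touched (JumpLess a b l) s = {a, b}"
| "touched (JumpEq a b l) s = {a, b}"

definition step :: "nat \<Rightarrow> prog \<Rightarrow> nat list \<Rightarrow> config \<Rightarrow> config" where
  "step w P x s = (if halted P s then s else exec w x (P ! pc s) s)"

definition run :: "nat \<Rightarrow> prog \<Rightarrow> nat list \<Rightarrow> nat \<Rightarrow> config" where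
  "run w P x t = (step w P x ^^ t) init_config"

text \<open>
  With word length \<open>w\<close>, program \<open>P\<close> on input \<open>x\<close> halts after exactly \<open>t\<close> instructions with
  output \<open>ys\<close>, and all memory accesses fall in the first \<open>m\<close> words. The auxiliary space is then
  at most \<open>w * m\<close> bits. The bound is on addresses and not on the number of distinct
  words accessed, so that no information can be hidden in the choice of addresses.
\<close>

definition computes ::
  "nat \<Rightarrow> prog \<Rightarrow> nat list \<Rightarrow> nat list \<Rightarrow> nat \<Rightarrow> nat \<Rightarrow> bool" where
  "computes w P x ys t m \<longleftrightarrow>
     halted P (run w P x t) \<and> out (run w P x t) = ys \<and>
     (\<forall>i<t. \<not> halted P (run w P x i) \<and>
            touched (P ! pc (run w P x i)) (run w P x i) \<subseteq> {..<m})"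

text \<open>
  The ground set is \<open>{..<n}\<close>. The input array holds \<open>n\<close>, the number of sets, and then for each set
  its size followed by its elements. Each set of the family is listed exactly once; the
  order of the sets and the order of the elements within a set are arbitrary.
\<close>

definition encodes :: "nat list \<Rightarrow> nat \<Rightarrow> nat set set \<Rightarrow> bool" where
  "encodes x n F \<longleftrightarrow>
     (\<exists>As. x = n # length As # concat (map (\<lambda>A. length A # A) As) \<and>
           (\<forall>A\<in>set As. distinct A) \<and> distinct (map set As) \<and> set ` set As = F)"

end

theory Submission
  imports Defs "HOL-Library.FuncSet" "HOL-Number_Theory.Cong"
begin

text \<open>
  With \<open>g = n powr (1 / R)\<close> and \<open>R = \<Theta>(1 / \<epsilon>)\<close>, let round \<open>s\<close> of the greedy algorithm add every
  vertex that lies in at least about \<open>n ^ (2 * d) / g ^ s\<close> sets not hit so far. No degree ever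
  exceeds \<open>g\<close> times the threshold, so a round adds \<open>O(g * d * opt)\<close> vertices, and after
  \<open>O(d * R)\<close> rounds everything is hit. Computed recursively this would cost one pointer
  into the family, that is \<open>O(d * log n)\<close> bits, in each of the \<open>O(d * R)\<close> rounds.

  The rounds are therefore grouped into \<open>O(d)\<close> phases of \<open>R\<close> rounds each. Within a phase the
  degrees are estimated on a hashed sample of \<open>n ^ O(1)\<close> of the sets not hit before
  the phase, whose members are named by their ranks of \<open>O(log n)\<close> bits; only the \<open>O(d)\<close>
  phases need a long pointer. If each threshold is placed in a gap of the degree sequence, a
  pairwise independent hash function exists for which all decisions on the sample agree with the
  exact ones (Chebyshev and a union bound). The hash functions and sample thresholds are found by
  exhaustive search.

  Since halting runs repeat no configuration, a space bound yields a time bound, provided the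
  program is short compared with \<open>n\<close>. The finitely many \<open>n\<close> below a bound that depends on \<open>d\<close>
  and \<open>\<epsilon>\<close>, where constant factors are not absorbed by \<open>n powr \<epsilon>\<close>, are solved optimally by a
  decision tree, which uses the control state only.
\<close>

section \<open>Running times\<close>

text \<open>The chosen set is never stored. Whether a vertex is in it is recomputed from the tests
  of earlier rounds, so each phase and each round owns variables and the space is the sum of their
  widths. In digits to base \<open>n\<close>, a phase has 12 variables of \<open>14 * d\<close>
  digits and a round has 6 of 11 digits; over \<open>2 * d + 3\<close> phases of \<open>R\<close>
  rounds this is \<open>O(d^2 + d * R)\<close>. Space is charged as word length times number of
  words, and the word length may be any constant multiple of \<open>log n\<close>. Therefore all
  variables are packed into one long word, and only six words are ever addressed.

  The greedy count is \<open>(2 * d + 3) * R\<close> rounds times \<open>27 * g * d * opt\<close>, a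
  factor of order \<open>d\<close> above the claim. Taking \<open>R\<close> as twice the ceiling of
  \<open>1 / \<epsilon>\<close> makes \<open>g\<close> at most
  \<open>n powr (\<epsilon> / 2)\<close>, and the second half of the exponent pays for every factor
  that depends on \<open>d\<close> and \<open>\<epsilon>\<close>.

  A single program must serve all \<open>n\<close>, so the cut-off for small \<open>n\<close> is
  built into it. The decision tree grows with the cut-off and must not enter the time bound for
  large \<open>n\<close>.\<close>

definition gstep :: "nat \<Rightarrow> prog \<Rightarrow> nat list \<Rightarrow> nat \<Rightarrow> config \<Rightarrow> config \<Rightarrow> bool" where
  "gstep w P x m s s' \<longleftrightarrow>
     \<not> halted P s \<and> touched (P ! pc s) s \<subseteq> {..<m} \<and> s' = step w P x s"

lemma gstep_relpowp_iff:
  "(gstep w P x m ^^ t) s s' \<longleftrightarrow>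
     s' = (step w P x ^^ t) s \<and>
     (\<forall>i<t. \<not> halted P ((step w P x ^^ i) s) \<and>
        touched (P ! pc ((step w P x ^^ i) s)) ((step w P x ^^ i) s) \<subseteq> {..<m})"
proof (induction t arbitrary: s')
  case (Suc t)
  have "(gstep w P x m ^^ Suc t) s s' \<longleftrightarrow>
      gstep w P x m ((step w P x ^^ t) s) s' \<and>
      (\<forall>i<t. \<not> halted P ((step w P x ^^ i) s) \<and>
        touched (P ! pc ((step w P x ^^ i) s)) ((step w P x ^^ i) s) \<subseteq> {..<m})"
    by (auto simp: relcompp_apply Suc.IH)
  moreover have "gstep w P x m ((step w P x ^^ t) s) s' \<longleftrightarrow>
      \<not> halted P ((step w P x ^^ t) s) \<and>
      touched (P ! pc ((step w P x ^^ t) s)) ((step w P x ^^ t) s) \<subseteq> {..<m} \<and>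
      s' = (step w P x ^^ Suc t) s"
    by (simp add: gstep_def)
  ultimately show ?case
    unfolding less_Suc_eq by blast
qed auto

text \<open>The conditions on halting and addresses travel inside \<open>gstep\<close>, so runs of
  consecutive pieces of code compose as powers of one relation.\<close>

lemma computes_iff_relpowp:
  "computes w P x ys t m \<longleftrightarrow>
     (\<exists>s. (gstep w P x m ^^ t) init_config s \<and> halted P s \<and> out s = ys)"
  by (auto simp: gstep_relpowp_iff computes_def run_def)

section \<open>Counting configurations\<close>

definition wordmem :: "nat \<Rightarrow> nat \<Rightarrow> (nat \<Rightarrow> nat) set" where
  "wordmem w m = {f. (\<forall>i<m. f i < 2 ^ w) \<and> (\<forall>i\<ge>m. f i = 0)}"

lemma eval_op_less: "eval_op w f a b < 2 ^ w"
  by (cases f) (auto simp: take_bit_eq_mod)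

lemma wordmem_step:
  assumes "mem s \<in> wordmem w m" "gstep w P x m s s'"
  shows "mem s' \<in> wordmem w m"
proof -
  have "mem (exec w x i s) \<in> wordmem w m" if "touched i s \<subseteq> {..<m}" for i
    using that assms(1)
    by (cases i) (auto simp: wordmem_def eval_op_less input_word_def take_bit_eq_mod)
  then show ?thesis
    using assms(2) by (auto simp: gstep_def step_def)
qed

lemma card_wordmem: "finite (wordmem w m)" "card (wordmem w m) = (2 ^ w) ^ m"
proof -
  \<comment> \<open>Functions in \<open>PiE\<close> are \<open>undefined\<close> outside their
    domain, memories are 0 there; \<open>?e\<close> translates.\<close>
  let ?e = "\<lambda>f i. if i < m then f i else (0::nat)"
  have eq: "wordmem w m = ?e ` ({..<m} \<rightarrow>\<^sub>E {..<2 ^ w})"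
  proof (intro equalityI subsetI)
    fix f assume f: "f \<in> wordmem w m"
    then have "f = ?e (restrict f {..<m})"
      by (auto simp: wordmem_def fun_eq_iff)
    moreover have "restrict f {..<m} \<in> {..<m} \<rightarrow>\<^sub>E {..<2 ^ w}"
      using f by (auto simp: wordmem_def)
    ultimately show "f \<in> ?e ` ({..<m} \<rightarrow>\<^sub>E {..<2 ^ w})" by blast
  qed (auto simp: wordmem_def PiE_def Pi_def)
  have inj: "inj_on ?e ({..<m} \<rightarrow>\<^sub>E {..<2 ^ w})"
  proof (rule inj_onI)
    fix f g assume fg: "f \<in> {..<m} \<rightarrow>\<^sub>E {..<2 ^ w}" "g \<in> {..<m} \<rightarrow>\<^sub>E {..<2 ^ w}" "?e f = ?e g"
    have "f i = g i" if "i < m" for i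
      using fun_cong[OF fg(3), of i] that by simp
    then show "f = g"
      using fg(1,2) by (intro PiE_ext) auto
  qed
  show "finite (wordmem w m)" unfolding eq by (intro finite_imageI finite_PiE) auto
  show "card (wordmem w m) = (2 ^ w) ^ m"
    unfolding eq by (simp add: card_image[OF inj] card_PiE)
qed

text \<open>The output stream is write-only and cannot influence the run, so configurations may be
  counted without it.\<close>

lemma step_cong:
  assumes "pc s = pc s'" "mem s = mem s'"
  shows "pc (step w P x s) = pc (step w P x s') \<and> mem (step w P x s) = mem (step w P x s')"
proof -
  have "pc (exec w x i s) = pc (exec w x i s') \<and> mem (exec w x i s) = mem (exec w x i s')" for i
    using assms by (cases i) auto
  then show ?thesis using assms by (simp add: step_def halted_def)
qed

text \<open>A halting run never repeats a pair of program counter and memory.\<close>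

lemma computes_time:
  assumes "computes w P x ys t m" and lo: "\<And>i. t0 \<le> i \<Longrightarrow> i < t \<Longrightarrow> lo \<le> pc (run w P x i)"
  shows "t \<le> t0 + (length P - lo) * (2 ^ w) ^ m"
proof -
  define c where "c i = run w P x i" for i
  have c_add: "c (i + j) = (step w P x ^^ j) (c i)" for i j
    by (simp add: c_def run_def funpow_add add.commute[of i])
  have nh: "\<not> halted P (c i)" if "i < t" for i
    using assms that by (auto simp: computes_def c_def)
  have h: "halted P (c t)" using assms by (auto simp: computes_def c_def)
  have gs: "gstep w P x m (c i) (c (Suc i))" if "i < t" for i
    using assms that by (auto simp: computes_def c_def gstep_def run_def)
  have wm: "mem (c i) \<in> wordmem w m" if "i \<le> t" for i
    using that
  proof (induction i)
    case 0 then show ?case by (auto simp: c_def run_def init_config_def wordmem_def)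
  next
    case (Suc i) then show ?case using wordmem_step[OF _ gs[of i]] by auto
  qed
  have cong: "pc ((step w P x ^^ k) s) = pc ((step w P x ^^ k) s') \<and>
      mem ((step w P x ^^ k) s) = mem ((step w P x ^^ k) s')"
    if "pc s = pc s'" "mem s = mem s'" for k s s'
  proof (induction k)
    case (Suc k)
    then show ?case
      using step_cong[of "(step w P x ^^ k) s" "(step w P x ^^ k) s'"] by simp
  qed (use that in simp)
  define f where "f i = (pc (c i), mem (c i))" for i
  \<comment> \<open>If times \<open>i < j\<close> agreed up to output, the \<open>t - j\<close>
    steps that lead from \<open>j\<close> to the halt would also halt the run from \<open>i\<close>,
    at the earlier time \<open>i + (t - j)\<close>.\<close>
  have inj': False if "i < j" "j < t" "f i = f j" for i j
  proof -
    have "pc (c (i + (t - j))) = pc (c (j + (t - j)))"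
      unfolding c_add using that(3) by (intro conjunct1[OF cong]) (auto simp: f_def)
    then have "halted P (c (i + (t - j)))" using h that by (simp add: halted_def)
    moreover have "i + (t - j) < t" using that by linarith
    ultimately show False using nh by blast
  qed
  have "inj_on f {t0..<t}"
  proof (rule inj_onI)
    fix i j assume "i \<in> {t0..<t}" "j \<in> {t0..<t}" "f i = f j"
    then show "i = j" using inj'[of i j] inj'[of j i] by (cases i j rule: linorder_cases) auto
  qed
  moreover have "f ` {t0..<t} \<subseteq> {lo..<length P} \<times> wordmem w m"
    using nh wm lo by (auto simp: f_def halted_def not_le c_def)
  ultimately have "card {t0..<t} \<le> card ({lo..<length P} \<times> wordmem w m)"
    by (intro card_inj_on_le) (auto simp: card_wordmem)
  then show ?thesis by (simp add: card_cartesian_product card_wordmem)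
qed

text \<open>Restricting the run to program counters from \<open>lo\<close> on keeps the code in
  front of \<open>lo\<close>, here the decision tree, out of the configuration count. The length of
  the tree grows with the cut-off \<open>N\<close>, so \<open>N\<close> could not be chosen above
  the length of the whole program.\<close>

definition gstep_from :: "nat \<Rightarrow> nat \<Rightarrow> prog \<Rightarrow> nat list \<Rightarrow> nat \<Rightarrow> config \<Rightarrow> config \<Rightarrow> bool" where
  "gstep_from lo w P x m s s' \<longleftrightarrow> gstep w P x m s s' \<and> lo \<le> pc s"

lemma gstep_from_relpowp:
  assumes "(gstep_from lo w P x m ^^ t) s s'"
  shows "(gstep w P x m ^^ t) s s' \<and> (\<forall>i<t. lo \<le> pc ((step w P x ^^ i) s))"
  using assms
proof (induction t arbitrary: s')
  case (Suc t)
  then obtain s1 where s1: "(gstep_from lo w P x m ^^ t) s s1" "gstep_from lo w P x m s1 s'" by auto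
  have IH: "(gstep w P x m ^^ t) s s1" "\<forall>i<t. lo \<le> pc ((step w P x ^^ i) s)"
    using Suc.IH[OF s1(1)] by auto
  have "s1 = (step w P x ^^ t) s" using IH(1) by (simp add: gstep_relpowp_iff)
  then show ?case using IH s1(2) by (auto simp: gstep_from_def less_Suc_eq)
qed simp

text \<open>A prefix is paid for step by step and the rest by counting configurations, which
  replaces a time analysis of the nested loops.\<close>

lemma computes_from:
  assumes "(gstep w P x m ^^ t0) init_config s1" "(gstep_from lo w P x m)\<^sup>*\<^sup>* s1 s2" "halted P s2"
  shows "\<exists>t. computes w P x (out s2) t m \<and> t \<le> t0 + (length P - lo) * (2 ^ w) ^ m"
proof -
  obtain t1 where "(gstep_from lo w P x m ^^ t1) s1 s2"
    using assms(2) by (auto dest: rtranclp_imp_relpowp)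
  then have t1: "(gstep w P x m ^^ t1) s1 s2" "\<forall>i<t1. lo \<le> pc ((step w P x ^^ i) s1)"
    using gstep_from_relpowp by auto
  have c: "computes w P x (out s2) (t0 + t1) m"
    using assms(1,3) t1(1) unfolding computes_iff_relpowp by (auto simp: relpowp_add)
  have s1: "s1 = (step w P x ^^ t0) init_config" using assms(1) by (simp add: gstep_relpowp_iff)
  have "t0 + t1 \<le> t0 + (length P - lo) * (2 ^ w) ^ m"
  proof (rule computes_time[OF c])
    fix i assume i: "t0 \<le> i" "i < t0 + t1"
    then have "run w P x i = (step w P x ^^ (i - t0)) s1"
      unfolding run_def s1 by (metis comp_apply funpow_add le_add_diff_inverse2)
    then show "lo \<le> pc (run w P x i)" using t1(2) i by simp
  qed
  then show ?thesis using c by blast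
qed

section \<open>Code fragments and straight-line execution\<close>

definition code_at :: "prog \<Rightarrow> nat \<Rightarrow> instr list \<Rightarrow> bool" where
  "code_at P k cs \<longleftrightarrow> (\<exists>ys zs. P = ys @ cs @ zs \<and> length ys = k)"

lemma code_at_Nil [simp]: "code_at P k [] \<longleftrightarrow> k \<le> length P"
proof
  assume "k \<le> length P"
  then have "P = take k P @ [] @ drop k P" "length (take k P) = k" by auto
  then show "code_at P k []" unfolding code_at_def by blast
qed (auto simp: code_at_def)

lemma code_at_append:
  "code_at P k (as @ bs) \<longleftrightarrow> code_at P k as \<and> code_at P (k + length as) bs"
proof
  assume "code_at P k (as @ bs)"
  then obtain ys zs where P: "P = ys @ (as @ bs) @ zs" "length ys = k" by (auto simp: code_at_def)
  have "P = ys @ as @ (bs @ zs)" "P = (ys @ as) @ bs @ zs" using P by auto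
  then show "code_at P k as \<and> code_at P (k + length as) bs"
    using P(2) unfolding code_at_def by (metis length_append)
next
  assume "code_at P k as \<and> code_at P (k + length as) bs"
  then obtain ys zs ys' zs' where P: "P = ys @ as @ zs" "length ys = k"
     "P = ys' @ bs @ zs'" "length ys' = k + length as" unfolding code_at_def by blast
  have "take (k + length as) P = ys @ as" "take (k + length as) P = ys'"
    unfolding P(1) using P(2) apply simp
    unfolding P(1)[symmetric] P(3) using P(4) by simp
  then have "P = ys @ (as @ bs) @ zs'" using P(3) by simp
  then show "code_at P k (as @ bs)" using P(2) unfolding code_at_def by blast
qed

lemma code_at_single: "code_at P k [i] \<longleftrightarrow> k < length P \<and> P ! k = i"
proof
  assume "k < length P \<and> P ! k = i"
  then have "P = take k P @ [i] @ drop (Suc k) P" "length (take k P) = k"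
    by (auto simp: id_take_nth_drop)
  then show "code_at P k [i]" unfolding code_at_def by blast
qed (auto simp: code_at_def nth_append)

lemma code_at_Cons:
  "code_at P k (i # is) \<longleftrightarrow> k < length P \<and> P ! k = i \<and> code_at P (Suc k) is"
  using code_at_append[of P k "[i]" "is"] by (simp add: code_at_single)

text \<open>Without \<open>Load\<close> and \<open>Store\<close> every address is a literal of the
  program, so the bound \<open>m\<close> on addresses is a syntactic check. Compiled code consists
  of such instructions and of jumps.\<close>

fun straight :: "nat \<Rightarrow> instr \<Rightarrow> bool" where
  "straight m (Const a k) \<longleftrightarrow> a < m"
| "straight m (Op f a b c) \<longleftrightarrow> a < m \<and> b < m \<and> c < m"
| "straight m (Input a b) \<longleftrightarrow> a < m \<and> b < m"
| "straight m (Output a) \<longleftrightarrow> a < m"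
| "straight m _ \<longleftrightarrow> False"

lemma straight_relpowp:
  assumes "code_at P k cs" "list_all (straight m) cs" "pc s = k"
  shows "(gstep w P x m ^^ length cs) s (fold (exec w x) cs s) \<and>
         pc (fold (exec w x) cs s) = k + length cs"
  using assms
proof (induction cs arbitrary: k s)
  case (Cons i cs)
  let ?s = "exec w x i s"
  have i: "k < length P" "P ! k = i" "code_at P (Suc k) cs" "straight m i"
    using Cons.prems by (auto simp: code_at_Cons)
  have "gstep w P x m s ?s" using i Cons.prems(3)
    by (cases i) (auto simp: gstep_def halted_def step_def)
  moreover have "pc ?s = Suc k" using i(4) Cons.prems(3) by (cases i) auto
  ultimately show ?case
    using Cons.IH[OF i(3) _ \<open>pc ?s = Suc k\<close>] Cons.prems(2)
    by (auto simp del: relpowp.simps simp: relpowp_Suc_I2 intro: relpowp_Suc_I2)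
qed simp

lemma straight_reaches:
  assumes "code_at P k cs" "list_all (straight m) cs" "pc s = k" "lo \<le> k"
  shows "(gstep_from lo w P x m)\<^sup>*\<^sup>* s (fold (exec w x) cs s) \<and>
         pc (fold (exec w x) cs s) = k + length cs"
  using assms
proof (induction cs arbitrary: k s)
  case (Cons i cs)
  let ?s = "exec w x i s"
  have i: "k < length P" "P ! k = i" "code_at P (Suc k) cs" "straight m i"
    using Cons.prems by (auto simp: code_at_Cons)
  have "gstep_from lo w P x m s ?s" using i Cons.prems(3,4)
    by (cases i) (auto simp: gstep_from_def gstep_def halted_def step_def)
  moreover have "pc ?s = Suc k" using i(4) Cons.prems(3) by (cases i) auto
  ultimately show ?case
    using Cons.IH[OF i(3) _ \<open>pc ?s = Suc k\<close>] Cons.prems(2,4)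
    by (auto intro: converse_rtranclp_into_rtranclp)
qed simp

section \<open>A structured language and its compiler\<close>

primrec offset :: "('v \<Rightarrow> nat) \<Rightarrow> 'v list \<Rightarrow> 'v \<Rightarrow> nat" where
  "offset wd [] x = 0"
| "offset wd (v # vs) x = (if x = v then 0 else wd v + offset wd vs x)"

text \<open>Variable \<open>v\<close> occupies \<open>wd v\<close> consecutive digits to base
  \<open>n\<close>. The widths are fixed with the program while \<open>n\<close> is known only from
  the input, which is why the base is \<open>n\<close> and not a power of two.\<close>

primrec pack :: "nat \<Rightarrow> ('v \<Rightarrow> nat) \<Rightarrow> 'v list \<Rightarrow> ('v \<Rightarrow> nat) \<Rightarrow> nat" where
  "pack n wd [] s = 0"
| "pack n wd (v # vs) s = s v + n ^ wd v * pack n wd vs s"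

abbreviation total_width :: "('v \<Rightarrow> nat) \<Rightarrow> 'v list \<Rightarrow> nat" where
  "total_width wd vs \<equiv> sum_list (map wd vs)"

lemma pack_less:
  assumes "\<forall>v\<in>set vs. s v < n ^ wd v"
  shows "pack n wd vs s < n ^ total_width wd vs"
  using assms
proof (induction vs)
  case (Cons v vs)
  have "pack n wd (v # vs) s < n ^ wd v + n ^ wd v * pack n wd vs s"
    using Cons.prems by simp
  also have "\<dots> = n ^ wd v * (pack n wd vs s + 1)" by (simp add: algebra_simps)
  also have "\<dots> \<le> n ^ wd v * n ^ total_width wd vs"
    using Cons by (intro mult_left_mono) auto
  finally show ?case by (simp add: power_add)
qed simp

lemma pack_get:
  assumes "\<forall>v\<in>set vs. s v < n ^ wd v" "x \<in> set vs"
  shows "pack n wd vs s div n ^ offset wd vs x mod n ^ wd x = s x"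
  using assms
proof (induction vs)
  case (Cons v vs)
  show ?case
  proof (cases "x = v")
    case True
    then show ?thesis using Cons.prems by (simp add: mod_mult_self2)
  next
    case False
    have "n ^ wd v > 0" using Cons.prems(1) by (metis list.set_intros(1) gr_zeroI not_less_zero)
    then have "pack n wd (v # vs) s div n ^ wd v = pack n wd vs s"
      using Cons.prems(1) by simp
    then show ?thesis
      using False Cons by (simp add: power_add div_mult2_eq)
  qed
qed simp

lemma pack_unchanged: "x \<notin> set vs \<Longrightarrow> pack n wd vs (s(x := y)) = pack n wd vs s"
  by (induction vs) auto

text \<open>Both sides carry an added term because subtraction on \<open>nat\<close> is truncated;
  \<open>pack_upd_le\<close> allows it to be moved.\<close>

lemma pack_upd:
  assumes "distinct vs" "x \<in> set vs"
  shows "pack n wd vs (s(x := y)) + s x * n ^ offset wd vs x =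
         pack n wd vs s + y * n ^ offset wd vs x"
  using assms
proof (induction vs)
  case (Cons v vs)
  show ?case
  proof (cases "x = v")
    case True
    have "pack n wd vs (s(v := y)) = pack n wd vs s"
      using Cons.prems True by (intro pack_unchanged) auto
    then show ?thesis using True by (simp del: fun_upd_apply) (simp add: algebra_simps)
  next
    case False
    then have IH: "pack n wd vs (s(x := y)) + s x * n ^ offset wd vs x =
         pack n wd vs s + y * n ^ offset wd vs x"
      using Cons by (simp del: fun_upd_apply)
    have "n ^ wd v * (pack n wd vs (s(x := y)) + s x * n ^ offset wd vs x) =
         n ^ wd v * (pack n wd vs s + y * n ^ offset wd vs x)"
      using IH by simp
    then show ?thesis using False
      by (simp add: power_add algebra_simps del: fun_upd_apply) simp
  qed
qed simp

lemma pack_upd_le: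
  assumes "x \<in> set vs"
  shows "s x * n ^ offset wd vs x \<le> pack n wd vs s"
  using assms
proof (induction vs)
  case (Cons v vs)
  show ?case
  proof (cases "x = v")
    case False
    then have "n ^ wd v * (s x * n ^ offset wd vs x) \<le> n ^ wd v * pack n wd vs s"
      using Cons by (intro mult_left_mono) auto
    then show ?thesis using False by (simp add: power_add mult.left_commute mult.assoc trans_le_add2 del: mult_le_cancel1 mult_le_cancel2)
  qed auto
qed simp

section \<open>A structured language and its semantics\<close>

datatype 'v cond = Less 'v 'v | Eq 'v 'v

datatype 'v com =
    Skip
  | Set 'v nat
  | Bin binop 'v 'v 'v
  | Inp 'v 'v
  | Out 'v
  | Seq "'v com" "'v com"  (infixr \<open>;;\<close> 60)
  | If "'v cond" "'v com" "'v com"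
  | While "'v cond" "'v com"

fun cval :: "'v cond \<Rightarrow> ('v \<Rightarrow> nat) \<Rightarrow> bool" where
  "cval (Less a b) s \<longleftrightarrow> s a < s b"
| "cval (Eq a b) s \<longleftrightarrow> s a = s b"

fun cvars :: "'v cond \<Rightarrow> 'v set" where
  "cvars (Less a b) = {a, b}"
| "cvars (Eq a b) = {a, b}"

fun vars :: "'v com \<Rightarrow> 'v set" where
  "vars Skip = {}"
| "vars (Set a k) = {a}"
| "vars (Bin f a b c) = {a, b, c}"
| "vars (Inp a b) = {a, b}"
| "vars (Out a) = {a}"
| "vars (c ;; d) = vars c \<union> vars d"
| "vars (If b c d) = cvars b \<union> vars c \<union> vars d"
| "vars (While b c) = cvars b \<union> vars c"

locale machine =
  fixes w n :: nat and inp :: "nat list" and wd :: "'v \<Rightarrow> nat"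
begin

text \<open>An assignment has a derivation only if the value fits the width of its variable. A
  derivation therefore certifies termination and the absence of overflow together.\<close>

inductive big :: "'v com \<Rightarrow> ('v \<Rightarrow> nat) \<Rightarrow> nat list \<Rightarrow> ('v \<Rightarrow> nat) \<Rightarrow> nat list \<Rightarrow> bool" where
  Skip: "big Skip s os s os"
| Set: "k < n ^ wd a \<Longrightarrow> big (Set a k) s os (s(a := k)) os"
| Bin: "eval_op w f (s b) (s c) < n ^ wd a \<Longrightarrow>
    big (Bin f a b c) s os (s(a := eval_op w f (s b) (s c))) os"
| Inp: "input_word w inp (s b) < n ^ wd a \<Longrightarrow>
    big (Inp a b) s os (s(a := input_word w inp (s b))) os"
| Out: "big (Out a) s os s (os @ [s a])"
| Seq: "big c s os s' os' \<Longrightarrow> big d s' os' s'' os'' \<Longrightarrow> big (c ;; d) s os s'' os''"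
| IfT: "cval b s \<Longrightarrow> big c s os s' os' \<Longrightarrow> big (If b c d) s os s' os'"
| IfF: "\<not> cval b s \<Longrightarrow> big d s os s' os' \<Longrightarrow> big (If b c d) s os s' os'"
| WhileF: "\<not> cval b s \<Longrightarrow> big (While b c) s os s os"
| WhileT: "cval b s \<Longrightarrow> big c s os s' os' \<Longrightarrow> big (While b c) s' os' s'' os'' \<Longrightarrow>
    big (While b c) s os s'' os''"

end

text \<open>
  Layout of the real memory: word 0 holds all variables as digits in base \<open>n\<close>, word 1
  holds \<open>n\<close>, words 2 and 3 operands, word 4 a power of \<open>n\<close>, and word 5 an old value.
\<close>

definition pow_code :: "nat \<Rightarrow> instr list" where
  "pow_code k = Const 4 1 # replicate k (Op Mul 4 4 1)"

locale layout =
  fixes wd :: "'v \<Rightarrow> nat" and vs :: "'v list"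
begin

text \<open>\<open>offset\<close> and \<open>wd\<close> are literals, so the powers of
  \<open>n\<close> are unrolled multiplications and the length of the code does not depend on
  \<open>n\<close>.\<close>

definition get_code :: "nat \<Rightarrow> 'v \<Rightarrow> instr list" where
  "get_code a x = pow_code (offset wd vs x) @ [Op Div a 0 4] @ pow_code (wd x) @ [Op Mod a a 4]"

definition put_code :: "nat \<Rightarrow> 'v \<Rightarrow> instr list" where
  "put_code a x = get_code 5 x @ pow_code (offset wd vs x) @
     [Op Mul 5 5 4, Op Sub 0 0 5, Op Mul 5 a 4, Op Add 0 0 5]"

primrec cond_code :: "'v cond \<Rightarrow> nat \<Rightarrow> instr list" where
  "cond_code (Less a b) l = get_code 2 a @ get_code 3 b @ [JumpLess 2 3 l]"
| "cond_code (Eq a b) l = get_code 2 a @ get_code 3 b @ [JumpEq 2 3 l]"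

definition cond_len :: "'v cond \<Rightarrow> nat" where
  "cond_len b = length (cond_code b 0)"

lemma length_cond_code: "length (cond_code b l) = cond_len b"
  by (cases b) (auto simp: cond_len_def)

text \<open>Jump targets lie behind code that has not been generated yet. Its length does not depend
  on its position, so it can be computed beforehand.\<close>

primrec len :: "'v com \<Rightarrow> nat" where
  "len Skip = 0"
| "len (Set a k) = length (Const 2 k # put_code 2 a)"
| "len (Bin f a b c) = length (get_code 2 b @ get_code 3 c @ [Op f 2 2 3] @ put_code 2 a)"
| "len (Inp a b) = length (get_code 2 b @ [Input 2 2] @ put_code 2 a)"
| "len (Out a) = length (get_code 2 a @ [Output 2])"
| "len (c ;; d) = len c + len d"
| "len (If b c d) = cond_len b + len d + 1 + len c"
| "len (While b c) = cond_len b + 1 + len c + 1"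

primrec code :: "nat \<Rightarrow> 'v com \<Rightarrow> instr list" where
  "code k Skip = []"
| "code k (Set a v) = Const 2 v # put_code 2 a"
| "code k (Bin f a b c) = get_code 2 b @ get_code 3 c @ [Op f 2 2 3] @ put_code 2 a"
| "code k (Inp a b) = get_code 2 b @ [Input 2 2] @ put_code 2 a"
| "code k (Out a) = get_code 2 a @ [Output 2]"
| "code k (c ;; d) = code k c @ code (k + len c) d"
| "code k (If b c d) =
     cond_code b (k + cond_len b + len d + 1) @
     code (k + cond_len b) d @ [Jump (k + cond_len b + len d + 1 + len c)] @
     code (k + cond_len b + len d + 1) c"
| "code k (While b c) =
     cond_code b (k + cond_len b + 1) @
     [Jump (k + cond_len b + 1 + len c + 1)] @
     code (k + cond_len b + 1) c @ [Jump k]"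

lemma length_code [simp]: "length (code k c) = len c"
  by (induction c arbitrary: k) (auto simp: length_cond_code)

end

section \<open>Correctness of the compiler\<close>

locale compiler = machine w n inp wd + layout wd vs
  for w n :: nat and inp :: "nat list" and wd :: "'v \<Rightarrow> nat" and vs :: "'v list" +
  fixes m lo :: nat and P :: prog
  assumes n: "1 < n" "n < 2 ^ w" and distinct: "distinct vs" and m: "6 \<le> m"
    and fits: "n ^ total_width wd vs < 2 ^ w"
begin

abbreviation bounded :: "('v \<Rightarrow> nat) \<Rightarrow> bool" where
  "bounded s \<equiv> \<forall>v\<in>set vs. s v < n ^ wd v"

definition rep :: "('v \<Rightarrow> nat) \<Rightarrow> nat list \<Rightarrow> config \<Rightarrow> bool" where
  "rep s os cf \<longleftrightarrow> bounded s \<and> mem cf 0 = pack n wd vs s \<and> mem cf 1 = n \<and> out cf = os"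

abbreviation reaches :: "config \<Rightarrow> config \<Rightarrow> bool" where
  "reaches \<equiv> (gstep_from lo w P inp m)\<^sup>*\<^sup>*"

abbreviation run_code :: "instr list \<Rightarrow> config \<Rightarrow> config" where
  "run_code \<equiv> fold (exec w inp)"

lemma width_le: "x \<in> set vs \<Longrightarrow> offset wd vs x + wd x \<le> total_width wd vs"
  by (induction vs) auto

lemma pow_less: "x \<in> set vs \<Longrightarrow> k \<le> offset wd vs x + wd x \<Longrightarrow> n ^ k < 2 ^ w"
  using width_le[of x] power_increasing[of k "total_width wd vs" n] fits n
  by (meson le_trans less_imp_le_nat le_less_trans)

lemma pow_code_straight: "list_all (straight m) (pow_code k)"
  using m by (auto simp: pow_code_def list_all_iff)

lemma pow_code_exec:
  assumes "mem cf 1 = n" "n ^ k < 2 ^ w"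
  shows "mem (run_code (pow_code k) cf) = (mem cf)(4 := n ^ k)"
    "out (run_code (pow_code k) cf) = out cf"
proof -
  \<comment> \<open>Generalised over the value \<open>j\<close> already in word 4, because the
    induction peels off the first multiplication.\<close>
  have r: "mem (run_code (replicate k (Op Mul 4 4 1)) cf) = (mem cf)(4 := j * n ^ k) \<and>
        out (run_code (replicate k (Op Mul 4 4 1)) cf) = out cf"
    if "mem cf 1 = n" "mem cf 4 = j" "j * n ^ k < 2 ^ w" for j cf
    using that
  proof (induction k arbitrary: cf j)
    case (Suc k)
    let ?cf = "exec w inp (Op Mul 4 4 1) cf"
    have "j * n * 1 \<le> j * n * n ^ k" using n by (intro mult_left_mono) auto
    then have "j * n < 2 ^ w" using Suc.prems(3)
      by (metis le_less_trans mult.assoc mult.right_neutral power_Suc)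
    then have "mem ?cf 4 = j * n" "mem ?cf 1 = n"
      using Suc.prems by (auto simp: take_bit_nat_eq_self)
    then show ?case using Suc.IH[of ?cf "j * n"] Suc.prems(3)
      by (simp add: mult.assoc fun_upd_def fun_eq_iff)
  qed (auto simp: fun_eq_iff)
  let ?c1 = "exec w inp (Const 4 1) cf"
  have "1 < (2::nat) ^ w" using n by linarith
  then have "take_bit w 1 = (1::nat)" by (rule take_bit_nat_eq_self)
  then have "mem ?c1 4 = 1" "mem ?c1 1 = n" using assms(1) by (simp_all del: take_bit_of_1)
  from r[OF this(2,1)] assms show
    "mem (run_code (pow_code k) cf) = (mem cf)(4 := n ^ k)"
    "out (run_code (pow_code k) cf) = out cf"
    by (auto simp: pow_code_def fun_eq_iff)
qed

lemma get_code_straight: "a < 6 \<Longrightarrow> list_all (straight m) (get_code a x)"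
  using m pow_code_straight by (simp add: get_code_def)

lemma put_code_straight: "a < 6 \<Longrightarrow> list_all (straight m) (put_code a x)"
  using m pow_code_straight get_code_straight by (simp add: put_code_def)

lemma get_code_exec:
  assumes "rep s os cf" "x \<in> set vs" "a \<notin> {0, 1, 4}"
  shows "mem (run_code (get_code a x) cf) = (mem cf)(4 := n ^ wd x, a := s x)"
    "out (run_code (get_code a x) cf) = os"
proof -
  note pow = pow_code_exec
  have cf: "mem cf 1 = n" "mem cf 0 = pack n wd vs s" "bounded s" "out cf = os"
    using assms by (auto simp: rep_def)
  have lt: "n ^ offset wd vs x < 2 ^ w" "n ^ wd x < 2 ^ w" using pow_less[OF assms(2)] by auto
  have pk: "pack n wd vs s < 2 ^ w" using pack_less[OF cf(3)] fits by linarith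
  define c1 where "c1 = run_code (pow_code (offset wd vs x)) cf"
  have c1: "mem c1 = (mem cf)(4 := n ^ offset wd vs x)" "out c1 = os"
    unfolding c1_def using pow[OF cf(1) lt(1)] cf by auto
  define c2 where "c2 = exec w inp (Op Div a 0 4) c1"
  have "pack n wd vs s div n ^ offset wd vs x < 2 ^ w"
    by (meson div_le_dividend le_less_trans pk)
  then have c2: "mem c2 = (mem c1)(a := pack n wd vs s div n ^ offset wd vs x)" "out c2 = os"
    unfolding c2_def using c1 cf by (auto simp: take_bit_nat_eq_self)
  define c3 where "c3 = run_code (pow_code (wd x)) c2"
  have "mem c2 1 = n" using c2 c1 cf assms(3) by auto
  then have c3: "mem c3 = (mem c2)(4 := n ^ wd x)" "out c3 = os"
    unfolding c3_def using pow[OF _ lt(2)] c2 by auto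
  have "s x < 2 ^ w" using cf(3) assms(2) lt(2) by (meson less_trans)
  then have "mem (exec w inp (Op Mod a a 4) c3) = (mem cf)(4 := n ^ wd x, a := s x)"
    using c3 c2 c1 assms(3) pack_get[OF cf(3) assms(2)]
    by (auto simp: take_bit_nat_eq_self fun_eq_iff)
  moreover have "run_code (get_code a x) cf = exec w inp (Op Mod a a 4) c3"
    by (simp add: get_code_def c1_def c2_def c3_def)
  ultimately show "mem (run_code (get_code a x) cf) = (mem cf)(4 := n ^ wd x, a := s x)"
    "out (run_code (get_code a x) cf) = os" using c3 by auto
qed

lemma get_code_rep:
  assumes "rep s os cf" "x \<in> set vs" "a \<notin> {0, 1, 4}"
  shows "rep s os (run_code (get_code a x) cf)" "mem (run_code (get_code a x) cf) a = s x"
    "b \<notin> {a, 4} \<Longrightarrow> mem (run_code (get_code a x) cf) b = mem cf b"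
  using assms get_code_exec[OF assms] by (auto simp: rep_def)

lemma put_code_rep:
  assumes "rep s os cf" "x \<in> set vs" "mem cf a = v" "a \<notin> {0, 1, 4, 5}" "v < n ^ wd x"
  shows "rep (s(x := v)) os (run_code (put_code a x) cf)"
proof -
  define c1 where "c1 = run_code (get_code 5 x) cf"
  have c1: "mem c1 = (mem cf)(4 := n ^ wd x, 5 := s x)" "out c1 = os"
    unfolding c1_def using get_code_exec[OF assms(1,2), of 5] by auto
  have cf: "mem cf 1 = n" "mem cf 0 = pack n wd vs s" "bounded s" "out cf = os"
    using assms by (auto simp: rep_def)
  have lt: "n ^ offset wd vs x < 2 ^ w" using pow_less[OF assms(2)] by auto
  define c2 where "c2 = run_code (pow_code (offset wd vs x)) c1"
  have c2: "mem c2 = (mem c1)(4 := n ^ offset wd vs x)" "out c2 = os"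
    unfolding c2_def using pow_code_exec[OF _ lt, of c1] c1 cf by auto
  have pk: "pack n wd vs s < 2 ^ w" using pack_less[OF cf(3)] fits by linarith
  have b': "bounded (s(x := v))" using cf(3) assms(5) by auto
  have pk': "pack n wd vs (s(x := v)) < 2 ^ w" using pack_less[OF b'] fits by linarith
  let ?o = "n ^ offset wd vs x"
  \<comment> \<open>The old digit block is at most the packed word, so the machine subtraction in
    \<open>put_code\<close> does not wrap and the truncated subtraction in \<open>upd\<close> is
    exact.\<close>
  have le: "s x * ?o \<le> pack n wd vs s" by (rule pack_upd_le[OF assms(2)])
  have upd: "pack n wd vs (s(x := v)) = pack n wd vs s - s x * ?o + v * ?o"
    using pack_upd[OF distinct assms(2), of n wd s v] le by linarith
  have vle: "v * ?o < 2 ^ w" using upd pk' by linarith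
  define c3 where "c3 = exec w inp (Op Mul 5 5 4) c2"
  have c3: "mem c3 = (mem c2)(5 := s x * ?o)" "out c3 = os"
    unfolding c3_def using c2 c1 le pk by (auto simp: take_bit_nat_eq_self)
  define c4 where "c4 = exec w inp (Op Sub 0 0 5) c3"
  have v3: "mem c3 0 = pack n wd vs s" "mem c3 5 = s x * ?o" "mem c3 a = v" "mem c3 4 = ?o"
    using c3 c2 c1 cf(2) assms(3,4) by auto
  have "mem c4 = (mem c3)(0 := take_bit w (mem c3 0 + 2 ^ w - mem c3 5))" "out c4 = os"
    using c3(2) by (simp_all add: c4_def)
  moreover have "take_bit w (mem c3 0 + 2 ^ w - mem c3 5) = pack n wd vs s - s x * ?o"
  proof -
    have "mem c3 0 + 2 ^ w - mem c3 5 = (pack n wd vs s - s x * ?o) + 2 ^ w"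
      using le unfolding v3 by linarith
    then show ?thesis using pk by (simp add: take_bit_eq_mod)
  qed
  ultimately have c4: "mem c4 = (mem c3)(0 := pack n wd vs s - s x * ?o)" "out c4 = os"
    by simp_all
  define c5 where "c5 = exec w inp (Op Mul 5 a 4) c4"
  have "mem c5 = (mem c4)(5 := take_bit w (mem c4 a * mem c4 4))" "out c5 = os"
    using c4(2) by (simp_all add: c5_def)
  moreover have "mem c4 a = v" "mem c4 4 = ?o"
    using c4(1) v3 assms(4) by auto
  ultimately have c5: "mem c5 = (mem c4)(5 := v * ?o)" "out c5 = os"
    using take_bit_nat_eq_self[OF vle] by simp_all
  define c6 where "c6 = exec w inp (Op Add 0 0 5) c5"
  have "mem c6 = (mem c5)(0 := take_bit w (mem c5 0 + mem c5 5))" "out c6 = os"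
    using c5(2) by (simp_all add: c6_def)
  moreover have "mem c5 0 + mem c5 5 = pack n wd vs (s(x := v))"
    unfolding upd using c5(1) c4(1) by simp
  ultimately have c6: "mem c6 = (mem c5)(0 := pack n wd vs (s(x := v)))" "out c6 = os"
    using take_bit_nat_eq_self[OF pk'] by (simp_all del: fun_upd_apply)
  have "run_code (put_code a x) cf = c6"
    by (simp add: put_code_def c1_def c2_def c3_def c4_def c5_def c6_def)
  moreover have "rep (s(x := v)) os c6"
    using c6 c5 c4 c3 c2 c1 cf b' by (auto simp: rep_def)
  ultimately show ?thesis by simp
qed

lemma put_new_rep:
  assumes "rep s os cf" "x \<in> set vs" "straight m i" "v < n ^ wd x"
    "mem (exec w inp i cf) = (mem cf)(2 := v)" "out (exec w inp i cf) = out cf"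
  shows "rep (s(x := v)) os (run_code (i # put_code 2 x) cf)"
proof -
  have "rep s os (exec w inp i cf)" using assms by (auto simp: rep_def)
  from put_code_rep[OF this assms(2) _ _ assms(4)] assms(5) show ?thesis by simp
qed

lemma cond_code_exec:
  assumes "rep s os cf" "cvars b \<subseteq> set vs" "code_at P k (cond_code b l)" "pc cf = k" "lo \<le> k"
  obtains cf' where "reaches cf cf'" "rep s os cf'"
    "pc cf' = (if cval b s then l else k + cond_len b)"
proof -
  note found = that
  have main: thesis
    if b: "cond_code b l = get_code 2 x @ get_code 3 y @ [J]" "x \<in> set vs" "y \<in> set vs"
      "\<And>c. mem c 2 = s x \<Longrightarrow> mem c 3 = s y \<Longrightarrow>
         exec w inp J c = c\<lparr>pc := (if cval b s then l else pc c + 1)\<rparr>"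
      "\<And>c. touched J c = {2, 3}" for x y J
  proof -
    let ?g = "get_code 2 x @ get_code 3 y"
    have at: "code_at P k (?g @ [J])" using assms(3) b(1) by simp
    let ?c = "run_code ?g cf"
    have r1: "rep s os (run_code (get_code 2 x) cf)" and v1: "mem (run_code (get_code 2 x) cf) 2 = s x"
      using get_code_rep[OF assms(1) b(2), of 2] by auto
    have r2: "rep s os ?c" and v2: "mem ?c 3 = s y" "mem ?c 2 = s x"
      using get_code_rep[OF r1 b(3), of 3] v1 by auto
    have st: "reaches cf ?c \<and> pc ?c = k + length ?g"
      using at assms(4,5) get_code_straight
      by (intro straight_reaches) (auto simp: code_at_append)
    have "gstep_from lo w P inp m ?c (exec w inp J ?c)"
      using at st b(5) m assms(5) by (auto simp: gstep_from_def gstep_def step_def halted_def code_at_append code_at_single add.assoc)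
    with st have "reaches cf (exec w inp J ?c)" by auto
    moreover have "exec w inp J ?c = ?c\<lparr>pc := (if cval b s then l else pc ?c + 1)\<rparr>"
      using v2 by (intro b(4)) auto
    moreover have "pc ?c + 1 = k + cond_len b"
      using st length_cond_code[of b l] b(1) by simp
    ultimately show thesis
      using r2 by (intro found[of "exec w inp J ?c"]) (auto simp: rep_def)
  qed
  show thesis
  proof (cases b)
    case (Less x y)
    then show thesis using assms(2) by (intro main[of x y "JumpLess 2 3 l"]) auto
  next
    case (Eq x y)
    then show thesis using assms(2) by (intro main[of x y "JumpEq 2 3 l"]) auto
  qed
qed

lemma jump_reaches:
  assumes "code_at P k [Jump l]" "pc cf = k" "lo \<le> k"
  shows "reaches cf (cf\<lparr>pc := l\<rparr>)"
proof -
  have "gstep_from lo w P inp m cf (cf\<lparr>pc := l\<rparr>)"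
    using assms by (auto simp: gstep_from_def gstep_def step_def halted_def code_at_single)
  then show ?thesis by auto
qed

text \<open>The induction is on the derivation, so the loop case may use the hypothesis for the
  remaining iterations. One direction of simulation suffices because the machine is
  deterministic.\<close>

lemma code_correct:
  assumes "big c s os s' os'" "vars c \<subseteq> set vs" "code_at P k (code k c)" "pc cf = k" "rep s os cf" "lo \<le> k"
  shows "\<exists>cf'. reaches cf cf' \<and> rep s' os' cf' \<and> pc cf' = k + len c"
  using assms
proof (induction arbitrary: k cf rule: big.induct)
  case (Skip s os)
  then show ?case by auto
next
  case (Set v a s os)
  let ?cs = "Const 2 v # put_code 2 a"
  have "v < 2 ^ w" using Set.hyps pow_less[of a "wd a"] Set.prems by (auto intro: less_trans)
  then have "rep (s(a := v)) os (run_code ?cs cf)"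
    using Set m by (intro put_new_rep) (auto simp: take_bit_nat_eq_self)
  moreover have "reaches cf (run_code ?cs cf) \<and> pc (run_code ?cs cf) = k + length ?cs"
    using Set.prems put_code_straight m by (intro straight_reaches) auto
  ultimately show ?case unfolding len.simps by blast
next
  case (Bin f s b c a os)
  let ?v = "eval_op w f (s b) (s c)"
  let ?cs = "get_code 2 b @ get_code 3 c @ [Op f 2 2 3] @ put_code 2 a"
  let ?c1 = "run_code (get_code 2 b) cf"
  have r1: "rep s os ?c1" "mem ?c1 2 = s b"
    using get_code_rep[OF Bin.prems(4), of b 2] Bin.prems(1) by auto
  let ?c2 = "run_code (get_code 3 c) ?c1"
  have r2: "rep s os ?c2" "mem ?c2 3 = s c" "mem ?c2 2 = s b"
    using get_code_rep[OF r1(1), of c 3] r1 Bin.prems(1) by auto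
  have "rep (s(a := ?v)) os (run_code (Op f 2 2 3 # put_code 2 a) ?c2)"
    using r2 Bin.hyps Bin.prems(1) m by (intro put_new_rep) auto
  then have "rep (s(a := ?v)) os (run_code ?cs cf)" by simp
  moreover have "reaches cf (run_code ?cs cf) \<and> pc (run_code ?cs cf) = k + length ?cs"
    using Bin.prems put_code_straight get_code_straight m by (intro straight_reaches) auto
  ultimately show ?case unfolding len.simps by blast
next
  case (Inp s b a os)
  let ?v = "input_word w inp (s b)"
  let ?cs = "get_code 2 b @ [Input 2 2] @ put_code 2 a"
  let ?c1 = "run_code (get_code 2 b) cf"
  have r1: "rep s os ?c1" "mem ?c1 2 = s b"
    using get_code_rep[OF Inp.prems(4), of b 2] Inp.prems(1) by auto
  have "rep (s(a := ?v)) os (run_code (Input 2 2 # put_code 2 a) ?c1)"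
    using r1 Inp.hyps Inp.prems(1) m by (intro put_new_rep) auto
  then have "rep (s(a := ?v)) os (run_code ?cs cf)" by simp
  moreover have "reaches cf (run_code ?cs cf) \<and> pc (run_code ?cs cf) = k + length ?cs"
    using Inp.prems put_code_straight get_code_straight m by (intro straight_reaches) auto
  ultimately show ?case unfolding len.simps by blast
next
  case (Out a s os)
  let ?cs = "get_code 2 a @ [Output 2]"
  let ?c1 = "run_code (get_code 2 a) cf"
  have r1: "rep s os ?c1" "mem ?c1 2 = s a"
    using get_code_rep[OF Out.prems(4), of a 2] Out.prems(1) by auto
  moreover have "reaches cf (run_code ?cs cf) \<and> pc (run_code ?cs cf) = k + length ?cs"
    using Out.prems get_code_straight m by (intro straight_reaches) auto
  ultimately show ?case by (intro exI[of _ "run_code ?cs cf"]) (auto simp: rep_def)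
next
  case (Seq c s os s' os' d s'' os'')
  obtain c1 where c1: "reaches cf c1" "rep s' os' c1" "pc c1 = k + len c"
    using Seq.IH(1)[of k cf] Seq.prems by (auto simp: code_at_append)
  obtain c2 where "reaches c1 c2" "rep s'' os'' c2" "pc c2 = k + len c + len d"
    using Seq.IH(2)[of "k + len c" c1] Seq.prems c1 by (auto simp: code_at_append)
  with c1(1) show ?case by (intro exI[of _ c2]) auto
next
  case (IfT b s c os s' os' d)
  have at: "code_at P k (cond_code b (k + cond_len b + len d + 1))"
    "code_at P (k + cond_len b + len d + 1) (code (k + cond_len b + len d + 1) c)"
    using IfT.prems(2) by (auto simp: code_at_append length_cond_code code_at_Cons add_ac)
  obtain c1 where c1: "reaches cf c1" "rep s os c1" "pc c1 = k + cond_len b + len d + 1"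
    using cond_code_exec[OF IfT.prems(4) _ at(1) IfT.prems(3,5)] IfT.prems(1) IfT.hyps(1) by auto
  obtain c2 where "reaches c1 c2" "rep s' os' c2" "pc c2 = k + cond_len b + len d + 1 + len c"
    using IfT.IH[OF _ at(2) c1(3,2)] IfT.prems(1,5) by auto
  with c1(1) show ?case by (intro exI[of _ c2]) auto
next
  case (IfF b s d os s' os' c)
  have at: "code_at P k (cond_code b (k + cond_len b + len d + 1))"
    "code_at P (k + cond_len b) (code (k + cond_len b) d)"
    "code_at P (k + cond_len b + len d) [Jump (k + cond_len b + len d + 1 + len c)]"
    using IfF.prems(2) by (auto simp: code_at_append length_cond_code code_at_Cons code_at_single add_ac)
  obtain c1 where c1: "reaches cf c1" "rep s os c1" "pc c1 = k + cond_len b"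
    using cond_code_exec[OF IfF.prems(4) _ at(1) IfF.prems(3,5)] IfF.prems(1) IfF.hyps(1) by auto
  obtain c2 where c2: "reaches c1 c2" "rep s' os' c2" "pc c2 = k + cond_len b + len d"
    using IfF.IH[OF _ at(2) c1(3,2)] IfF.prems(1,5) by auto
  note j = jump_reaches[OF at(3) c2(3) trans_le_add1[OF trans_le_add1[OF IfF.prems(5)]]]
  have "reaches cf (c2\<lparr>pc := k + cond_len b + len d + 1 + len c\<rparr>)"
    using c1(1) c2(1) j by (meson rtranclp_trans)
  then show ?case using c2(2) by (auto simp: rep_def add_ac intro!: exI)
next
  case (WhileF b s c os)
  have at: "code_at P k (cond_code b (k + cond_len b + 1))"
    "code_at P (k + cond_len b) [Jump (k + cond_len b + 1 + len c + 1)]"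
    using WhileF.prems(2) by (auto simp: code_at_append length_cond_code code_at_Cons code_at_single add_ac)
  obtain c1 where c1: "reaches cf c1" "rep s os c1" "pc c1 = k + cond_len b"
    using cond_code_exec[OF WhileF.prems(4) _ at(1) WhileF.prems(3,5)] WhileF.prems(1) WhileF.hyps(1) by auto
  note j = jump_reaches[OF at(2) c1(3) trans_le_add1[OF WhileF.prems(5)]]
  have "reaches cf (c1\<lparr>pc := k + cond_len b + 1 + len c + 1\<rparr>)"
    using c1(1) j by (meson rtranclp_trans)
  then show ?case using c1(2) by (auto simp: rep_def add_ac intro!: exI)
next
  case (WhileT b s c os s' os' s'' os'')
  have at: "code_at P k (cond_code b (k + cond_len b + 1))"
    "code_at P (k + cond_len b + 1) (code (k + cond_len b + 1) c)"
    "code_at P (k + cond_len b + 1 + len c) [Jump k]"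
    using WhileT.prems(2) by (auto simp: code_at_append length_cond_code code_at_Cons code_at_single add_ac)
  obtain c1 where c1: "reaches cf c1" "rep s os c1" "pc c1 = k + cond_len b + 1"
    using cond_code_exec[OF WhileT.prems(4) _ at(1) WhileT.prems(3,5)] WhileT.prems(1) WhileT.hyps(1) by auto
  obtain c2 where c2: "reaches c1 c2" "rep s' os' c2" "pc c2 = k + cond_len b + 1 + len c"
    using WhileT.IH(1)[OF _ at(2) c1(3,2)] WhileT.prems(1,5) by auto
  note j = jump_reaches[OF at(3) c2(3) trans_le_add1[OF trans_le_add1[OF trans_le_add1[OF WhileT.prems(5)]]]]
  obtain c3 where c3: "reaches (c2\<lparr>pc := k\<rparr>) c3" "rep s'' os'' c3" "pc c3 = k + len (While b c)"
    using WhileT.IH(2)[of k "c2\<lparr>pc := k\<rparr>"] WhileT.prems c2 by (auto simp: rep_def)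
  show ?case using c1(1) c2(1) j c3 by (meson rtranclp_trans)
qed

end

section \<open>The threshold algorithm and its program\<close>

definition sample :: "(nat \<Rightarrow> bool) \<Rightarrow> nat set list \<Rightarrow> nat set \<Rightarrow> nat list" where
  "sample h Ss A = filter (\<lambda>j. h j \<and> Ss ! j \<inter> A = {}) [0..<length Ss]"

text \<open>Ranks from \<open>L\<close> on are ignored. The search also runs the tests on advice
  with oversized samples, and the cap keeps all counters of a round within their short
  width.\<close>

definition hit_count :: "nat \<Rightarrow> nat set list \<Rightarrow> nat list \<Rightarrow> nat set \<Rightarrow> nat \<Rightarrow> nat" where
  "hit_count L Ss T A v =
     card {i. i < L \<and> i < length T \<and> v \<in> Ss ! (T ! i) \<and> Ss ! (T ! i) \<inter> A = {}}"

text \<open>A threshold 0, which the search also tries, selects every natural number; this is why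
  \<open>good\<close> and \<open>result\<close> later restrict to vertices below
  \<open>n\<close>.\<close>

primrec rounds_set ::
  "nat \<Rightarrow> nat set list \<Rightarrow> nat list \<Rightarrow> (nat \<Rightarrow> nat) \<Rightarrow> nat set \<Rightarrow> nat \<Rightarrow> nat set" where
  "rounds_set L Ss T \<tau> A 0 = A"
| "rounds_set L Ss T \<tau> A (Suc r) = rounds_set L Ss T \<tau> A r \<union>
     {v. \<tau> r \<le> hit_count L Ss T (rounds_set L Ss T \<tau> A r) v}"

primrec phases_set ::
  "nat \<Rightarrow> nat set list \<Rightarrow> (nat \<Rightarrow> nat \<Rightarrow> bool) \<Rightarrow> (nat \<Rightarrow> nat \<Rightarrow> nat) \<Rightarrow> nat \<Rightarrow> nat \<Rightarrow> nat set" where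
  "phases_set L Ss h \<tau> R 0 = {}"
| "phases_set L Ss h \<tau> R (Suc p) =
     rounds_set L Ss (sample (h p) Ss (phases_set L Ss h \<tau> R p)) (\<tau> p) (phases_set L Ss h \<tau> R p) R"

section \<open>Loops, frames and weakest preconditions\<close>

definition For :: "'v \<Rightarrow> 'v \<Rightarrow> 'v \<Rightarrow> 'v com \<Rightarrow> 'v com" where
  "For one x ub c = Set x 0 ;; While (Less x ub) (c ;; Bin Add x x one)"

definition frame :: "'v set \<Rightarrow> ('v \<Rightarrow> nat) \<Rightarrow> ('v \<Rightarrow> nat) \<Rightarrow> bool" where
  "frame W s s' \<longleftrightarrow> (\<forall>z. z \<notin> W \<longrightarrow> s' z = s z)"

lemma frame_refl: "frame W s s"
  by (simp add: frame_def)

lemma frame_upd: "frame W s s' \<Longrightarrow> x \<in> W \<Longrightarrow> frame W s (s'(x := k))"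
  by (auto simp: frame_def)

lemma frame_trans: "frame W s s' \<Longrightarrow> frame V s' s'' \<Longrightarrow> V \<subseteq> W \<Longrightarrow> frame W s s''"
  by (auto simp: frame_def)

lemma frameD: "frame W s s' \<Longrightarrow> z \<notin> W \<Longrightarrow> s' z = s z"
  by (auto simp: frame_def)

context machine
begin

definition wp :: "'v com \<Rightarrow> (('v \<Rightarrow> nat) \<Rightarrow> nat list \<Rightarrow> bool) \<Rightarrow> ('v \<Rightarrow> nat) \<Rightarrow> nat list \<Rightarrow> bool" where
  "wp c Q s os \<longleftrightarrow> (\<exists>s' os'. big c s os s' os' \<and> Q s' os')"

lemma wp_Skip: "Q s os \<Longrightarrow> wp Skip Q s os"
  by (auto simp: wp_def intro: big.intros)

lemma wp_Set: "k < n ^ wd a \<Longrightarrow> Q (s(a := k)) os \<Longrightarrow> wp (Set a k) Q s os"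
  unfolding wp_def by (blast intro: big.intros)

lemma wp_Out: "Q s (os @ [s a]) \<Longrightarrow> wp (Out a) Q s os"
  unfolding wp_def by (blast intro: big.intros)

lemma wp_Inp: "input_word w inp (s b) < n ^ wd a \<Longrightarrow> Q (s(a := input_word w inp (s b))) os \<Longrightarrow>
    wp (Inp a b) Q s os"
  unfolding wp_def by (blast intro: big.intros)

lemma wp_Seq: "wp c (wp d Q) s os \<Longrightarrow> wp (c ;; d) Q s os"
  unfolding wp_def by (blast intro: big.intros)

lemma wp_If: "(cval b s \<Longrightarrow> wp c Q s os) \<Longrightarrow> (\<not> cval b s \<Longrightarrow> wp d Q s os) \<Longrightarrow> wp (If b c d) Q s os"
  unfolding wp_def by (cases "cval b s") (blast intro: big.intros)+

lemma wp_mono: "wp c Q s os \<Longrightarrow> (\<And>s' os'. Q s' os' \<Longrightarrow> Q' s' os') \<Longrightarrow> wp c Q' s os"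
  unfolding wp_def by blast

end

locale wide_machine = machine +
  assumes wide: "n ^ wd z \<le> 2 ^ w" "0 < wd z" and n_gt2: "2 < n"
begin

lemma const_less: "k \<le> 2 \<Longrightarrow> k < n ^ wd z"
  using self_le_power[of n "wd z"] wide(2)[of z] n_gt2 by linarith

lemma wp_Bin:
  assumes "eval_op w f (s b) (s c) = v" "v < n ^ wd a" "Q (s(a := v)) os"
  shows "wp (Bin f a b c) Q s os"
  using assms unfolding wp_def by (blast intro: big.intros)

lemma wp_Add: "s b + s c < n ^ wd a \<Longrightarrow> Q (s(a := s b + s c)) os \<Longrightarrow> wp (Bin Add a b c) Q s os"
  using wide(1)[of a] by (intro wp_Bin) (auto simp: take_bit_nat_eq_self)

lemma wp_Mul: "s b * s c < n ^ wd a \<Longrightarrow> Q (s(a := s b * s c)) os \<Longrightarrow> wp (Bin Mul a b c) Q s os"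
  using wide(1)[of a] by (intro wp_Bin) (auto simp: take_bit_nat_eq_self)

lemma wp_Mod:
  "s b < n ^ wd a \<Longrightarrow> Q (s(a := s b mod s c)) os \<Longrightarrow> wp (Bin Mod a b c) Q s os"
proof -
  assume *: "s b < n ^ wd a" "Q (s(a := s b mod s c)) os"
  have "s b mod s c < n ^ wd a" using *(1) by (meson le_less_trans mod_less_eq_dividend)
  then show ?thesis using wide(1)[of a] *(2) by (intro wp_Bin) (auto simp: take_bit_nat_eq_self)
qed

text \<open>The invariant is indexed by the number of finished iterations and, by
  \<open>upd\<close>, does not see the loop variable, which is reset before the loop and incremented
  after the body. The bound \<open>L < n ^ wd x\<close> is strict because \<open>x\<close> ends at
  \<open>L\<close>. Frames refer to a fixed earlier state \<open>s0\<close>, so they are not chained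
  from iteration to iteration.\<close>

lemma wp_For:
  assumes L: "s ub = L" "s one = 1" "L < n ^ wd x" "ub \<notin> W" "one \<notin> W" "x \<in> W"
    and init: "frame W s0 s" "I 0 s os"
    and upd: "\<And>i k s os. I i s os \<Longrightarrow> k \<le> L \<Longrightarrow> I i (s(x := k)) os"
    and step: "\<And>i s os. i < L \<Longrightarrow> frame W s0 s \<Longrightarrow> s x = i \<Longrightarrow> I i s os \<Longrightarrow>
       wp c (\<lambda>s' os'. frame W s0 s' \<and> s' x = i \<and> I (Suc i) s' os') s os"
    and post: "\<And>s os. frame W s0 s \<Longrightarrow> I L s os \<Longrightarrow> Q s os"
  shows "wp (For one x ub c) Q s os"
proof -
  have fr: "s' ub = L" "s' one = 1" if "frame W s0 s'" for s'
    using frameD[OF that L(4)] frameD[OF init(1) L(4)] frameD[OF that L(5)] frameD[OF init(1) L(5)] L(1,2)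
    by auto
  have loop: "\<exists>s' os'. big (While (Less x ub) (c ;; Bin Add x x one)) s os s' os' \<and>
      frame W s0 s' \<and> I L s' os'"
    if "i \<le> L" "frame W s0 s" "s x = i" "I i s os" for i s os
    using that
  proof (induction "L - i" arbitrary: i s os)
    case 0
    then have "i = L" by simp
    then have "\<not> cval (Less x ub) s" using 0 fr by auto
    then show ?case using 0 \<open>i = L\<close> by (blast intro: big.intros)
  next
    case (Suc m)
    then have i: "i < L" by simp
    from step[OF i Suc.prems(2-4)] obtain s1 os1 where s1:
      "big c s os s1 os1" "frame W s0 s1" "s1 x = i" "I (Suc i) s1 os1"
      unfolding wp_def by blast
    let ?s2 = "s1(x := Suc i)"
    have "wp (Bin Add x x one) (\<lambda>s' os'. s' = ?s2 \<and> os' = os1) s1 os1"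
      using i L(3) s1 fr[OF s1(2)] by (intro wp_Add) auto
    then have b: "big (c ;; Bin Add x x one) s os ?s2 os1"
      using s1(1) unfolding wp_def by (blast intro: big.intros)
    have "\<exists>s' os'. big (While (Less x ub) (c ;; Bin Add x x one)) ?s2 os1 s' os' \<and>
      frame W s0 s' \<and> I L s' os'"
      using i Suc.hyps(2) s1 upd frame_upd[OF s1(2) L(6)] by (intro Suc.hyps(1)[of "Suc i"]) auto
    moreover have "cval (Less x ub) s" using i Suc.prems fr by auto
    ultimately show ?case using b by (blast intro: big.intros)
  qed
  have f0: "frame W s0 (s(x := 0))" by (rule frame_upd[OF init(1) L(6)])
  obtain s' os' where
    "big (While (Less x ub) (c ;; Bin Add x x one)) (s(x := 0)) os s' os'" "frame W s0 s'" "I L s' os'"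
    using loop[OF _ f0, of 0 os] upd[OF init(2)] by auto
  moreover have "big (Set x 0) s os (s(x := 0)) os"
    using const_less[of 0 x] by (intro big.intros) simp
  ultimately show ?thesis
    using post unfolding For_def wp_def by (blast intro: big.intros)
qed

end

section \<open>Variables and text of the program\<close>

datatype gl = One | NN | MM | CAP | VL | TOP | QQ | SZ | DONE | GOOD | CNT | GV | GF | GJ | GPOS | GSIZ | GE | GEL | HIT
datatype adv = HA | HB | HT
datatype phv = PJ | PPOS | PC | PH | PSIZ | PE | PEL | PG | PAL
datatype rdv = RI | RU | RG | ROK | RCNT

text \<open>Nested tests run without a stack, hence a copy of the variables for each phase and each
  round. Among the global ones \<open>CAP\<close> is the sample cap, \<open>VL\<close> the bound on
  the hash parameters, \<open>TOP\<close> is \<open>n + 1\<close>, \<open>QQ\<close> the hash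
  modulus and \<open>SZ\<close> the target size. \<open>HA\<close>, \<open>HB\<close> and
  \<open>HT\<close> are the coefficients and the cut-off of the hash of one phase.\<close>

datatype vr = Gl gl | Adv nat adv | Tau nat nat | Ph nat phv | Rd nat nat rdv

abbreviation "one \<equiv> Gl One"

text \<open>The set stored at \<open>pos\<close> starts with its size, so its element
  \<open>e\<close> is at \<open>pos + e + 1\<close>.\<close>

abbreviation each :: "vr \<Rightarrow> vr \<Rightarrow> vr \<Rightarrow> vr \<Rightarrow> vr com \<Rightarrow> vr com" where
  "each pos sz e el c \<equiv>
     For one e sz (Bin Add el pos e ;; Bin Add el el one ;; Inp el el ;; c)"

type_synonym test = "vr \<Rightarrow> vr \<Rightarrow> vr com"

text \<open>
  \<open>mem_code p T i u f\<close>: is \<open>u\<close> in the \<open>i\<close>-th set of the sample of phase \<open>p\<close>? The sample consists of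
  the hashed sets that avoid the set decided by \<open>T\<close>.
\<close>

definition mem_code :: "nat \<Rightarrow> test \<Rightarrow> vr \<Rightarrow> vr \<Rightarrow> vr \<Rightarrow> vr com" where
  "mem_code p T i u f =
     Set f 0 ;; Set (Ph p PC) 0 ;; Set (Ph p PPOS) 2 ;;
     For one (Ph p PJ) (Gl MM) (
       Bin Mul (Ph p PH) (Adv p HA) (Ph p PJ) ;; Bin Add (Ph p PH) (Ph p PH) (Adv p HB) ;;
       Bin Mod (Ph p PH) (Ph p PH) (Gl QQ) ;; Inp (Ph p PSIZ) (Ph p PPOS) ;;
       If (Less (Ph p PH) (Adv p HT)) (
         Set (Ph p PAL) 1 ;;
         each (Ph p PPOS) (Ph p PSIZ) (Ph p PE) (Ph p PEL) (
           T (Ph p PEL) (Ph p PG) ;; If (Eq (Ph p PG) one) (Set (Ph p PAL) 0) Skip) ;;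
         If (Eq (Ph p PAL) one) (
           If (Eq (Ph p PC) i) (
             each (Ph p PPOS) (Ph p PSIZ) (Ph p PE) (Ph p PEL) (
               If (Eq (Ph p PEL) u) (Set f 1) Skip)) Skip ;;
           Bin Add (Ph p PC) (Ph p PC) one) Skip) Skip ;;
       Bin Add (Ph p PPOS) (Ph p PPOS) (Ph p PSIZ) ;; Bin Add (Ph p PPOS) (Ph p PPOS) one)"

text \<open>The disjointness test runs through all vertices \<open>u\<close> and asks
  \<open>mem_code\<close> whether \<open>u\<close> is in the \<open>i\<close>-th sampled set.
  Running through the elements of the set instead would need a pointer into the family that survives
  the inner test \<open>T\<close>, that is, a long variable in every round.\<close>

definition round_code :: "nat \<Rightarrow> nat \<Rightarrow> test \<Rightarrow> test \<Rightarrow> test" where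
  "round_code p r T0 T X Y =
     T X Y ;; Set (Rd p r RCNT) 0 ;;
     For one (Rd p r RI) (Gl CAP) (
       mem_code p T0 (Rd p r RI) X (Rd p r ROK) ;;
       For one (Rd p r RU) (Gl NN) (
         mem_code p T0 (Rd p r RI) (Rd p r RU) (Rd p r RG) ;;
         If (Eq (Rd p r RG) one) (
           T (Rd p r RU) (Rd p r RG) ;; If (Eq (Rd p r RG) one) (Set (Rd p r ROK) 0) Skip) Skip) ;;
       Bin Add (Rd p r RCNT) (Rd p r RCNT) (Rd p r ROK)) ;;
     If (Less (Rd p r RCNT) (Tau p r)) Skip (Set Y 1)"

text \<open>Tests are inlined, and a round contains the previous one twice, so the text is
  exponentially long in the number of rounds. Its length depends on \<open>d\<close> and
  \<open>R\<close> only, and the cut-off \<open>N\<close> is chosen above it.\<close>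

primrec rounds_code :: "nat \<Rightarrow> test \<Rightarrow> nat \<Rightarrow> test" where
  "rounds_code p T0 0 = T0"
| "rounds_code p T0 (Suc r) = round_code p r T0 (rounds_code p T0 r)"

primrec phase_code :: "nat \<Rightarrow> nat \<Rightarrow> test" where
  "phase_code R 0 = (\<lambda>X Y. Set Y 0)"
| "phase_code R (Suc p) = rounds_code p (phase_code R p) R"

definition check_code :: "test \<Rightarrow> vr com" where
  "check_code T =
     Set (Gl GOOD) 1 ;; Set (Gl CNT) 0 ;;
     For one (Gl GV) (Gl NN) (T (Gl GV) (Gl GF) ;; Bin Add (Gl CNT) (Gl CNT) (Gl GF)) ;;
     If (Less (Gl SZ) (Gl CNT)) (Set (Gl GOOD) 0) Skip ;;
     Set (Gl GPOS) 2 ;;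
     For one (Gl GJ) (Gl MM) (
       Inp (Gl GSIZ) (Gl GPOS) ;; Set (Gl HIT) 0 ;;
       each (Gl GPOS) (Gl GSIZ) (Gl GE) (Gl GEL) (
         T (Gl GEL) (Gl GF) ;; If (Eq (Gl GF) one) (Set (Gl HIT) 1) Skip) ;;
       If (Eq (Gl HIT) one) Skip (Set (Gl GOOD) 0) ;;
       Bin Add (Gl GPOS) (Gl GPOS) (Gl GSIZ) ;; Bin Add (Gl GPOS) (Gl GPOS) one)"

definition try_code :: "test \<Rightarrow> vr com" where
  "try_code T =
     If (Eq (Gl DONE) one) Skip (
       check_code T ;;
       If (Eq (Gl GOOD) one) (
         For one (Gl GV) (Gl NN) (T (Gl GV) (Gl GF) ;; If (Eq (Gl GF) one) (Out (Gl GV)) Skip) ;;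
         Set (Gl DONE) 1) Skip)"

primrec enum_code :: "(vr \<times> vr) list \<Rightarrow> vr com \<Rightarrow> vr com" where
  "enum_code [] c = c"
| "enum_code (y # ys) c = For one (fst y) (snd y) (enum_code ys c)"

primrec pow_com :: "vr \<Rightarrow> nat \<Rightarrow> vr com" where
  "pow_com x 0 = Set x 1"
| "pow_com x (Suc k) = pow_com x k ;; Bin Mul x x (Gl NN)"

definition advice :: "nat \<Rightarrow> nat \<Rightarrow> (vr \<times> vr) list" where
  "advice D R = (Gl QQ, Gl VL) #
     [(Adv p a, Gl VL). p \<leftarrow> [0..<D], a \<leftarrow> [HA, HB, HT]] @
     [(Tau p r, Gl CAP). p \<leftarrow> [0..<D], r \<leftarrow> [0..<R]]"

text \<open>Output cannot be retracted, so \<open>try_code\<close> checks a candidate in full before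
  printing it, and \<open>DONE\<close> blocks all later ones. \<open>TOP\<close> is
  \<open>n + 1\<close> to let the target size run up to \<open>n\<close> inclusive.\<close>

definition main_code :: "nat \<Rightarrow> nat \<Rightarrow> nat \<Rightarrow> nat \<Rightarrow> vr com" where
  "main_code D R kl kv =
     Set one 1 ;; Set (Gl NN) 0 ;; Inp (Gl NN) (Gl NN) ;; Inp (Gl MM) one ;;
     pow_com (Gl CAP) kl ;; pow_com (Gl VL) kv ;; Set (Gl DONE) 0 ;; Bin Add (Gl TOP) (Gl NN) one ;;
     For one (Gl SZ) (Gl TOP) (enum_code (advice D R) (try_code (phase_code R D)))"

section \<open>Positions of the sets in the input\<close>

primrec setpos :: "nat list list \<Rightarrow> nat \<Rightarrow> nat" where
  "setpos As 0 = 2"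
| "setpos As (Suc j) = setpos As j + length (As ! j) + 1"

abbreviation listing :: "nat list list \<Rightarrow> nat list" where
  "listing As \<equiv> concat (map (\<lambda>A. length A # A) As)"

lemma setpos_take: "j \<le> length As \<Longrightarrow> setpos As j = 2 + length (listing (take j As))"
  by (induction j) (auto simp: take_Suc_conv_app_nth)

lemma setpos_nth:
  assumes "j < length As" "x = a # b # listing As"
  shows "setpos As j < length x" "x ! setpos As j = length (As ! j)"
    "k < length (As ! j) \<Longrightarrow> setpos As j + k + 1 < length x"
    "k < length (As ! j) \<Longrightarrow> x ! (setpos As j + k + 1) = As ! j ! k"
proof -
  define A ys zs where "A = As ! j" and "ys = take j As" and "zs = drop (Suc j) As"
  have "As = ys @ A # zs"
    using assms(1) by (simp add: id_take_nth_drop A_def ys_def zs_def)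
  then have x: "x = (a # b # listing ys) @ length A # A @ listing zs"
    using assms(2) by simp
  have p: "setpos As j = length (a # b # listing ys)"
    using setpos_take[of j As] assms(1) by (simp add: ys_def)
  show "setpos As j < length x" unfolding p x by simp
  show "x ! setpos As j = length (As ! j)" unfolding p x A_def[symmetric] by (rule nth_append_length)
  show "setpos As j + k + 1 < length x" if "k < length (As ! j)"
    unfolding p x using that by (simp add: A_def)
  show "x ! (setpos As j + k + 1) = As ! j ! k" if "k < length (As ! j)"
    unfolding p x A_def[symmetric] using that by (simp add: nth_append A_def)
qed

lemma setpos_le: "j \<le> length As \<Longrightarrow> setpos As j \<le> length (a # b # listing As)"
proof -
  assume j: "j \<le> length As"
  have "length (listing (take j As)) \<le> length (listing (take j As @ drop j As))"
    by (simp only: map_append concat_append length_append)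
  then show ?thesis using setpos_take[OF j] by simp
qed

section \<open>Correctness of the membership tests\<close>

definition fixed :: "vr set" where
  "fixed = Gl ` {One, NN, MM, CAP, QQ} \<union> {Adv p a | p a. True} \<union> {Tau p r | p r. True}"

definition hashed :: "(vr \<Rightarrow> nat) \<Rightarrow> nat \<Rightarrow> nat \<Rightarrow> bool" where
  "hashed \<alpha> p j \<longleftrightarrow> (\<alpha> (Adv p HA) * j + \<alpha> (Adv p HB)) mod \<alpha> (Gl QQ) < \<alpha> (Adv p HT)"

text \<open>The variables that may hold input words, positions in the input or numbers of sets. Hash
  parameters are wide as well, but their range is governed by the bound \<open>vl\<close> of the
  locale \<open>main\<close>.\<close>

fun is_long :: "vr \<Rightarrow> bool" where
  "is_long (Gl g) \<longleftrightarrow> True"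
| "is_long (Ph p a) \<longleftrightarrow> True"
| "is_long _ \<longleftrightarrow> False"

locale alg = wide_machine w n inp wd
  for w n :: nat and inp :: "nat list" and wd :: "vr \<Rightarrow> nat" +
  fixes As :: "nat list list" and L :: nat
  assumes inp: "inp = n # length As # listing As"
    and is_long: "is_long z \<Longrightarrow> length inp + 1 < n ^ wd z"
    and is_long_entry: "is_long z \<Longrightarrow> v \<in> set inp \<Longrightarrow> v < n ^ wd z"
    and short: "n < n ^ wd z" "L < n ^ wd z"
    and ground: "A \<in> set As \<Longrightarrow> set A \<subseteq> {..<n}"
begin

abbreviation "Ss \<equiv> map set As"

lemma long: "length inp + 1 < n ^ wd (Gl g)" "length inp + 1 < n ^ wd (Ph p a)"
  and entries: "v \<in> set inp \<Longrightarrow> v < n ^ wd (Gl g)" "v \<in> set inp \<Longrightarrow> v < n ^ wd (Ph p a)"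
  using is_long is_long_entry by auto

lemma input_word_nth: "i < length inp \<Longrightarrow> input_word w inp i = inp ! i"
  using entries(1)[of "inp ! i" One] wide(1)[of "Gl One"]
  by (auto simp: input_word_def intro!: take_bit_nat_eq_self)

lemma wp_each:
  assumes j: "j < length As" "s pos = setpos As j" "s sz = length (As ! j)" "s one = 1"
    and vars: "pos \<notin> W" "sz \<notin> W" "one \<notin> W" "e \<in> W" "el \<in> W" "e \<noteq> el"
    and long': "is_long e" "is_long el"
    and init: "I 0 s os"
    and upd: "\<And>k s s' os. I k s os \<Longrightarrow> (\<And>z. z \<noteq> e \<Longrightarrow> z \<noteq> el \<Longrightarrow> s' z = s z) \<Longrightarrow> I k s' os"
    and step: "\<And>k s' os. k < length (As ! j) \<Longrightarrow> frame W s s' \<Longrightarrow> s' e = k \<Longrightarrow> s' el = As ! j ! k \<Longrightarrow>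
       I k s' os \<Longrightarrow> wp c (\<lambda>s'' os'. frame W s s'' \<and> s'' e = k \<and> I (Suc k) s'' os') s' os"
    and post: "\<And>s' os. frame W s s' \<Longrightarrow> I (length (As ! j)) s' os \<Longrightarrow> Q s' os"
  shows "wp (each pos sz e el c) Q s os"
proof (rule wp_For[where L = "length (As ! j)" and I = I and W = W and ?s0.0 = s])
  note nth = setpos_nth[OF j(1) inp]
  have lg: "length inp + 1 < n ^ wd e" "length inp + 1 < n ^ wd el" "\<And>v. v \<in> set inp \<Longrightarrow> v < n ^ wd el"
    using long' is_long is_long_entry by auto
  show "length (As ! j) < n ^ wd e"
  proof (cases "length (As ! j)")
    case 0 then show ?thesis using const_less[of 0 e] by simp
  next
    case (Suc m) then show ?thesis using nth(3)[of m] lg by simp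
  qed
  show "s sz = length (As ! j)" "s one = 1" "sz \<notin> W" "one \<notin> W" "e \<in> W" by fact+
  show "frame W s s" by (rule frame_refl)
  show "I 0 s os" by fact
  show "I i (s(e := k)) os" if "I i s os" for i k s os using upd[OF that] by auto
  show "Q s' os" if "frame W s s'" "I (length (As ! j)) s' os" for s' os using post that .
  fix k s' os assume k: "k < length (As ! j)" "frame W s s'" "s' e = k" "I k s' os"
  have fr: "s' pos = setpos As j" "s' one = 1" using frameD[OF k(2)] vars j by auto
  let ?s = "s'(el := setpos As j + k, el := setpos As j + k + 1, el := As ! j ! k)"
  have el: "pos \<noteq> el" "one \<noteq> el" using vars by auto
  have I: "I k ?s os" by (rule upd[OF k(4)]) auto
  have "wp c (\<lambda>s'' os'. frame W s s'' \<and> s'' e = k \<and> I (Suc k) s'' os') ?s os"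
    using k(1-3) vars I by (intro step) (auto intro!: frame_upd)
  moreover have "setpos As j + k + 1 < n ^ wd el" using nth(3)[OF k(1)] lg by simp
  moreover have "As ! j ! k \<in> set inp" using nth(3,4)[OF k(1)] by (metis nth_mem)
  ultimately show "wp (Bin Add el pos e ;; Bin Add el el one ;; Inp el el ;; c)
      (\<lambda>s' os'. frame W s s' \<and> s' e = k \<and> I (Suc k) s' os') s' os"
    using nth(3,4)[OF k(1)] fr k(3) vars el lg(3)
    by (intro wp_Seq wp_Add wp_Inp) (auto simp: input_word_nth fun_upd_def)
qed

text \<open>The last conjunct excludes overflow in the hash \<open>a * j + b\<close>. It has to hold
  for all advice that the search tries, since a test must also end properly on bad advice.\<close>

definition glob :: "(vr \<Rightarrow> nat) \<Rightarrow> bool" where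
  "glob s \<longleftrightarrow> s one = 1 \<and> s (Gl NN) = n \<and> s (Gl MM) = length As \<and> s (Gl CAP) = L \<and>
     (\<forall>p. \<forall>j<length As. s (Adv p HA) * j + s (Adv p HB) < n ^ wd (Ph p PH))"

text \<open>\<open>X\<close> and \<open>Y\<close> lie outside the private variables
  \<open>W\<close>, so a test may be called with the variables of an enclosing round or phase. The
  result refers to the set \<open>A s\<close> at entry; \<open>fixed_only\<close> guarantees that it
  is still the same set after writes to other variables.\<close>

definition test_ok :: "test \<Rightarrow> ((vr \<Rightarrow> nat) \<Rightarrow> nat set) \<Rightarrow> vr set \<Rightarrow> bool" where
  "test_ok T A W \<longleftrightarrow> (\<forall>X Y s os. X \<notin> W \<longrightarrow> Y \<notin> W \<longrightarrow> X \<noteq> Y \<longrightarrow> Y \<notin> fixed \<longrightarrow> glob s \<longrightarrow>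
     wp (T X Y) (\<lambda>s' os'. os' = os \<and> frame (insert Y W) s s' \<and> s' Y = of_bool (s X \<in> A s)) s os)"

definition fixed_only :: "((vr \<Rightarrow> nat) \<Rightarrow> 'b) \<Rightarrow> bool" where
  "fixed_only A \<longleftrightarrow> (\<forall>s s'. (\<forall>z\<in>fixed. s z = s' z) \<longrightarrow> A s = A s')"

lemma test_okD:
  assumes "test_ok T A W" "X \<notin> W" "Y \<notin> W" "X \<noteq> Y" "Y \<notin> fixed" "glob s"
    "\<And>s'. frame (insert Y W) s s' \<Longrightarrow> s' Y = of_bool (s X \<in> A s) \<Longrightarrow> Q s' os"
  shows "wp (T X Y) Q s os"
proof -
  have "wp (T X Y) (\<lambda>s' os'. os' = os \<and> frame (insert Y W) s s' \<and> s' Y = of_bool (s X \<in> A s)) s os"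
    using assms(1-6) by (simp add: test_ok_def)
  then show ?thesis by (rule wp_mono) (use assms(7) in auto)
qed

lemma frame_fixed: "frame W s s' \<Longrightarrow> W \<inter> fixed = {} \<Longrightarrow> z \<in> fixed \<Longrightarrow> s' z = s z"
  by (auto simp: frame_def)

lemma fixed_simps [simp]:
  "one \<in> fixed" "Gl NN \<in> fixed" "Gl MM \<in> fixed" "Gl CAP \<in> fixed" "Gl QQ \<in> fixed"
  "Adv p a \<in> fixed" "Tau p r \<in> fixed" "Ph p b \<notin> fixed" "Rd p r c \<notin> fixed"
  "Gl GV \<notin> fixed" "Gl GF \<notin> fixed"
  by (auto simp: fixed_def)

lemma glob_frame: "glob s \<Longrightarrow> frame W s s' \<Longrightarrow> W \<inter> fixed = {} \<Longrightarrow> glob s'"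
  unfolding glob_def by (simp add: frame_fixed)

lemma fixed_only_frame: "fixed_only A \<Longrightarrow> frame W s s' \<Longrightarrow> W \<inter> fixed = {} \<Longrightarrow> A s' = A s"
  unfolding fixed_only_def by (metis frame_fixed)

abbreviation smp :: "nat \<Rightarrow> ((vr \<Rightarrow> nat) \<Rightarrow> nat set) \<Rightarrow> (vr \<Rightarrow> nat) \<Rightarrow> nat list" where
  "smp p A s \<equiv> sample (hashed s p) Ss (A s)"

text \<open>Ranks are counted in the order of the input: after \<open>j\<close> sets
  \<open>PC\<close> is the length of the sample of these \<open>j\<close> sets, so no list of
  sampled indices is stored.\<close>

lemma mem_code_ok:
  assumes T: "test_ok T A W" and W: "W \<inter> fixed = {}" "\<And>k. Ph p k \<notin> W"
    and A: "fixed_only A"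
    and v: "i \<notin> W \<union> range (Ph p)" "u \<notin> W \<union> range (Ph p)" "f \<notin> W \<union> range (Ph p)"
      "f \<noteq> i" "f \<noteq> u" "f \<notin> fixed"
    and s: "glob s"
    and Q: "\<And>s'. frame (insert f (W \<union> range (Ph p))) s s' \<Longrightarrow>
       s' f = of_bool (s i < length (smp p A s) \<and> s u \<in> Ss ! (smp p A s ! s i)) \<Longrightarrow> Q s' os"
  shows "wp (mem_code p T i u f) Q s os"
proof -
  have "one \<notin> W" using W(1) fixed_simps(1) by blast
  note W = W this
  define W' where "W' = insert f (W \<union> range (Ph p))"
  have W': "W' \<inter> fixed = {}" using W v by (auto simp: W'_def)
  define h where "h = (\<lambda>j. hashed s p j \<and> Ss ! j \<inter> A s = {})"
  define sm where "sm j = filter h [0..<j]" for j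
  have smp: "sm (length As) = smp p A s" unfolding sm_def sample_def h_def by simp
  \<comment> \<open>The verdict on the sample of the first \<open>j\<close> sets. Longer prefixes
    only append to the sample, so it stays constant once rank \<open>s i\<close> is passed.\<close>
  define F where "F j = (of_bool (s i < length (sm j) \<and> s u \<in> Ss ! (sm j ! s i)) :: nat)" for j
  define I where "I j s' os' \<longleftrightarrow> os' = os \<and> s' (Ph p PPOS) = setpos As j \<and>
      s' (Ph p PC) = length (sm j) \<and> s' f = F j" for j s' os'
  have sm_Suc: "sm (Suc j) = (if h j then sm j @ [j] else sm j)" for j by (simp add: sm_def)
  have sm_len: "length (sm j) \<le> j" for j unfolding sm_def using length_filter_le[of h "[0..<j]"] by simp
  have fne: "f \<noteq> Ph p k" "i \<noteq> Ph p k" "u \<noteq> Ph p k" "Ph p k \<noteq> f" "Ph p k \<noteq> i" "Ph p k \<noteq> u" for k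
    using v by auto
  have M: "length As < length inp"
    unfolding inp by (induction As) auto
  have loop: "wp (For one (Ph p PJ) (Gl MM) c) Q s1 os"
    if c: "\<And>j s'. j < length As \<Longrightarrow> frame W' s s' \<Longrightarrow> s' (Ph p PJ) = j \<Longrightarrow> I j s' os \<Longrightarrow>
        wp c (\<lambda>s'' os'. frame W' s s'' \<and> s'' (Ph p PJ) = j \<and> I (Suc j) s'' os') s' os"
      and s1: "frame W' s s1" "I 0 s1 os" for c s1
  proof (rule wp_For[where L = "length As" and I = I and W = W' and ?s0.0 = s])
    show "s1 (Gl MM) = length As" "s1 one = 1"
      using s glob_frame[OF s s1(1) W'] by (auto simp: glob_def)
    show "length As < n ^ wd (Ph p PJ)" using M long(2)[of p PJ] by simp
    show "Gl MM \<notin> W'" "one \<notin> W'" using W' by auto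
    show "Ph p PJ \<in> W'" by (simp add: W'_def)
    show "frame W' s s1" "I 0 s1 os" by fact+
    show "I j (s'(Ph p PJ := k)) os'" if "I j s' os'" for j k s' os'
      using that fne by (auto simp: I_def)
    show "wp c (\<lambda>s'' os''. frame W' s s'' \<and> s'' (Ph p PJ) = j \<and> I (Suc j) s'' os'') s' os'"
      if "j < length As" "frame W' s s'" "s' (Ph p PJ) = j" "I j s' os'" for j s' os'
      using c[OF that(1-3)] that(4) by (auto simp: I_def)
    show "Q s' os'" if "frame W' s s'" "I (length As) s' os'" for s' os'
      using that Q[of s'] by (auto simp: I_def W'_def smp F_def)
  qed
  have body: "wp (Bin Mul (Ph p PH) (Adv p HA) (Ph p PJ) ;; Bin Add (Ph p PH) (Ph p PH) (Adv p HB) ;;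
       Bin Mod (Ph p PH) (Ph p PH) (Gl QQ) ;; Inp (Ph p PSIZ) (Ph p PPOS) ;;
       If (Less (Ph p PH) (Adv p HT)) (
         Set (Ph p PAL) 1 ;;
         each (Ph p PPOS) (Ph p PSIZ) (Ph p PE) (Ph p PEL) (
           T (Ph p PEL) (Ph p PG) ;; If (Eq (Ph p PG) one) (Set (Ph p PAL) 0) Skip) ;;
         If (Eq (Ph p PAL) one) (
           If (Eq (Ph p PC) i) (
             each (Ph p PPOS) (Ph p PSIZ) (Ph p PE) (Ph p PEL) (
               If (Eq (Ph p PEL) u) (Set f 1) Skip)) Skip ;;
           Bin Add (Ph p PC) (Ph p PC) one) Skip) Skip ;;
       Bin Add (Ph p PPOS) (Ph p PPOS) (Ph p PSIZ) ;; Bin Add (Ph p PPOS) (Ph p PPOS) one)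
      (\<lambda>s'' os'. frame W' s s'' \<and> s'' (Ph p PJ) = j \<and> I (Suc j) s'' os') s1 os"
    (is "wp ?body _ _ _") if j: "j < length As" and s1: "frame W' s s1" "s1 (Ph p PJ) = j" "I j s1 os" for j s1
  proof -
    let ?A = "As ! j"
    have fr: "t z = s z" if "frame W' s t" "z \<in> fixed \<or> z = i \<or> z = u" for t z
      using that W' fne v frameD[OF that(1), of z] by (auto simp: W'_def)
    note nth = setpos_nth[OF j inp]
    have h_iff: "h j \<longleftrightarrow> hashed s p j \<and> (\<forall>k<length ?A. ?A ! k \<notin> A s)"
      using j by (auto simp: h_def in_set_conv_nth) (metis disjoint_iff nth_mem)
    define B where "B t \<longleftrightarrow> frame W' s t \<and> t (Ph p PJ) = j \<and> t (Ph p PPOS) = setpos As j \<and>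
      t (Ph p PSIZ) = length ?A" for t
    define N where "N t \<longleftrightarrow> B t \<and> t (Ph p PC) = length (sm j) \<and> t f = F j" for t
    define M where "M t \<longleftrightarrow> B t \<and> t (Ph p PC) = length (sm (Suc j)) \<and> t f = F (Suc j)" for t
    have tail: "wp (Bin Add (Ph p PPOS) (Ph p PPOS) (Ph p PSIZ) ;; Bin Add (Ph p PPOS) (Ph p PPOS) one)
      (\<lambda>s'' os'. frame W' s s'' \<and> s'' (Ph p PJ) = j \<and> I (Suc j) s'' os') t os" if t: "M t" for t
    proof -
      have "setpos As j + length ?A + 1 < n ^ wd (Ph p PPOS)"
        using setpos_le[of "Suc j" As n "length As"] j inp long(2)[of p PPOS] by simp
      moreover have "frame W' s t" using t by (simp add: M_def B_def)
      moreover have "t one = 1" using fr[of t one] t s by (auto simp: M_def B_def glob_def)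
      ultimately show ?thesis
        using t fne by (intro wp_Seq wp_Add) (auto simp: M_def B_def I_def W'_def intro!: frame_upd)
    qed
    have each1: "wp (each (Ph p PPOS) (Ph p PSIZ) (Ph p PE) (Ph p PEL)
          (T (Ph p PEL) (Ph p PG) ;; If (Eq (Ph p PG) one) (Set (Ph p PAL) 0) Skip))
        Q' t os"
      if t: "B t" "t (Ph p PAL) = 1"
        and Q': "\<And>t'. frame (W \<union> {Ph p PE, Ph p PEL, Ph p PG, Ph p PAL}) t t' \<Longrightarrow>
          t' (Ph p PAL) = of_bool (\<forall>k<length ?A. ?A ! k \<notin> A s) \<Longrightarrow> Q' t' os" for t Q'
    proof (rule wp_each[where j = j and W = "W \<union> {Ph p PE, Ph p PEL, Ph p PG, Ph p PAL}"
          and I = "\<lambda>k s' os'. os' = os \<and> s' (Ph p PAL) = of_bool (\<forall>k'<k. ?A ! k' \<notin> A s)"])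
      fix k s' os' assume k: "k < length ?A" "frame (W \<union> {Ph p PE, Ph p PEL, Ph p PG, Ph p PAL}) t s'"
        "s' (Ph p PE) = k" "s' (Ph p PEL) = ?A ! k"
        "os' = os \<and> s' (Ph p PAL) = of_bool (\<forall>k'<k. ?A ! k' \<notin> A s)"
      have "frame W' s t" using t(1) by (simp add: B_def)
      then have fs: "frame W' s s'" by (rule frame_trans[OF _ k(2)]) (auto simp: W'_def)
      have g: "glob s'" "A s' = A s"
        using glob_frame[OF s fs W'] fixed_only_frame[OF A fs W'] by auto
      show "wp (T (Ph p PEL) (Ph p PG) ;; If (Eq (Ph p PG) one) (Set (Ph p PAL) 0) Skip)
          (\<lambda>s'' os'. frame (W \<union> {Ph p PE, Ph p PEL, Ph p PG, Ph p PAL}) t s'' \<and>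
             s'' (Ph p PE) = k \<and> os' = os \<and>
             s'' (Ph p PAL) = of_bool (\<forall>k'<Suc k. ?A ! k' \<notin> A s)) s' os'"
      proof (intro wp_Seq test_okD[OF T] wp_If wp_Set wp_Skip)
        fix s'' assume s'': "frame (insert (Ph p PG) W) s' s''"
          "s'' (Ph p PG) = of_bool (s' (Ph p PEL) \<in> A s')"
        have f2: "frame (W \<union> {Ph p PE, Ph p PEL, Ph p PG, Ph p PAL}) t s''"
          by (rule frame_trans[OF k(2) s''(1)]) auto
        have f3: "s'' (Ph p PE) = k" "s'' (Ph p PAL) = s' (Ph p PAL)" "s'' one = 1"
          using frameD[OF s''(1), of "Ph p PE"] frameD[OF s''(1), of "Ph p PAL"]
            frameD[OF s''(1), of one] k(3) W g(1) by (auto simp: glob_def)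
        show "0 < n ^ wd (Ph p PAL)" using const_less[of 0] by simp
        { assume "cval (Eq (Ph p PG) one) s''"
          then show "frame (W \<union> {Ph p PE, Ph p PEL, Ph p PG, Ph p PAL}) t (s''(Ph p PAL := 0)) \<and>
             (s''(Ph p PAL := 0)) (Ph p PE) = k \<and> os' = os \<and>
             (s''(Ph p PAL := 0)) (Ph p PAL) = of_bool (\<forall>k'<Suc k. ?A ! k' \<notin> A s)"
            using f2 f3 k(4,5) s''(2) g(2) by (auto intro!: frame_upd) }
        { assume "\<not> cval (Eq (Ph p PG) one) s''"
          then show "frame (W \<union> {Ph p PE, Ph p PEL, Ph p PG, Ph p PAL}) t s'' \<and>
             s'' (Ph p PE) = k \<and> os' = os \<and>
             s'' (Ph p PAL) = of_bool (\<forall>k'<Suc k. ?A ! k' \<notin> A s)"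
            using f2 f3 k(4,5) s''(2) g(2) by (auto simp: less_Suc_eq) }
      qed (use g(1) W in auto)
    next
      show "t one = 1" using fr[of t one] t s by (auto simp: B_def glob_def)
      show "Ph p PPOS \<notin> W \<union> {Ph p PE, Ph p PEL, Ph p PG, Ph p PAL}"
        "Ph p PSIZ \<notin> W \<union> {Ph p PE, Ph p PEL, Ph p PG, Ph p PAL}"
        "one \<notin> W \<union> {Ph p PE, Ph p PEL, Ph p PG, Ph p PAL}" using W by auto
    qed (use j t Q' in \<open>auto simp: B_def\<close>)
    have each2: "wp (each (Ph p PPOS) (Ph p PSIZ) (Ph p PE) (Ph p PEL)
          (If (Eq (Ph p PEL) u) (Set f 1) Skip)) Q' t os"
      if t: "B t" "t f = 0"
        and Q': "\<And>t'. frame {Ph p PE, Ph p PEL, f} t t' \<Longrightarrow>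
          t' f = of_bool (s u \<in> set ?A) \<Longrightarrow> Q' t' os" for t Q'
    proof (rule wp_each[where j = j and W = "{Ph p PE, Ph p PEL, f}"
          and I = "\<lambda>k s' os'. os' = os \<and> s' f = of_bool (\<exists>k'<k. s u = ?A ! k')"])
      fix k s' os' assume k: "k < length ?A" "frame {Ph p PE, Ph p PEL, f} t s'"
        "s' (Ph p PE) = k" "s' (Ph p PEL) = ?A ! k"
        "os' = os \<and> s' f = of_bool (\<exists>k'<k. s u = ?A ! k')"
      have "frame W' s t" using t(1) by (simp add: B_def)
      then have fs: "frame W' s s'" by (rule frame_trans[OF _ k(2)]) (auto simp: W'_def)
      then show "wp (If (Eq (Ph p PEL) u) (Set f 1) Skip)
          (\<lambda>s'' os'. frame {Ph p PE, Ph p PEL, f} t s'' \<and> s'' (Ph p PE) = k \<and> os' = os \<and>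
             s'' f = of_bool (\<exists>k'<Suc k. s u = ?A ! k')) s' os'"
        using k fne const_less[of 1 f] fr[of s' u]
        by (intro wp_If wp_Set wp_Skip) (auto simp: less_Suc_eq intro!: frame_upd)
    next
      show "t one = 1" using fr[of t one] t s by (auto simp: B_def glob_def)
      show "one \<notin> {Ph p PE, Ph p PEL, f}" using v by auto
      show "Q' s' os'" if "frame {Ph p PE, Ph p PEL, f} t s'"
        "os' = os \<and> s' f = of_bool (\<exists>k'<length ?A. s u = ?A ! k')" for s' os'
      proof -
        have "(\<exists>k'<length ?A. s u = ?A ! k') \<longleftrightarrow> s u \<in> set ?A" by (auto simp: in_set_conv_nth)
        then show ?thesis using that Q'[of s'] by simp
      qed
    qed (use j t fne in \<open>auto simp: B_def\<close>)
    have ifpart: "wp (If (Less (Ph p PH) (Adv p HT)) (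
         Set (Ph p PAL) 1 ;;
         each (Ph p PPOS) (Ph p PSIZ) (Ph p PE) (Ph p PEL) (
           T (Ph p PEL) (Ph p PG) ;; If (Eq (Ph p PG) one) (Set (Ph p PAL) 0) Skip) ;;
         If (Eq (Ph p PAL) one) (
           If (Eq (Ph p PC) i) (
             each (Ph p PPOS) (Ph p PSIZ) (Ph p PE) (Ph p PEL) (
               If (Eq (Ph p PEL) u) (Set f 1) Skip)) Skip ;;
           Bin Add (Ph p PC) (Ph p PC) one) Skip) Skip) (\<lambda>t' os'. os' = os \<and> M t') t os"
      if t: "N t" "t (Ph p PH) = (s (Adv p HA) * j + s (Adv p HB)) mod s (Gl QQ)" for t
    proof -
      have ht: "cval (Less (Ph p PH) (Adv p HT)) t \<longleftrightarrow> hashed s p j"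
        using t fr[of t "Adv p HT"] by (auto simp: N_def B_def hashed_def)
      show ?thesis
      proof (rule wp_If)
        assume "\<not> cval (Less (Ph p PH) (Adv p HT)) t"
        then have "\<not> h j" using ht h_iff by blast
        then have "M t" using t by (simp add: M_def N_def sm_Suc F_def)
        then show "wp Skip (\<lambda>t' os'. os' = os \<and> M t') t os" by (intro wp_Skip) simp
      next
        assume "cval (Less (Ph p PH) (Adv p HT)) t"
        then have hs: "hashed s p j" using ht by blast
        let ?t = "t(Ph p PAL := 1)"
        have B: "B ?t" using t by (auto simp: N_def B_def W'_def intro!: frame_upd)
        show "wp (Set (Ph p PAL) 1 ;;
         each (Ph p PPOS) (Ph p PSIZ) (Ph p PE) (Ph p PEL) (
           T (Ph p PEL) (Ph p PG) ;; If (Eq (Ph p PG) one) (Set (Ph p PAL) 0) Skip) ;;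
         If (Eq (Ph p PAL) one) (
           If (Eq (Ph p PC) i) (
             each (Ph p PPOS) (Ph p PSIZ) (Ph p PE) (Ph p PEL) (
               If (Eq (Ph p PEL) u) (Set f 1) Skip)) Skip ;;
           Bin Add (Ph p PC) (Ph p PC) one) Skip) (\<lambda>t' os'. os' = os \<and> M t') t os"
        proof (intro wp_Seq wp_Set each1[OF B])
          show "1 < n ^ wd (Ph p PAL)" by (rule const_less) simp
          show "?t (Ph p PAL) = 1" by simp
          fix t1 assume t1: "frame (W \<union> {Ph p PE, Ph p PEL, Ph p PG, Ph p PAL}) ?t t1"
            "t1 (Ph p PAL) = of_bool (\<forall>k<length ?A. ?A ! k \<notin> A s)"
          have e: "t1 z = t z" if "z = f \<or> z = i \<or> z = one \<or> z = Ph p PJ \<or> z = Ph p PPOS \<or> z = Ph p PC \<or> z = Ph p PSIZ" for z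
            using frameD[OF t1(1), of z] W v fne that by auto
          have "frame W' s ?t" using B by (simp add: B_def)
          then have f1: "frame W' s t1" by (rule frame_trans[OF _ t1(1)]) (auto simp: W'_def)
          have N1: "N t1" using t(1) f1 by (simp add: N_def B_def e)
          have o: "t1 one = 1" using fr[OF f1, of one] s by (auto simp: glob_def)
          show "wp (If (Eq (Ph p PAL) one) (
            If (Eq (Ph p PC) i) (
             each (Ph p PPOS) (Ph p PSIZ) (Ph p PE) (Ph p PEL) (
               If (Eq (Ph p PEL) u) (Set f 1) Skip)) Skip ;;
            Bin Add (Ph p PC) (Ph p PC) one) Skip) (\<lambda>t' os'. os' = os \<and> M t') t1 os"
          proof (rule wp_If)
            assume "\<not> cval (Eq (Ph p PAL) one) t1"
            then have "\<not> h j" using t1(2) o h_iff by auto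
            then have "M t1" using N1 by (simp add: M_def N_def sm_Suc F_def)
            then show "wp Skip (\<lambda>t' os'. os' = os \<and> M t') t1 os" by (intro wp_Skip) simp
          next
            assume "cval (Eq (Ph p PAL) one) t1"
            then have "of_bool (\<forall>k<length ?A. ?A ! k \<notin> A s) = (1::nat)" using t1(2) o by simp
            then have "\<forall>k<length ?A. ?A ! k \<notin> A s" by (simp only: of_bool_eq_1_iff)
            then have hj: "h j" using h_iff hs by blast
            have fin: "wp (Bin Add (Ph p PC) (Ph p PC) one) (\<lambda>t' os'. os' = os \<and> M t') t2 os"
              if t2: "B t2" "t2 (Ph p PC) = length (sm j)" "t2 f = F (Suc j)" for t2
            proof -
              have "t2 one = 1" using fr[of t2 one] t2(1) s by (auto simp: B_def glob_def)
              moreover have "length (sm j) + 1 < n ^ wd (Ph p PC)"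
                using sm_len[of j] j M long(2)[of p PC] by linarith
              ultimately show ?thesis using t2 hj fne
                by (intro wp_Add) (auto simp: M_def B_def sm_Suc W'_def intro!: frame_upd)
            qed
            show "wp (If (Eq (Ph p PC) i) (
             each (Ph p PPOS) (Ph p PSIZ) (Ph p PE) (Ph p PEL) (
               If (Eq (Ph p PEL) u) (Set f 1) Skip)) Skip ;;
              Bin Add (Ph p PC) (Ph p PC) one) (\<lambda>t' os'. os' = os \<and> M t') t1 os"
            proof (intro wp_Seq wp_If)
              assume "\<not> cval (Eq (Ph p PC) i) t1"
              then have "s i \<noteq> length (sm j)" using N1 fr[OF f1, of i] by (simp add: N_def)
              then have "F (Suc j) = F j" using hj by (auto simp: F_def sm_Suc nth_append)
              then show "wp Skip (wp (Bin Add (Ph p PC) (Ph p PC) one) (\<lambda>t' os'. os' = os \<and> M t')) t1 os"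
                using N1 by (intro wp_Skip fin) (auto simp: N_def)
            next
              assume "cval (Eq (Ph p PC) i) t1"
              then have i: "s i = length (sm j)" using N1 fr[OF f1, of i] by (simp add: N_def)
              then have F: "F j = 0" "F (Suc j) = of_bool (s u \<in> set ?A)"
                using hj j by (auto simp: F_def sm_Suc)
              show "wp (each (Ph p PPOS) (Ph p PSIZ) (Ph p PE) (Ph p PEL) (
                 If (Eq (Ph p PEL) u) (Set f 1) Skip))
                 (wp (Bin Add (Ph p PC) (Ph p PC) one) (\<lambda>t' os'. os' = os \<and> M t')) t1 os"
              proof (rule each2)
                show "B t1" "t1 f = 0" using N1 F by (auto simp: N_def)
                fix t2 assume t2: "frame {Ph p PE, Ph p PEL, f} t1 t2" "t2 f = of_bool (s u \<in> set ?A)"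
                have "frame W' s t2" by (rule frame_trans[OF f1 t2(1)]) (auto simp: W'_def)
                then have "B t2" using N1 t2(1) fne by (auto simp: N_def B_def frame_def)
                then show "wp (Bin Add (Ph p PC) (Ph p PC) one) (\<lambda>t' os'. os' = os \<and> M t') t2 os"
                  using N1 t2 fne F by (intro fin) (auto simp: N_def frame_def)
              qed
            qed
          qed
        qed
      qed
    qed
    have fx: "s1 (Adv p HA) = s (Adv p HA)" "s1 (Adv p HB) = s (Adv p HB)" "s1 (Gl QQ) = s (Gl QQ)"
      using fr[OF s1(1)] by auto
    have lt: "s (Adv p HA) * j + s (Adv p HB) < n ^ wd (Ph p PH)" using s j by (auto simp: glob_def)
    have in_len: "length ?A \<in> set inp" using nth(1,2) by (metis nth_mem)
    show ?thesis
    \<comment> \<open>The first four goals are the ranges of the four assignments in front of the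
      conditional; the fifth is the conditional together with the rest of the body.\<close>
    proof (intro wp_Seq wp_Mul wp_Add wp_Mod wp_Inp, goal_cases)
      case 5
      show ?case
      proof (rule wp_mono[OF ifpart], goal_cases)
        case (3 s' os')
        then show ?case using tail[of s'] by simp
      qed (use s1 fx nth(1,2) fne in \<open>auto simp: N_def B_def I_def input_word_nth W'_def intro!: frame_upd\<close>)
    qed (use s1 fx lt nth(1,2) fne in_len entries(2) in \<open>auto simp: I_def input_word_nth\<close>)
  qed
  have "wp (For one (Ph p PJ) (Gl MM) ?body) Q (s(f := 0, Ph p PC := 0, Ph p PPOS := 2)) os"
    by (rule loop, rule body)
      (use fne v in \<open>auto simp: I_def W'_def sm_def F_def intro!: frame_upd frame_refl\<close>)
  then show ?thesis
    unfolding mem_code_def using const_less n_gt2 by (intro wp_Seq wp_Set) simp_all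
qed

end

context alg begin

lemma smp_less: "i < length (sample h Ss A) \<Longrightarrow> sample h Ss A ! i < length As"
  using nth_mem[of i "sample h Ss A"] by (auto simp: sample_def)

lemma round_code_ok:
  assumes T0: "test_ok T0 A W0" and T: "test_ok T B W"
    and W: "W0 \<subseteq> W" "range (Ph p) \<subseteq> W" "\<And>k. Rd p r k \<notin> W" "\<And>k. Ph p k \<notin> W0" "W \<inter> fixed = {}"
    and A: "fixed_only A" and B: "fixed_only B"
  shows "test_ok (round_code p r T0 T)
     (\<lambda>s. B s \<union> {v. s (Tau p r) \<le> hit_count L Ss (smp p A s) (B s) v}) (W \<union> range (Rd p r))"
  unfolding test_ok_def
proof (intro allI impI)
  fix X Y and s :: "vr \<Rightarrow> nat" and os :: "nat list"
  assume X: "X \<notin> W \<union> range (Rd p r)" and Y: "Y \<notin> W \<union> range (Rd p r)" "X \<noteq> Y" "Y \<notin> fixed"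
    and s: "glob s"
  let ?R = "Rd p r"
  define V where "V = insert Y (W \<union> range ?R)"
  define S where "S = smp p A s"
  have VF: "V \<inter> fixed = {}" using W Y by (auto simp: V_def)
  have W0F: "W0 \<inter> fixed = {}" using W by blast
  have XV: "X \<notin> V" using X Y by (auto simp: V_def)
  have ne: "Y \<noteq> ?R k" "?R k \<noteq> Y" "X \<noteq> ?R k" "?R k \<noteq> X" "?R k \<notin> W0" for k
    using X Y W by auto
  have fV: "s' one = 1" "s' (Gl CAP) = L" "s' (Gl NN) = n" "s' (Tau p r) = s (Tau p r)" "s' X = s X"
     "glob s'" "smp p A s' = S" "B s' = B s"
    if "frame V s s'" for s'
  proof -
    have g: "glob s'" using glob_frame[OF s that VF] .
    then show "s' one = 1" "s' (Gl CAP) = L" "s' (Gl NN) = n" "glob s'" by (auto simp: glob_def)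
    show "s' (Tau p r) = s (Tau p r)" by (rule frame_fixed[OF that VF]) simp
    show "s' X = s X" by (rule frameD[OF that XV])
    have "hashed s' p = hashed s p"
      using frame_fixed[OF that VF] by (auto simp: hashed_def fun_eq_iff)
    then show "smp p A s' = S" using fixed_only_frame[OF A that VF] by (simp add: S_def)
    show "B s' = B s" by (rule fixed_only_frame[OF B that VF])
  qed
  define C where "C i \<longleftrightarrow> i < length S \<and> s X \<in> Ss ! (S ! i) \<and> Ss ! (S ! i) \<inter> B s = {}" for i
  define D where "D i u \<longleftrightarrow> i < length S \<and> u \<in> Ss ! (S ! i) \<and> u \<in> B s" for i u
  \<comment> \<open>\<open>Y\<close> holds the verdict of the previous round during the count.
    Rounds only add vertices, so afterwards it is at most raised to 1.\<close>
  define y where "y = (of_bool (s X \<in> B s) :: nat)"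
  define I where "I i s' os' \<longleftrightarrow> os' = os \<and> s' (?R RCNT) = card {i'. i' < i \<and> C i'} \<and> s' Y = y"
    for i s' os'
  \<comment> \<open>Running over \<open>u < n\<close> decides disjointness because the sets lie in
    the ground set.\<close>
  have C_iff: "C i \<longleftrightarrow> i < length S \<and> s X \<in> Ss ! (S ! i) \<and> (\<forall>u<n. \<not> D i u)" for i
  proof -
    have "Ss ! (S ! i) \<subseteq> {..<n}" if "i < length S"
      using smp_less[of i] that ground[of "As ! (S ! i)"] by (auto simp: S_def)
    then show ?thesis by (auto simp: C_def D_def)
  qed
  have cC: "card {i'. i' < Suc i \<and> C i'} = card {i'. i' < i \<and> C i'} + of_bool (C i)" for i
  proof -
    have "{i'. i' < Suc i \<and> C i'} = (if C i then insert i {i'. i' < i \<and> C i'} else {i'. i' < i \<and> C i'})"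
      by (auto simp: less_Suc_eq)
    then show ?thesis by simp
  qed
  have card_le: "card {i'. i' < i \<and> C i'} \<le> i" for i
    using card_mono[of "{..<i}" "{i'. i' < i \<and> C i'}"] by auto
  have mem: "wp (mem_code p T0 (?R RI) u f) Q s' os"
    if f: "frame V s s'" "u = X \<or> u = ?R RU" "f = ?R ROK \<or> f = ?R RG"
      and Q: "\<And>t. frame (insert f (W0 \<union> range (Ph p))) s' t \<Longrightarrow>
        t f = of_bool (s' (?R RI) < length S \<and> s' u \<in> Ss ! (S ! s' (?R RI))) \<Longrightarrow> Q t os" for s' Q u f
    using f(2,3) fV[OF f(1)] Q X W ne
    by (intro mem_code_ok[OF T0 W0F W(4) A]) auto
  have inner: "wp (For one (?R RU) (Gl NN) (
         mem_code p T0 (?R RI) (?R RU) (?R RG) ;;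
         If (Eq (?R RG) one) (
           T (?R RU) (?R RG) ;; If (Eq (?R RG) one) (Set (?R ROK) 0) Skip) Skip)) Q t os"
    if t: "frame V s t" "t (?R RI) = i" "t (?R ROK) = of_bool (i < length S \<and> s X \<in> Ss ! (S ! i))"
      and Q: "\<And>t'. frame (W \<union> {?R RU, ?R RG, ?R ROK}) t t' \<Longrightarrow> t' (?R ROK) = of_bool (C i) \<Longrightarrow> Q t' os"
      for t i Q
  proof (rule wp_For[where L = n and W = "W \<union> {?R RU, ?R RG, ?R ROK}" and ?s0.0 = t and
        I = "\<lambda>u t' os'. os' = os \<and> t' (?R ROK) =
           of_bool (i < length S \<and> s X \<in> Ss ! (S ! i) \<and> (\<forall>u'<u. \<not> D i u'))"])
    show "t (Gl NN) = n" "t one = 1" using fV[OF t(1)] by auto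
    show "n < n ^ wd (?R RU)" by (rule short)
    show "Gl NN \<notin> W \<union> {?R RU, ?R RG, ?R ROK}" "one \<notin> W \<union> {?R RU, ?R RG, ?R ROK}"
      using W(5) fixed_simps by blast+
    fix u t' os' assume u: "u < n" "frame (W \<union> {?R RU, ?R RG, ?R ROK}) t t'" "t' (?R RU) = u"
      "os' = os \<and> t' (?R ROK) =
           of_bool (i < length S \<and> s X \<in> Ss ! (S ! i) \<and> (\<forall>u'<u. \<not> D i u'))"
    have f': "frame V s t'" by (rule frame_trans[OF t(1) u(2)]) (auto simp: V_def)
    have ri: "t' (?R RI) = i" using frameD[OF u(2), of "?R RI"] t W by auto
    show "wp (mem_code p T0 (?R RI) (?R RU) (?R RG) ;;
         If (Eq (?R RG) one) (
           T (?R RU) (?R RG) ;; If (Eq (?R RG) one) (Set (?R ROK) 0) Skip) Skip)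
       (\<lambda>s' os'. frame (W \<union> {?R RU, ?R RG, ?R ROK}) t s' \<and> s' (?R RU) = u \<and> os' = os \<and>
          s' (?R ROK) = of_bool (i < length S \<and> s X \<in> Ss ! (S ! i) \<and> (\<forall>u'<Suc u. \<not> D i u')))
       t' os'"
      unfolding conjunct1[OF u(4)]
    proof (intro wp_Seq mem[OF f'])
      fix t1 assume t1: "frame (insert (?R RG) (W0 \<union> range (Ph p))) t' t1"
        "t1 (?R RG) = of_bool (t' (?R RI) < length S \<and> t' (?R RU) \<in> Ss ! (S ! t' (?R RI)))"
      have fr1: "frame (W \<union> {?R RU, ?R RG, ?R ROK}) t t1"
        by (rule frame_trans[OF u(2) t1(1)]) (use W in auto)
      have fv1: "frame V s t1"
        by (rule frame_trans[OF f' t1(1)]) (use W in \<open>auto simp: V_def\<close>)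
      have e1: "t1 (?R RU) = u" "t1 (?R ROK) = t' (?R ROK)"
        using frameD[OF t1(1), of "?R RU"] frameD[OF t1(1), of "?R ROK"] u(3) ne(5) by auto
      note g1 = fV[OF fv1]
      have c1: "cval (Eq (?R RG) one) t1 \<longleftrightarrow> i < length S \<and> u \<in> Ss ! (S ! i)"
        using t1(2) g1 ri u(3) by simp
      show "wp (If (Eq (?R RG) one) (
           T (?R RU) (?R RG) ;; If (Eq (?R RG) one) (Set (?R ROK) 0) Skip) Skip)
         (\<lambda>s' os'. frame (W \<union> {?R RU, ?R RG, ?R ROK}) t s' \<and> s' (?R RU) = u \<and> os' = os \<and>
          s' (?R ROK) = of_bool (i < length S \<and> s X \<in> Ss ! (S ! i) \<and> (\<forall>u'<Suc u. \<not> D i u')))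
         t1 os"
      proof (rule wp_If)
        assume "\<not> cval (Eq (?R RG) one) t1"
        then have "\<not> D i u" using c1 by (auto simp: D_def)
        then show "wp Skip (\<lambda>s' os'. frame (W \<union> {?R RU, ?R RG, ?R ROK}) t s' \<and> s' (?R RU) = u \<and>
            os' = os \<and> s' (?R ROK) = of_bool (i < length S \<and> s X \<in> Ss ! (S ! i) \<and> (\<forall>u'<Suc u. \<not> D i u')))
            t1 os"
          using fr1 e1 u(4) by (intro wp_Skip) (auto simp: less_Suc_eq)
      next
        assume "cval (Eq (?R RG) one) t1"
        then have iu: "i < length S" "u \<in> Ss ! (S ! i)" using c1 by auto
        show "wp (T (?R RU) (?R RG) ;; If (Eq (?R RG) one) (Set (?R ROK) 0) Skip)
          (\<lambda>s' os'. frame (W \<union> {?R RU, ?R RG, ?R ROK}) t s' \<and> s' (?R RU) = u \<and> os' = os \<and>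
           s' (?R ROK) = of_bool (i < length S \<and> s X \<in> Ss ! (S ! i) \<and> (\<forall>u'<Suc u. \<not> D i u'))) t1 os"
        proof (intro wp_Seq test_okD[OF T])
          show "glob t1" by (rule g1)
          fix t2 assume t2: "frame (insert (?R RG) W) t1 t2" "t2 (?R RG) = of_bool (t1 (?R RU) \<in> B t1)"
          have fr2: "frame (W \<union> {?R RU, ?R RG, ?R ROK}) t t2"
            by (rule frame_trans[OF fr1 t2(1)]) auto
          have fv2: "frame V s t2"
            by (rule frame_trans[OF fv1 t2(1)]) (auto simp: V_def)
          have e2: "t2 (?R RU) = u" "t2 (?R ROK) = t1 (?R ROK)" "t2 one = 1"
            using frameD[OF t2(1), of "?R RU"] frameD[OF t2(1), of "?R ROK"] W(3) e1 fV[OF fv2] by auto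
          have d: "t2 (?R RG) = of_bool (D i u)" using t2(2) g1 e1 iu by (simp add: D_def)
          show "wp (If (Eq (?R RG) one) (Set (?R ROK) 0) Skip)
             (\<lambda>s' os'. frame (W \<union> {?R RU, ?R RG, ?R ROK}) t s' \<and> s' (?R RU) = u \<and> os' = os \<and>
              s' (?R ROK) = of_bool (i < length S \<and> s X \<in> Ss ! (S ! i) \<and> (\<forall>u'<Suc u. \<not> D i u'))) t2 os"
            using e1 e2 d u(4) fr2 const_less[of 0 "?R ROK"]
            by (intro wp_If wp_Set wp_Skip) (auto simp: less_Suc_eq intro!: frame_upd)
        qed (use W in auto)
      qed
    qed auto
  qed (use t Q C_iff frame_refl in auto)
  have fin: "wp (If (Less (?R RCNT) (Tau p r)) Skip (Set Y 1))
      (\<lambda>s' os'. os' = os \<and> frame V s s' \<and>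
        s' Y = of_bool (s X \<in> B s \<union> {v. s (Tau p r) \<le> hit_count L Ss S (B s) v})) t os"
    if t: "frame V s t" "I L t os" for t
  proof -
    have "{i'. i' < L \<and> C i'} = {i. i < L \<and> i < length S \<and> s X \<in> Ss ! (S ! i) \<and> Ss ! (S ! i) \<inter> B s = {}}"
      by (auto simp: C_def)
    then have "t (?R RCNT) = hit_count L Ss S (B s) (s X)"
      using t(2) by (simp add: I_def hit_count_def)
    then show ?thesis using t(2) fV[OF t(1)] frame_upd[OF t(1), of Y 1] t(1) const_less[of 1 Y]
      by (intro wp_If wp_Set wp_Skip) (auto simp: I_def y_def V_def)
  qed
  have body: "wp (mem_code p T0 (?R RI) X (?R ROK) ;;
     For one (?R RU) (Gl NN) (
         mem_code p T0 (?R RI) (?R RU) (?R RG) ;;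
         If (Eq (?R RG) one) (
           T (?R RU) (?R RG) ;; If (Eq (?R RG) one) (Set (?R ROK) 0) Skip) Skip) ;;
       Bin Add (?R RCNT) (?R RCNT) (?R ROK))
     (\<lambda>s' os'. frame V s s' \<and> s' (?R RI) = i \<and> I (Suc i) s' os') t os"
    if t: "i < L" "frame V s t" "t (?R RI) = i" "I i t os" for i t
  proof (intro wp_Seq mem[OF t(2)])
    fix t1 assume t1: "frame (insert (?R ROK) (W0 \<union> range (Ph p))) t t1"
      "t1 (?R ROK) = of_bool (t (?R RI) < length S \<and> t X \<in> Ss ! (S ! t (?R RI)))"
    have fv1: "frame V s t1"
      by (rule frame_trans[OF t(2) t1(1)]) (use W in \<open>auto simp: V_def\<close>)
    have YW0: "Y \<notin> insert (?R ROK) (W0 \<union> range (Ph p))" using Y(1) W by blast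
    have e1: "t1 (?R RI) = i" "t1 (?R RCNT) = t (?R RCNT)" "t1 Y = t Y"
      using frameD[OF t1(1), of "?R RI"] frameD[OF t1(1), of "?R RCNT"] frameD[OF t1(1) YW0] t(3) ne
      by auto
    show "wp (For one (?R RU) (Gl NN) (
         mem_code p T0 (?R RI) (?R RU) (?R RG) ;;
         If (Eq (?R RG) one) (
           T (?R RU) (?R RG) ;; If (Eq (?R RG) one) (Set (?R ROK) 0) Skip) Skip))
       (wp (Bin Add (?R RCNT) (?R RCNT) (?R ROK))
         (\<lambda>s' os'. frame V s s' \<and> s' (?R RI) = i \<and> I (Suc i) s' os')) t1 os"
    proof (rule inner[OF fv1 e1(1)])
      show "t1 (?R ROK) = of_bool (i < length S \<and> s X \<in> Ss ! (S ! i))"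
        using t1(2) t(3) fV[OF t(2)] by simp
      fix t2 assume t2: "frame (W \<union> {?R RU, ?R RG, ?R ROK}) t1 t2" "t2 (?R ROK) = of_bool (C i)"
      have fv2: "frame V s t2" by (rule frame_trans[OF fv1 t2(1)]) (auto simp: V_def)
      have "Y \<notin> W \<union> {?R RU, ?R RG, ?R ROK}" using Y(1) by blast
      then have e2: "t2 (?R RI) = i" "t2 (?R RCNT) = card {i'. i' < i \<and> C i'}" "t2 Y = y"
        using frameD[OF t2(1), of "?R RI"] frameD[OF t2(1), of "?R RCNT"] frameD[OF t2(1), of Y]
          e1 W(3) t(4) by (auto simp: I_def)
      have "card {i'. i' < i \<and> C i'} + of_bool (C i) < n ^ wd (?R RCNT)"
        using card_le[of i] t(1) short(2)[of "?R RCNT"] by simp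
      then show "wp (Bin Add (?R RCNT) (?R RCNT) (?R ROK))
         (\<lambda>s' os'. frame V s s' \<and> s' (?R RI) = i \<and> I (Suc i) s' os') t2 os"
        using t2(2) e2 fv2 ne
        by (intro wp_Add) (auto simp: I_def cC V_def intro!: frame_upd)
    qed
  qed auto
  show "wp (round_code p r T0 T X Y) (\<lambda>s' os'. os' = os \<and> frame (insert Y (W \<union> range ?R)) s s' \<and>
      s' Y = of_bool (s X \<in> B s \<union> {v. s (Tau p r) \<le> hit_count L Ss (smp p A s) (B s) v})) s os"
    unfolding round_code_def V_def[symmetric] S_def[symmetric]
  proof (intro wp_Seq test_okD[OF T] wp_Set)
    fix s1 assume s1: "frame (insert Y W) s s1" "s1 Y = of_bool (s X \<in> B s)"
    let ?s1 = "s1(?R RCNT := 0)"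
    have f1: "frame V s ?s1"
      using frame_trans[OF frame_refl s1(1), of V] by (auto simp: V_def intro!: frame_upd)
    show "wp (For one (?R RI) (Gl CAP)
           (mem_code p T0 (?R RI) X (?R ROK) ;;
            For one (?R RU) (Gl NN)
             (mem_code p T0 (?R RI) (?R RU) (?R RG) ;;
              If (Eq (?R RG) one) (T (?R RU) (?R RG) ;; If (Eq (?R RG) one) (Set (?R ROK) 0) Skip) Skip) ;;
            Bin Add (?R RCNT) (?R RCNT) (?R ROK)))
       (wp (If (Less (?R RCNT) (Tau p r)) Skip (Set Y 1))
        (\<lambda>s' os'. os' = os \<and> frame V s s' \<and>
          s' Y = of_bool (s X \<in> B s \<union> {v. s (Tau p r) \<le> hit_count L Ss S (B s) v}))) ?s1 os"
    proof (rule wp_For[where L = L and I = I and W = V and ?s0.0 = s])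
      show "?s1 (Gl CAP) = L" "?s1 one = 1" using fV[OF f1] by auto
      show "L < n ^ wd (?R RI)" by (rule short)
      show "Gl CAP \<notin> V" "one \<notin> V" using VF fixed_simps by blast+
      show "?R RI \<in> V" by (simp add: V_def)
      show "frame V s ?s1" by (rule f1)
      show "I 0 ?s1 os" using s1(2) ne by (simp add: I_def y_def)
      show "I i (t(?R RI := k)) os'" if "I i t os'" for i k t os' using that ne by (simp add: I_def)
      show "wp (mem_code p T0 (?R RI) X (?R ROK) ;;
            For one (?R RU) (Gl NN)
             (mem_code p T0 (?R RI) (?R RU) (?R RG) ;;
              If (Eq (?R RG) one) (T (?R RU) (?R RG) ;; If (Eq (?R RG) one) (Set (?R ROK) 0) Skip) Skip) ;;
            Bin Add (?R RCNT) (?R RCNT) (?R ROK))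
           (\<lambda>s' os'. frame V s s' \<and> s' (?R RI) = i \<and> I (Suc i) s' os') t os'"
        if "i < L" "frame V s t" "t (?R RI) = i" "I i t os'" for i t os'
        using body[OF that(1-3)] that(4) by (auto simp: I_def)
      show "wp (If (Less (?R RCNT) (Tau p r)) Skip (Set Y 1))
        (\<lambda>s' os'. os' = os \<and> frame V s s' \<and>
          s' Y = of_bool (s X \<in> B s \<union> {v. s (Tau p r) \<le> hit_count L Ss S (B s) v})) t os'"
        if "frame V s t" "I L t os'" for t os'
        using fin[OF that(1)] that(2) by (auto simp: I_def)
    qed
  qed (use X Y s const_less[of 0 "?R RCNT"] in auto)
qed

abbreviation taus :: "(vr \<Rightarrow> nat) \<Rightarrow> nat \<Rightarrow> nat \<Rightarrow> nat" where
  "taus s p r \<equiv> s (Tau p r)"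

definition wphase :: "nat \<Rightarrow> vr set" where
  "wphase p = {Ph p' k | p' k. p' < p} \<union> {Rd p' r k | p' r k. p' < p}"

definition wround :: "nat \<Rightarrow> nat \<Rightarrow> vr set" where
  "wround p r = wphase p \<union> range (Ph p) \<union> {Rd p r' k | r' k. r' < r}"

lemma test_ok_mono:
  assumes "test_ok T A W" "W \<subseteq> W'"
  shows "test_ok T A W'"
  unfolding test_ok_def
proof (intro allI impI)
  fix X Y s os assume "X \<notin> W'" "Y \<notin> W'" "X \<noteq> Y" "Y \<notin> fixed" "glob s"
  then show "wp (T X Y) (\<lambda>s' os'. os' = os \<and> frame (insert Y W') s s' \<and> s' Y = of_bool (s X \<in> A s)) s os"
    using assms(2) by (intro test_okD[OF assms(1)]) (auto simp: frame_def)
qed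

lemma fixed_only_phases: "fixed_only (\<lambda>s. phases_set L Ss (hashed s) (taus s) R p)"
proof -
  have "hashed s = hashed s' \<and> taus s = taus s'" if "\<forall>z\<in>fixed. s z = s' z" for s s'
    using that by (auto simp: hashed_def fun_eq_iff)
  then show ?thesis unfolding fixed_only_def by metis
qed

lemma fixed_only_rounds:
  assumes "fixed_only A"
  shows "fixed_only (\<lambda>s. rounds_set L Ss (smp p A s) (taus s p) (A s) r)"
  unfolding fixed_only_def
proof (intro allI impI)
  fix s s' assume e: "\<forall>z\<in>fixed. s z = (s' z :: nat)"
  have "hashed s = hashed s'" "taus s p = taus s' p"
    using e by (auto simp: hashed_def fun_eq_iff)
  moreover have "A s = A s'" using assms e unfolding fixed_only_def by blast
  ultimately show "rounds_set L Ss (smp p A s) (taus s p) (A s) r =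
      rounds_set L Ss (smp p A s') (taus s' p) (A s') r" by simp
qed

lemma rounds_code_ok:
  assumes T0: "test_ok T0 A (wphase p)" and A: "fixed_only A"
  shows "test_ok (rounds_code p T0 r)
     (\<lambda>s. rounds_set L Ss (smp p A s) (taus s p) (A s) r) (wround p r)"
proof (induction r)
  case 0
  show ?case using test_ok_mono[OF T0, of "wround p 0"] by (simp add: wround_def)
next
  case (Suc r)
  have "test_ok (round_code p r T0 (rounds_code p T0 r))
     (\<lambda>s. rounds_set L Ss (smp p A s) (taus s p) (A s) r \<union>
       {v. taus s p r \<le> hit_count L Ss (smp p A s) (rounds_set L Ss (smp p A s) (taus s p) (A s) r) v})
     (wround p r \<union> range (Rd p r))"
    by (rule round_code_ok[OF T0 Suc _ _ _ _ _ A fixed_only_rounds[OF A]])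
      (auto simp: wround_def wphase_def fixed_def)
  moreover have "wround p r \<union> range (Rd p r) \<subseteq> wround p (Suc r)" by (auto simp: wround_def)
  ultimately show ?case by (simp add: test_ok_mono)
qed

lemma phase_code_ok:
  "test_ok (phase_code R p) (\<lambda>s. phases_set L Ss (hashed s) (taus s) R p) (wphase p)"
proof (induction p)
  case 0
  show ?case using const_less[of 0]
    by (auto simp: test_ok_def intro!: wp_Set frame_upd frame_refl)
next
  case (Suc p)
  have "test_ok (rounds_code p (phase_code R p) R)
     (\<lambda>s. phases_set L Ss (hashed s) (taus s) R (Suc p)) (wround p R)"
    using rounds_code_ok[OF Suc fixed_only_phases, of R] by simp
  then have "test_ok (rounds_code p (phase_code R p) R)
     (\<lambda>s. phases_set L Ss (hashed s) (taus s) R (Suc p)) (wphase (Suc p))"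
    by (rule test_ok_mono) (auto simp: wround_def wphase_def)
  then show ?case by simp
qed

end

lemma rounds_set_cong:
  "(\<And>r'. r' < r \<Longrightarrow> \<tau> r' = \<tau>' r') \<Longrightarrow> rounds_set L Ss T \<tau> A r = rounds_set L Ss T \<tau>' A r"
  by (induction r) auto

lemma phases_set_cong:
  assumes "\<And>p j. p < D \<Longrightarrow> h p j = h' p j" "\<And>p r. p < D \<Longrightarrow> r < R \<Longrightarrow> \<tau> p r = \<tau>' p r"
  shows "phases_set L Ss h \<tau> R D = phases_set L Ss h' \<tau>' R D"
  using assms
proof (induction D)
  case (Suc p)
  have "h p = h' p" using Suc.prems(1) by (auto simp: fun_eq_iff)
  moreover have "phases_set L Ss h \<tau> R p = phases_set L Ss h' \<tau>' R p" using Suc by simp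
  ultimately show ?case using rounds_set_cong[of R "\<tau> p" "\<tau>' p"] Suc.prems(2) by simp
qed simp

section \<open>The search over target sizes and advice\<close>

locale main = alg w n inp wd As L
  for w n :: nat and inp :: "nat list" and wd :: "vr \<Rightarrow> nat" and As :: "nat list list" and L :: nat +
  fixes vl D R :: nat
  assumes vl: "vl * length As + vl < n ^ wd (Ph p PH)" "vl < n ^ wd (Gl g)" "vl < n ^ wd (Adv p a)"
      "n + 1 < n ^ wd (Gl g)"
begin

abbreviation A :: "(vr \<Rightarrow> nat) \<Rightarrow> nat set" where
  "A s \<equiv> phases_set L Ss (hashed s) (taus s) R D"

abbreviation T :: test where
  "T \<equiv> phase_code R D"

definition temps :: "vr set" where
  "temps = wphase D \<union> Gl ` {GOOD, CNT, GV, GF, GJ, GPOS, GSIZ, GE, GEL, HIT}"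

definition good :: "(vr \<Rightarrow> nat) \<Rightarrow> bool" where
  "good s \<longleftrightarrow> card {v. v < n \<and> v \<in> A s} \<le> s (Gl SZ) \<and> (\<forall>j<length As. Ss ! j \<inter> A s \<noteq> {})"

definition result :: "(vr \<Rightarrow> nat) \<Rightarrow> nat list" where
  "result s = filter (\<lambda>v. v \<in> A s) [0..<n]"

lemma Gl_wphase: "Gl g \<notin> wphase p"
  by (auto simp: wphase_def)

lemma wphase_fixed: "wphase p \<inter> fixed = {}"
  by (auto simp: wphase_def fixed_def)

lemma temps_fixed: "temps \<inter> fixed = {}"
  using wphase_fixed[of D] by (auto simp: temps_def fixed_def)

lemma Gl_temps: "Gl g \<in> temps \<longleftrightarrow> g \<in> {GOOD, CNT, GV, GF, GJ, GPOS, GSIZ, GE, GEL, HIT}"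
  using Gl_wphase by (auto simp: temps_def)

lemma A_frame: "frame V s s' \<Longrightarrow> V \<inter> fixed = {} \<Longrightarrow> A s' = A s"
  using fixed_only_frame[OF fixed_only_phases] .

lemma frame_temps:
  assumes "frame temps s s'" "glob s"
  shows "glob s'" "A s' = A s" "s' one = 1" "s' (Gl NN) = n" "s' (Gl MM) = length As"
    "s' (Gl SZ) = s (Gl SZ)"
  using glob_frame[OF assms(2,1) temps_fixed] A_frame[OF assms(1) temps_fixed]
    frameD[OF assms(1), of "Gl SZ"]
  by (auto simp: glob_def Gl_temps)

lemma test_temps:
  assumes "glob s" "g \<in> {GV, GEL}" and Q: "\<And>s'. frame (insert (Gl GF) (wphase D)) s s' \<Longrightarrow>
      s' (Gl GF) = of_bool (s (Gl g) \<in> A s) \<Longrightarrow> Q s' os"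
  shows "wp (T (Gl g) (Gl GF)) Q s os"
  using Q assms(1,2) by (intro test_okD[OF phase_code_ok]) (auto simp: Gl_wphase)

lemma check_code_ok:
  assumes s: "glob s"
    and Q: "\<And>s'. frame temps s s' \<Longrightarrow> s' (Gl GOOD) = of_bool (good s) \<Longrightarrow> Q s' os"
  shows "wp (check_code T) Q s os"
proof -
  define cd where "cd v = card {v'. v' < v \<and> v' \<in> A s}" for v
  have cd_Suc: "cd (Suc v) = cd v + of_bool (v \<in> A s)" for v
  proof -
    have "{v'. v' < Suc v \<and> v' \<in> A s} =
        (if v \<in> A s then insert v {v'. v' < v \<and> v' \<in> A s} else {v'. v' < v \<and> v' \<in> A s})"
      by (auto simp: less_Suc_eq)
    then show ?thesis by (simp add: cd_def)
  qed
  have cd_le: "cd v \<le> v" for v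
    using card_mono[of "{..<v}" "{v'. v' < v \<and> v' \<in> A s}"] by (auto simp: cd_def)
  let ?c1 = "For one (Gl GV) (Gl NN) (T (Gl GV) (Gl GF) ;; Bin Add (Gl CNT) (Gl CNT) (Gl GF))"
  let ?each = "each (Gl GPOS) (Gl GSIZ) (Gl GE) (Gl GEL) (
         T (Gl GEL) (Gl GF) ;; If (Eq (Gl GF) one) (Set (Gl HIT) 1) Skip)"
  let ?body = "Inp (Gl GSIZ) (Gl GPOS) ;; Set (Gl HIT) 0 ;; ?each ;;
       If (Eq (Gl HIT) one) Skip (Set (Gl GOOD) 0) ;;
       Bin Add (Gl GPOS) (Gl GPOS) (Gl GSIZ) ;; Bin Add (Gl GPOS) (Gl GPOS) one"
  \<comment> \<open>\<open>GOOD\<close> starts this loop as the verdict on the size and can only be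
    lowered, by a set that is missed; the next definition says this.\<close>
  let ?c2 = "For one (Gl GJ) (Gl MM) ?body"
  define P2 where "P2 j s' \<longleftrightarrow> s' (Gl GPOS) = setpos As j \<and>
     s' (Gl GOOD) = of_bool (cd n \<le> s (Gl SZ) \<and> (\<forall>j'<j. Ss ! j' \<inter> A s \<noteq> {}))" for j s'
  have loop1: "wp ?c1 Q' t os"
    if t: "frame temps s t" "t (Gl CNT) = 0" "t (Gl GOOD) = 1"
      and Q': "\<And>t'. frame temps s t' \<Longrightarrow> t' (Gl CNT) = cd n \<Longrightarrow> t' (Gl GOOD) = 1 \<Longrightarrow> Q' t' os" for t Q'
  proof (rule wp_For[where L = n and W = temps and ?s0.0 = s and
        I = "\<lambda>v s' os'. os' = os \<and> s' (Gl CNT) = cd v \<and> s' (Gl GOOD) = 1"])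
    show "t (Gl NN) = n" "t one = 1" using frame_temps[OF t(1) s] by auto
    show "n < n ^ wd (Gl GV)" by (rule short)
    fix v t' os' assume v: "v < n" "frame temps s t'" "t' (Gl GV) = v"
      "os' = os \<and> t' (Gl CNT) = cd v \<and> t' (Gl GOOD) = 1"
    note g = frame_temps[OF v(2) s]
    show "wp (T (Gl GV) (Gl GF) ;; Bin Add (Gl CNT) (Gl CNT) (Gl GF))
        (\<lambda>s' os'. frame temps s s' \<and> s' (Gl GV) = v \<and> os' = os \<and> s' (Gl CNT) = cd (Suc v) \<and>
           s' (Gl GOOD) = 1) t' os'"
    proof (intro wp_Seq test_temps)
      fix t2 assume t2: "frame (insert (Gl GF) (wphase D)) t' t2"
        "t2 (Gl GF) = of_bool (t' (Gl GV) \<in> A t')"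
      have f2: "frame temps s t2"
        by (rule frame_trans[OF v(2) t2(1)]) (auto simp: temps_def)
      have e2: "t2 (Gl GV) = v" "t2 (Gl CNT) = cd v" "t2 (Gl GOOD) = 1"
        using frameD[OF t2(1), of "Gl GV"] frameD[OF t2(1), of "Gl CNT"] frameD[OF t2(1), of "Gl GOOD"]
          v Gl_wphase by auto
      have "cd v + of_bool (v \<in> A s) < n ^ wd (Gl CNT)"
        using cd_le[of v] v(1) short(1)[of "Gl CNT"] by simp
      then show "wp (Bin Add (Gl CNT) (Gl CNT) (Gl GF))
        (\<lambda>s' os'. frame temps s s' \<and> s' (Gl GV) = v \<and> os' = os \<and> s' (Gl CNT) = cd (Suc v) \<and>
           s' (Gl GOOD) = 1) t2 os'"
        using e2 t2(2) g(2) v f2 by (intro wp_Add) (auto simp: cd_Suc Gl_temps intro!: frame_upd)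
    qed (use g in auto)
  qed (use t Q' in \<open>auto simp: Gl_temps cd_def\<close>)
  have hitloop: "wp ?each Q' t os"
    if t: "j < length As" "frame temps s t" "t (Gl GPOS) = setpos As j" "t (Gl GSIZ) = length (As ! j)"
       "t (Gl HIT) = 0"
      and Q': "\<And>t'. frame (wphase D \<union> Gl ` {GE, GEL, GF, HIT}) t t' \<Longrightarrow>
         t' (Gl HIT) = of_bool (Ss ! j \<inter> A s \<noteq> {}) \<Longrightarrow> Q' t' os" for t Q' j
  proof (rule wp_each[where j = j and W = "wphase D \<union> Gl ` {GE, GEL, GF, HIT}" and
        I = "\<lambda>k s' os'. os' = os \<and> s' (Gl HIT) = of_bool (\<exists>k'<k. As ! j ! k' \<in> A s)"])
    show "t one = 1" using frame_temps[OF t(2) s] by auto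
    fix k t' os' assume k: "k < length (As ! j)" "frame (wphase D \<union> Gl ` {GE, GEL, GF, HIT}) t t'"
      "t' (Gl GE) = k" "t' (Gl GEL) = As ! j ! k"
      "os' = os \<and> t' (Gl HIT) = of_bool (\<exists>k'<k. As ! j ! k' \<in> A s)"
    have f1: "frame temps s t'"
      by (rule frame_trans[OF t(2) k(2)]) (auto simp: temps_def)
    note g = frame_temps[OF f1 s]
    show "wp (T (Gl GEL) (Gl GF) ;; If (Eq (Gl GF) one) (Set (Gl HIT) 1) Skip)
      (\<lambda>s' os'. frame (wphase D \<union> Gl ` {GE, GEL, GF, HIT}) t s' \<and> s' (Gl GE) = k \<and> os' = os \<and>
         s' (Gl HIT) = of_bool (\<exists>k'<Suc k. As ! j ! k' \<in> A s)) t' os'"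
    proof (intro wp_Seq test_temps)
      fix t2 assume t2: "frame (insert (Gl GF) (wphase D)) t' t2"
        "t2 (Gl GF) = of_bool (t' (Gl GEL) \<in> A t')"
      have f2: "frame (wphase D \<union> Gl ` {GE, GEL, GF, HIT}) t t2"
        by (rule frame_trans[OF k(2) t2(1)]) auto
      have e2: "t2 (Gl GE) = k" "t2 (Gl HIT) = t' (Gl HIT)" "t2 one = 1"
        using frameD[OF t2(1), of "Gl GE"] frameD[OF t2(1), of "Gl HIT"] frameD[OF t2(1), of one]
          k Gl_wphase g by auto
      show "wp (If (Eq (Gl GF) one) (Set (Gl HIT) 1) Skip)
       (\<lambda>s' os'. frame (wphase D \<union> Gl ` {GE, GEL, GF, HIT}) t s' \<and> s' (Gl GE) = k \<and> os' = os \<and>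
         s' (Gl HIT) = of_bool (\<exists>k'<Suc k. As ! j ! k' \<in> A s)) t2 os'"
        using e2 f2 k(4,5) t2(2) g(2) const_less[of 1 "Gl HIT"]
        by (intro wp_If wp_Set wp_Skip) (auto simp: less_Suc_eq intro!: frame_upd)
    qed (use g in auto)
  next
    show "Q' t' os'" if "frame (wphase D \<union> Gl ` {GE, GEL, GF, HIT}) t t'"
      "os' = os \<and> t' (Gl HIT) = of_bool (\<exists>k'<length (As ! j). As ! j ! k' \<in> A s)" for t' os'
    proof -
      have "(\<exists>k'<length (As ! j). As ! j ! k' \<in> A s) \<longleftrightarrow> Ss ! j \<inter> A s \<noteq> {}"
        using t(1) by (simp add: disjoint_iff) (metis in_set_conv_nth)
      then show ?thesis using that Q'[of t'] by simp
    qed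
  qed (use t Gl_wphase in auto)
  have M: "length As < length inp"
    unfolding inp by (induction As) auto
  have loop2: "wp ?c2 Q t os" if t: "frame temps s t" "P2 0 t" for t
  proof (rule wp_For[where L = "length As" and W = temps and ?s0.0 = s and
        I = "\<lambda>j s' os'. os' = os \<and> P2 j s'"])
    show "t (Gl MM) = length As" "t one = 1" using frame_temps[OF t(1) s] by auto
    show "length As < n ^ wd (Gl GJ)" using M long(1)[of GJ] by simp
    fix j t' os' assume j: "j < length As" "frame temps s t'" "t' (Gl GJ) = j" "os' = os \<and> P2 j t'"
    note nth = setpos_nth(1,2)[OF j(1) inp]
    let ?Q = "\<lambda>s' os'. frame temps s s' \<and> s' (Gl GJ) = j \<and> os' = os \<and> P2 (Suc j) s'"
    let ?t = "t'(Gl GSIZ := length (As ! j), Gl HIT := 0)"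
    have ft: "frame temps s ?t" using j(2) by (auto simp: Gl_temps intro!: frame_upd)
    have fin: "wp (If (Eq (Gl HIT) one) Skip (Set (Gl GOOD) 0) ;;
       Bin Add (Gl GPOS) (Gl GPOS) (Gl GSIZ) ;; Bin Add (Gl GPOS) (Gl GPOS) one) ?Q t2 os"
      if t2: "frame (wphase D \<union> Gl ` {GE, GEL, GF, HIT}) ?t t2"
         "t2 (Gl HIT) = of_bool (Ss ! j \<inter> A s \<noteq> {})" for t2
    proof -
      have f2: "frame temps s t2"
        by (rule frame_trans[OF ft t2(1)]) (auto simp: temps_def)
      have e2: "t2 (Gl GJ) = j" "t2 (Gl GPOS) = setpos As j" "t2 (Gl GSIZ) = length (As ! j)"
        "t2 (Gl GOOD) = of_bool (cd n \<le> s (Gl SZ) \<and> (\<forall>j'<j. Ss ! j' \<inter> A s \<noteq> {}))"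
        using frameD[OF t2(1), of "Gl GJ"] frameD[OF t2(1), of "Gl GPOS"]
          frameD[OF t2(1), of "Gl GSIZ"] frameD[OF t2(1), of "Gl GOOD"] j Gl_wphase
        by (auto simp: P2_def)
      have "setpos As j + length (As ! j) + 1 < n ^ wd (Gl GPOS)"
        using setpos_le[of "Suc j" As n "length As"] j(1) inp long(1)[of GPOS] by simp
      moreover have "t2 (Gl HIT) = 1 \<longleftrightarrow> Ss ! j \<inter> A s \<noteq> {}"
        unfolding t2(2) by (rule of_bool_eq_1_iff)
      ultimately show ?thesis
        using e2 f2 frame_temps(3)[OF f2 s] n_gt2 const_less[of 0 "Gl GOOD"] j(1)
        by (intro wp_Seq wp_If wp_Add wp_Set wp_Skip)
          (auto simp: P2_def less_Suc_eq Gl_temps intro!: frame_upd)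
    qed
    have "wp ?each (wp (If (Eq (Gl HIT) one) Skip (Set (Gl GOOD) 0) ;;
       Bin Add (Gl GPOS) (Gl GPOS) (Gl GSIZ) ;; Bin Add (Gl GPOS) (Gl GPOS) one) ?Q) ?t os"
      using j ft fin by (intro hitloop[of j]) (auto simp: P2_def)
    then have "wp (Set (Gl HIT) 0 ;; ?each ;; If (Eq (Gl HIT) one) Skip (Set (Gl GOOD) 0) ;;
       Bin Add (Gl GPOS) (Gl GPOS) (Gl GSIZ) ;; Bin Add (Gl GPOS) (Gl GPOS) one) ?Q
       (t'(Gl GSIZ := length (As ! j))) os"
      using const_less[of 0 "Gl HIT"] by (intro wp_Seq[of "Set (Gl HIT) 0"] wp_Set wp_Seq[of ?each]) auto
    moreover have "length (As ! j) \<in> set inp" using nth by (metis nth_mem)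
    moreover have "input_word w inp (t' (Gl GPOS)) = length (As ! j)"
      using j(4) nth by (simp add: P2_def input_word_nth)
    ultimately show "wp ?body ?Q t' os'"
      using j(4) entries(1)[of _ GSIZ] by (intro wp_Seq[of "Inp (Gl GSIZ) (Gl GPOS)"] wp_Inp) auto
  next
    show "Q t' os'" if "frame temps s t'" "os' = os \<and> P2 (length As) t'" for t' os'
      using that Q[of t'] by (auto simp: P2_def good_def cd_def)
  qed (use t in \<open>auto simp: Gl_temps P2_def\<close>)
  let ?s = "s(Gl GOOD := 1, Gl CNT := 0)"
  have "wp ?c1 (wp (If (Less (Gl SZ) (Gl CNT)) (Set (Gl GOOD) 0) Skip ;; Set (Gl GPOS) 2 ;; ?c2) Q) ?s os"
  proof (rule loop1)
    show "frame temps s ?s" by (auto simp: Gl_temps intro!: frame_upd frame_refl)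
    fix t assume t: "frame temps s t" "t (Gl CNT) = cd n" "t (Gl GOOD) = 1"
    have c3: "wp (Set (Gl GPOS) 2 ;; ?c2) Q t' os"
      if "frame temps s t'" "t' (Gl GOOD) = of_bool (cd n \<le> s (Gl SZ))" for t'
      using that const_less[of 2 "Gl GPOS"]
      by (intro wp_Seq wp_Set loop2) (auto simp: P2_def Gl_temps intro!: frame_upd)
    note e = t(2) frame_temps(6)[OF t(1) s]
    show "wp (If (Less (Gl SZ) (Gl CNT)) (Set (Gl GOOD) 0) Skip ;; Set (Gl GPOS) 2 ;; ?c2) Q t os"
    proof (rule wp_Seq, rule wp_If)
      assume c: "cval (Less (Gl SZ) (Gl CNT)) t"
      have "frame temps s (t(Gl GOOD := 0))" using t(1) by (intro frame_upd) (simp_all add: Gl_temps)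
      moreover have "(t(Gl GOOD := 0)) (Gl GOOD) = of_bool (cd n \<le> s (Gl SZ))" using c e by simp
      ultimately show "wp (Set (Gl GOOD) 0) (wp (Set (Gl GPOS) 2 ;; ?c2) Q) t os"
        using const_less[of 0 "Gl GOOD"] by (intro wp_Set c3) simp_all
    next
      assume "\<not> cval (Less (Gl SZ) (Gl CNT)) t"
      then have "t (Gl GOOD) = of_bool (cd n \<le> s (Gl SZ))" using e t(3) by simp
      then show "wp Skip (wp (Set (Gl GPOS) 2 ;; ?c2) Q) t os"
        using t(1) by (intro wp_Skip c3)
    qed
  qed auto
  then show ?thesis
    unfolding check_code_def using const_less n_gt2 by (intro wp_Seq wp_Set) auto
qed

definition outcome :: "(vr \<Rightarrow> nat) \<Rightarrow> nat list \<Rightarrow> (vr \<Rightarrow> nat) \<Rightarrow> nat list \<Rightarrow> bool" where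
  "outcome s os s' os' \<longleftrightarrow>
     (if s (Gl DONE) = 1 then s' (Gl DONE) = 1 \<and> os' = os
      else if good s then s' (Gl DONE) = 1 \<and> os' = os @ result s
      else s' (Gl DONE) = 0 \<and> os' = os)"

lemma try_code_ok:
  assumes s: "glob s" "s (Gl DONE) \<in> {0, 1}"
    and Q: "\<And>s' os'. frame (insert (Gl DONE) temps) s s' \<Longrightarrow> outcome s os s' os' \<Longrightarrow> Q s' os'"
  shows "wp (try_code T) Q s os"
proof -
  have out: "wp (For one (Gl GV) (Gl NN) (T (Gl GV) (Gl GF) ;; If (Eq (Gl GF) one) (Out (Gl GV)) Skip) ;;
       Set (Gl DONE) 1) Q t os"
    if t: "frame temps s t" "good s" "s (Gl DONE) = 0" for t
  proof (intro wp_Seq, rule wp_For[where L = n and W = temps and ?s0.0 = s and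
        I = "\<lambda>v s' os'. os' = os @ filter (\<lambda>v. v \<in> A s) [0..<v]"])
    show "t (Gl NN) = n" "t one = 1" using frame_temps[OF t(1) s(1)] by auto
    show "n < n ^ wd (Gl GV)" by (rule short)
    fix v t' os' assume v: "v < n" "frame temps s t'" "t' (Gl GV) = v"
      "os' = os @ filter (\<lambda>v. v \<in> A s) [0..<v]"
    note g = frame_temps[OF v(2) s(1)]
    show "wp (T (Gl GV) (Gl GF) ;; If (Eq (Gl GF) one) (Out (Gl GV)) Skip)
        (\<lambda>s' os'. frame temps s s' \<and> s' (Gl GV) = v \<and>
           os' = os @ filter (\<lambda>v. v \<in> A s) [0..<Suc v]) t' os'"
    proof (intro wp_Seq test_temps)
      fix t2 assume t2: "frame (insert (Gl GF) (wphase D)) t' t2"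
        "t2 (Gl GF) = of_bool (t' (Gl GV) \<in> A t')"
      have f2: "frame temps s t2"
        by (rule frame_trans[OF v(2) t2(1)]) (auto simp: temps_def)
      have e2: "t2 (Gl GV) = v" using frameD[OF t2(1), of "Gl GV"] v Gl_wphase by auto
      have "t2 (Gl GF) = of_bool (v \<in> A s)" "t2 one = 1"
        using t2(2) v(3) g(2) frame_temps(3)[OF f2 s(1)] by simp_all
      then have c: "cval (Eq (Gl GF) one) t2 \<longleftrightarrow> v \<in> A s" by (simp only: cval.simps of_bool_eq_1_iff)
      show "wp (If (Eq (Gl GF) one) (Out (Gl GV)) Skip)
        (\<lambda>s' os'. frame temps s s' \<and> s' (Gl GV) = v \<and>
           os' = os @ filter (\<lambda>v. v \<in> A s) [0..<Suc v]) t2 os'"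
      proof (rule wp_If)
        assume "cval (Eq (Gl GF) one) t2"
        then show "wp (Out (Gl GV)) (\<lambda>s' os'. frame temps s s' \<and> s' (Gl GV) = v \<and>
           os' = os @ filter (\<lambda>v. v \<in> A s) [0..<Suc v]) t2 os'"
          unfolding c using f2 e2 v(4) by (intro wp_Out) simp
      next
        assume "\<not> cval (Eq (Gl GF) one) t2"
        then show "wp Skip (\<lambda>s' os'. frame temps s s' \<and> s' (Gl GV) = v \<and>
           os' = os @ filter (\<lambda>v. v \<in> A s) [0..<Suc v]) t2 os'"
          unfolding c using f2 e2 v(4) by (intro wp_Skip) simp
      qed
    qed (use g in auto)
  next
    fix t' os' assume t': "frame temps s t'" "os' = os @ filter (\<lambda>v. v \<in> A s) [0..<n]"
    have "frame (insert (Gl DONE) temps) s (t'(Gl DONE := 1))"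
      using t'(1) by (auto simp: frame_def)
    then show "wp (Set (Gl DONE) 1) Q t' os'"
      using const_less[of 1 "Gl DONE"] t t'
      by (intro wp_Set Q) (auto simp: outcome_def result_def)
  qed (use t in \<open>auto simp: Gl_temps\<close>)
  have fr: "frame (insert (Gl DONE) temps) s t" if "frame temps s t" for t
    using that by (auto simp: frame_def)
  show ?thesis
    unfolding try_code_def
  proof (rule wp_If)
    assume "cval (Eq (Gl DONE) one) s"
    then show "wp Skip Q s os"
      using s by (intro wp_Skip Q) (auto simp: outcome_def glob_def frame_refl)
  next
    assume nd: "\<not> cval (Eq (Gl DONE) one) s"
    then have d: "s (Gl DONE) = 0" using s by (auto simp: glob_def)
    show "wp (check_code T ;;
       If (Eq (Gl GOOD) one) (
         For one (Gl GV) (Gl NN) (T (Gl GV) (Gl GF) ;; If (Eq (Gl GF) one) (Out (Gl GV)) Skip) ;;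
         Set (Gl DONE) 1) Skip) Q s os"
    proof (intro wp_Seq[of "check_code T"] check_code_ok)
      fix t assume t: "frame temps s t" "t (Gl GOOD) = of_bool (good s)"
      have o: "t one = 1" using frame_temps[OF t(1) s(1)] by auto
      have td: "t (Gl DONE) = 0" using frameD[OF t(1), of "Gl DONE"] d by (simp add: Gl_temps)
      show "wp (If (Eq (Gl GOOD) one) (
         For one (Gl GV) (Gl NN) (T (Gl GV) (Gl GF) ;; If (Eq (Gl GF) one) (Out (Gl GV)) Skip) ;;
         Set (Gl DONE) 1) Skip) Q t os"
      proof (rule wp_If)
        assume "cval (Eq (Gl GOOD) one) t"
        then have "good s" using t(2) o by (cases "good s") auto
        then show "wp (For one (Gl GV) (Gl NN) (T (Gl GV) (Gl GF) ;; If (Eq (Gl GF) one) (Out (Gl GV)) Skip) ;;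
         Set (Gl DONE) 1) Q t os" using out t(1) d by blast
      next
        assume "\<not> cval (Eq (Gl GOOD) one) t"
        then have "\<not> good s" using t(2) o by (cases "good s") auto
        then show "wp Skip Q t os"
          using d td fr[OF t(1)] by (intro wp_Skip Q) (auto simp: outcome_def)
      qed
    qed (use s in auto)
  qed
qed

definition vars_of :: "(vr \<times> vr) list \<Rightarrow> vr set" where
  "vars_of ys = fst ` set ys"

lemma vars_ofE:
  assumes "z \<in> vars_of ys"
  obtains l where "(z, l) \<in> set ys"
  using assms unfolding vars_of_def by (metis imageE prod.collapse)

text \<open>\<open>Adv\<close> may equal \<open>vl\<close>, although advice is smaller: a finished
  search loop leaves its variable at the limit.\<close>

definition base :: "(vr \<Rightarrow> nat) \<Rightarrow> bool" where
  "base s \<longleftrightarrow> s one = 1 \<and> s (Gl NN) = n \<and> s (Gl MM) = length As \<and> s (Gl CAP) = L \<and>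
     s (Gl VL) = vl \<and> (\<forall>p a. s (Adv p a) \<le> vl) \<and> s (Gl DONE) \<in> {0, 1}"

lemma base_glob:
  assumes "base s"
  shows "glob s"
proof -
  have "s (Adv p HA) * j + s (Adv p HB) < n ^ wd (Ph p PH)" if "j < length As" for p j
  proof -
    have "s (Adv p HA) * j + s (Adv p HB) \<le> vl * length As + vl"
      using that assms by (intro add_mono mult_mono) (auto simp: base_def)
    then show ?thesis using vl(1)[of p] by linarith
  qed
  then show ?thesis using assms by (simp add: base_def glob_def)
qed

lemma good_cong:
  assumes "\<And>p j. p < D \<Longrightarrow> hashed s p j = hashed t p j"
    "\<And>p r. p < D \<Longrightarrow> r < R \<Longrightarrow> s (Tau p r) = t (Tau p r)"
  shows "A s = A t"
  by (rule phases_set_cong) (use assms in auto)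

lemma good_frame:
  assumes "frame W s t" "W \<inter> fixed = {}" "Gl SZ \<notin> W"
  shows "good s = good t" "result s = result t"
  using A_frame[OF assms(1,2)] frameD[OF assms(1,3)] by (auto simp: good_def result_def)

text \<open>A candidate is represented by a whole state that may differ from \<open>s\<close> only
  in the enumerated variables \<open>ys\<close> and in \<open>W\<close>. The latter is used with
  scratch variables, which \<open>good\<close> and \<open>result\<close> do not read.\<close>

definition works :: "vr set \<Rightarrow> (vr \<times> vr) list \<Rightarrow> (vr \<Rightarrow> nat) \<Rightarrow> (vr \<Rightarrow> nat) \<Rightarrow> bool" where
  "works W ys s t \<longleftrightarrow> frame (W \<union> vars_of ys) s t \<and> (\<forall>(x, l)\<in>set ys. t x < s l) \<and> good t"

definition scratch :: "vr set" where
  "scratch = insert (Gl DONE) temps"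

text \<open>It is left open which candidate is output, so the order in which the nested loops try
  them does not enter the invariants.\<close>

definition enum_outcome :: "((vr \<Rightarrow> nat) \<Rightarrow> bool) \<Rightarrow> (vr \<Rightarrow> nat) \<Rightarrow> nat list \<Rightarrow> (vr \<Rightarrow> nat) \<Rightarrow> nat list \<Rightarrow> bool" where
  "enum_outcome P s os s' os' \<longleftrightarrow>
     (if s (Gl DONE) = 1 then s' (Gl DONE) = 1 \<and> os' = os
      else s' (Gl DONE) = 1 \<and> (\<exists>t. P t \<and> os' = os @ result t) \<or>
           s' (Gl DONE) = 0 \<and> os' = os \<and> (\<forall>t. \<not> P t))"

lemma enum_outcome_step:
  assumes "enum_outcome P s os s' os'" "enum_outcome Q s' os' s'' os''"
    "\<And>t. R' t \<longleftrightarrow> P t \<or> Q t" "s (Gl DONE) \<in> {0, 1}"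
  shows "enum_outcome R' s os s'' os''"
  using assms unfolding enum_outcome_def by (auto split: if_splits)

lemma scratch_fixed: "scratch \<inter> fixed = {}" "Gl SZ \<notin> scratch" "Gl VL \<notin> scratch"
  using temps_fixed by (auto simp: scratch_def Gl_temps fixed_def)

lemma scratch_Adv: "Adv p a \<notin> scratch" "Tau p r \<notin> scratch"
  using scratch_fixed(1) fixed_simps by blast+

lemma enum_code_ok:
  assumes ys: "distinct (map fst ys)"
    "\<And>x l. (x, l) \<in> set ys \<Longrightarrow> (x, l) = (Gl QQ, Gl VL) \<or> (\<exists>p a. (x, l) = (Adv p a, Gl VL)) \<or>
        (\<exists>p r. (x, l) = (Tau p r, Gl CAP))"
    and s: "base s"
  shows "wp (enum_code ys (try_code T))
    (\<lambda>s' os'. frame (scratch \<union> vars_of ys) s s' \<and> base s' \<and>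
        enum_outcome (works scratch ys s) s os s' os') s os"
  using assms
proof (induction ys arbitrary: s os)
  case Nil
  have "wp (try_code T) (\<lambda>s' os'. frame scratch s s' \<and> base s' \<and>
        enum_outcome (works scratch [] s) s os s' os') s os"
  proof (rule try_code_ok)
    show "glob s" "s (Gl DONE) \<in> {0, 1}" using base_glob Nil by (auto simp: base_def)
    fix s' os' assume f: "frame (insert (Gl DONE) temps) s s'" "outcome s os s' os'"
    then have f': "frame scratch s s'" by (simp add: scratch_def)
    have "s' (Gl VL) = s (Gl VL)" "\<And>p a. s' (Adv p a) = s (Adv p a)"
      using frameD[OF f'] scratch_fixed scratch_Adv by auto
    moreover have "s' (Gl DONE) \<in> {0, 1}" using f(2) by (auto simp: outcome_def split: if_splits)
    ultimately have "base s'"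
      using Nil(3) frame_fixed[OF f' scratch_fixed(1)] by (simp add: base_def)
    moreover have "enum_outcome (works scratch [] s) s os s' os'"
    proof -
      have g: "good s = good t" "result s = result t" if "frame scratch s t" for t
        using good_frame[OF that] scratch_fixed by auto
      have w: "works scratch [] s t \<longleftrightarrow> frame scratch s t \<and> good s" for t
        using g(1)[of t] by (auto simp: works_def vars_of_def)
      have "(\<exists>t. works scratch [] s t \<and> os' = os @ result t) \<longleftrightarrow> good s \<and> os' = os @ result s"
        unfolding w using g(2) frame_refl[of scratch s] by metis
      moreover have "(\<forall>t. \<not> works scratch [] s t) \<longleftrightarrow> \<not> good s"
        unfolding w using frame_refl[of scratch s] by blast
      ultimately show ?thesis
        using f(2) unfolding outcome_def enum_outcome_def by presburger
    qed
    ultimately show "frame scratch s s' \<and> base s' \<and> enum_outcome (works scratch [] s) s os s' os'"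
      using f' by simp
  qed
  then show ?case by (simp add: vars_of_def)
next
  case (Cons y ys)
  obtain x l where y: "y = (x, l)" by (cases y)
  have xl: "(x, l) = (Gl QQ, Gl VL) \<or> (\<exists>p a. (x, l) = (Adv p a, Gl VL)) \<or>
        (\<exists>p r. (x, l) = (Tau p r, Gl CAP))" using Cons.prems(2)[of x l] y by auto
  have x_ys: "x \<notin> vars_of ys" using Cons.prems(1) y by (auto simp: vars_of_def)
  have ys_ty: "z = Gl QQ \<or> (\<exists>p a. z = Adv p a) \<or> (\<exists>p r. z = Tau p r)" if "z \<in> vars_of (y # ys)" for z
  proof -
    obtain l' where "(z, l') \<in> set (y # ys)" using \<open>z \<in> vars_of (y # ys)\<close> by (rule vars_ofE)
    from Cons.prems(2)[OF this] show ?thesis by blast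
  qed
  define W where "W = scratch \<union> vars_of (y # ys)"
  have W: "x \<in> W" "scratch \<union> vars_of ys \<subseteq> W" by (auto simp: W_def vars_of_def y)
  have lW: "Gl VL \<notin> W" "Gl CAP \<notin> W" "one \<notin> W" "Gl SZ \<notin> W" "l \<notin> W"
    using ys_ty[of "Gl VL"] ys_ty[of "Gl CAP"] ys_ty[of one] ys_ty[of "Gl SZ"] scratch_fixed fixed_simps xl
    by (auto simp: W_def)
  have xs: "x \<notin> scratch" using xl scratch_Adv scratch_fixed fixed_simps by blast
  \<comment> \<open>The loop over \<open>x\<close> has dealt with the candidates whose value at
    \<open>x\<close> is below \<open>i\<close>.\<close>
  define P where "P i t \<longleftrightarrow> works scratch (y # ys) s t \<and> t x < i" for i t
  have "wp (For one x l (enum_code ys (try_code T)))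
      (\<lambda>s' os'. frame W s s' \<and> base s' \<and> enum_outcome (works scratch (y # ys) s) s os s' os') s os"
  proof (rule wp_For[where L = "s l" and W = W and ?s0.0 = s and
        I = "\<lambda>i s' os'. base s' \<and> enum_outcome (P i) s os s' os'"])
    show "s l = s l" ..
    show "s one = 1" using Cons.prems(3) by (simp add: base_def)
    have "s (Gl VL) = vl" "s (Gl CAP) = L" using Cons.prems(3) by (auto simp: base_def)
    then show "s l < n ^ wd x" using xl vl(2,3) short(2) by auto
    show "frame W s s" by (rule frame_refl)
    show "base s \<and> enum_outcome (P 0) s os s os"
      using Cons.prems(3) by (auto simp: enum_outcome_def P_def base_def)
    show "base (t(x := k)) \<and> enum_outcome (P i) s os (t(x := k)) os'"
      if "base t \<and> enum_outcome (P i) s os t os'" "k \<le> s l" for i k t os'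
    proof -
      have x: "one \<noteq> x" "Gl NN \<noteq> x" "Gl MM \<noteq> x" "Gl CAP \<noteq> x" "Gl VL \<noteq> x" "Gl DONE \<noteq> x"
        using xl by auto
      have kv: "k \<le> vl" if "Adv p a = x" for p a
      proof -
        have "l = Gl VL" using xl that by auto
        then show ?thesis using \<open>k \<le> s l\<close> Cons.prems(3) by (simp add: base_def)
      qed
      have "base (t(x := k))" using that(1) x kv by (simp add: base_def)
      moreover have "enum_outcome (P i) s os (t(x := k)) os'"
      proof -
        have "enum_outcome (P i) s os (t(x := k)) os' \<longleftrightarrow> enum_outcome (P i) s os t os'"
          using x by (simp add: enum_outcome_def)
        then show ?thesis using that(1) by blast
      qed
      ultimately show ?thesis ..
    qed
    show "frame W s t \<and> base t \<and> enum_outcome (works scratch (y # ys) s) s os t os'"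
      if "frame W s t" "base t \<and> enum_outcome (P (s l)) s os t os'" for t os'
    proof -
      have "P (s l) = works scratch (y # ys) s"
        by (auto simp: P_def works_def y fun_eq_iff)
      then show ?thesis using that by simp
    qed
    fix i t os' assume t: "i < s l" "frame W s t" "t x = i" "base t \<and> enum_outcome (P i) s os t os'"
    have lim: "t l' = s l'" if "(x', l') \<in> set (y # ys)" for x' l'
      using Cons.prems(2)[OF that] frameD[OF t(2)] lW by auto
    have works_iff: "works scratch ys t u \<longleftrightarrow> works scratch (y # ys) s u \<and> u x = i" for u
    proof -
      have "frame (scratch \<union> vars_of ys) t u \<longleftrightarrow> frame W s u \<and> u x = i"
      proof
        assume f: "frame (scratch \<union> vars_of ys) t u"
        then show "frame W s u \<and> u x = i"
          using frame_trans[OF t(2) f W(2)] frameD[OF f, of x] x_ys xs t(3) by auto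
      next
        assume f: "frame W s u \<and> u x = i"
        show "frame (scratch \<union> vars_of ys) t u"
          unfolding frame_def
        proof (intro allI impI)
          fix z assume z: "z \<notin> scratch \<union> vars_of ys"
          show "u z = t z"
          proof (cases "z = x")
            case True then show ?thesis using f t(3) by simp
          next
            case False
            then have "z \<notin> W" using z by (auto simp: W_def vars_of_def y)
            then show ?thesis using f frameD[OF t(2)] frameD[of W s u] by simp
          qed
        qed
      qed
      moreover have "(\<forall>(x', l')\<in>set ys. u x' < t l') \<longleftrightarrow> (\<forall>(x', l')\<in>set ys. u x' < s l')"
        using lim by force
      ultimately show ?thesis using t(1) by (auto simp: works_def W_def y)
    qed
    have "wp (enum_code ys (try_code T))
      (\<lambda>s' os''. frame (scratch \<union> vars_of ys) t s' \<and> base s' \<and>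
        enum_outcome (works scratch ys t) t os' s' os'') t os'"
      by (rule Cons.IH) (use Cons.prems t in auto)
    then show "wp (enum_code ys (try_code T))
      (\<lambda>s' os'. frame W s s' \<and> s' x = i \<and> base s' \<and> enum_outcome (P (Suc i)) s os s' os') t os'"
    proof (rule wp_mono)
      fix s' os''
      assume s': "frame (scratch \<union> vars_of ys) t s' \<and> base s' \<and>
        enum_outcome (works scratch ys t) t os' s' os''"
      have "frame W s s'" by (rule frame_trans[OF t(2) conjunct1[OF s'] W(2)])
      moreover have "s' x = i" using frameD[OF conjunct1[OF s'], of x] x_ys xs t(3) by auto
      moreover have "enum_outcome (P (Suc i)) s os s' os''"
      proof (rule enum_outcome_step)
        show "enum_outcome (P i) s os t os'" using t(4) by simp
        show "enum_outcome (works scratch ys t) t os' s' os''" using s' by simp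
        show "P (Suc i) u \<longleftrightarrow> P i u \<or> works scratch ys t u" for u
          by (auto simp: works_iff P_def)
        show "s (Gl DONE) \<in> {0, 1}" using Cons.prems(3) by (simp add: base_def)
      qed
      ultimately show "frame W s s' \<and> s' x = i \<and> base s' \<and> enum_outcome (P (Suc i)) s os s' os''"
        using s' by simp
    qed
  qed (use W lW in auto)
  then show ?case by (simp add: W_def y)
qed

lemma pow_com_ok:
  assumes "x \<noteq> Gl NN" "s (Gl NN) = n" "n ^ k < n ^ wd x" "Q (s(x := n ^ k)) os"
  shows "wp (pow_com x k) Q s os"
  using assms(3,4)
proof (induction k arbitrary: Q)
  case 0
  then show ?case using const_less[of 1 x]
    by (auto intro!: wp_Set simp del: fun_upd_apply One_nat_def)
next
  case (Suc k)
  have "n ^ k \<le> n * n ^ k" using n_gt2 by simp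
  also have "\<dots> < n ^ wd x" using Suc.prems(1) by simp
  finally have "n ^ k < n ^ wd x" .
  moreover have "wp (Bin Mul x x (Gl NN)) Q (s(x := n ^ k)) os"
  proof -
    have e: "(s(x := n ^ k)) x * (s(x := n ^ k)) (Gl NN) = n ^ Suc k"
      using assms(1,2) by (simp add: mult.commute)
    show ?thesis by (rule wp_Mul; unfold e fun_upd_upd) (use Suc.prems in \<open>simp_all del: fun_upd_apply\<close>)
  qed
  ultimately show ?case unfolding pow_com.simps by (intro wp_Seq Suc.IH)
qed

text \<open>
  The program tries the target sizes in increasing order, so for a given target any advice whose
  set hits everything may be output, whether or not it approximates the exact run.
\<close>

definition okay :: "(vr \<Rightarrow> nat) \<Rightarrow> bool" where
  "okay t \<longleftrightarrow> t (Gl QQ) < vl \<and> (\<forall>p<D. \<forall>a. t (Adv p a) < vl) \<and> (\<forall>p<D. \<forall>r<R. t (Tau p r) < L)"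

lemma advice_props:
  "distinct (map fst (advice D R))"
  "(x, l) \<in> set (advice D R) \<Longrightarrow> (x, l) = (Gl QQ, Gl VL) \<or> (\<exists>p a. (x, l) = (Adv p a, Gl VL)) \<or>
        (\<exists>p r. (x, l) = (Tau p r, Gl CAP))"
proof -
  have "distinct (concat (map (\<lambda>p. map (\<lambda>a. Adv p a) [HA, HB, HT]) [0..<k]))" for k
    by (induction k) auto
  moreover have "distinct (concat (map (\<lambda>p. map (\<lambda>r. Tau p r) [0..<j]) [0..<k]))" for j k
    by (induction k) (auto simp: distinct_map inj_on_def)
  ultimately show "distinct (map fst (advice D R))"
    by (auto simp: advice_def map_concat o_def)
qed (auto simp: advice_def)

lemma main_code_ok:
  assumes kl: "L = n ^ kl" "vl = n ^ kv"
    and t: "okay t" "\<forall>j<length As. Ss ! j \<inter> A t \<noteq> {}"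
    and Q: "\<And>s' u. \<forall>j<length As. Ss ! j \<inter> A u \<noteq> {} \<Longrightarrow>
       card {v. v < n \<and> v \<in> A u} \<le> card {v. v < n \<and> v \<in> A t} \<Longrightarrow> Q s' (result u)"
  shows "wp (main_code D R kl kv) Q (\<lambda>_. 0) []"
proof -
  let ?ys = "advice D R"
  define s0 where "s0 = (\<lambda>_. 0)(one := 1, Gl NN := n, Gl MM := length As, Gl CAP := L, Gl VL := vl,
     Gl TOP := n + 1)"
  have s0: "base s0" "s0 (Gl TOP) = n + 1" "s0 one = 1" "s0 (Gl DONE) = 0" "s0 (Gl VL) = vl"
    "s0 (Gl CAP) = L" by (auto simp: s0_def base_def)
  define W where "W = insert (Gl SZ) (scratch \<union> vars_of ?ys)"
  have vo: "z = Gl QQ \<or> (\<exists>p a. z = Adv p a) \<or> (\<exists>p r. z = Tau p r)" if "z \<in> vars_of ?ys" for z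
  proof -
    obtain l where "(z, l) \<in> set ?ys" using \<open>z \<in> vars_of ?ys\<close> by (rule vars_ofE)
    from advice_props(2)[OF this] show ?thesis by blast
  qed
  have nW: "Gl g \<notin> W" if "g \<in> {One, NN, MM, CAP, VL, TOP}" for g
    using vo[of "Gl g"] that by (auto simp: W_def scratch_def Gl_temps)
  \<comment> \<open>\<open>t\<close> is an arbitrary state of which the advice matters.
    \<open>tt sz\<close> grafts this advice onto the state of the program when it tries target size
    \<open>sz\<close>.\<close>
  define tt where "tt sz = (\<lambda>z. if z \<in> scratch \<union> vars_of ?ys then t z else if z = Gl SZ then sz else s0 z)" for sz
  have sz: "Gl SZ \<notin> scratch \<union> vars_of ?ys" using vo[of "Gl SZ"] scratch_fixed by auto
  have in_adv: "Gl QQ \<in> vars_of ?ys" "p < D \<Longrightarrow> Adv p a \<in> vars_of ?ys"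
     "p < D \<Longrightarrow> r < R \<Longrightarrow> Tau p r \<in> vars_of ?ys" for p a r
    by (cases a; force simp: vars_of_def advice_def)+
  have At: "A (tt sz) = A t" for sz
    by (rule good_cong) (auto simp: tt_def hashed_def in_adv)
  define k where "k = card {v. v < n \<and> v \<in> A t}"
  have k: "k \<le> n" using card_mono[of "{..<n}" "{v. v < n \<and> v \<in> A t}"] by (auto simp: k_def)
  have lim: "t x < s0 l" if "(x, l) \<in> set ?ys" for x l
    using that t(1) s0 by (auto simp: advice_def okay_def)
  \<comment> \<open>While nothing has been output, \<open>i \<le> k\<close>: at target size
    \<open>k\<close> the advice of \<open>t\<close> passes the check, so the search succeeds at some
    size at most \<open>k\<close>.\<close>
  define I where "I i s' os' \<longleftrightarrow> base s' \<and> (if s' (Gl DONE) = 1 then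
      \<exists>u. good u \<and> u (Gl SZ) \<le> k \<and> os' = result u else os' = [] \<and> i \<le> k)"
     for i :: nat and s' os'
  have "wp (For one (Gl SZ) (Gl TOP) (enum_code ?ys (try_code T))) Q s0 []"
  proof (rule wp_For[where L = "n + 1" and W = W and ?s0.0 = s0 and I = I])
    show "s0 (Gl TOP) = n + 1" "s0 one = 1" using s0 by auto
    show "n + 1 < n ^ wd (Gl SZ)" by (rule vl)
    show "Gl TOP \<notin> W" "one \<notin> W" using nW by auto
    show "Gl SZ \<in> W" by (simp add: W_def)
    show "frame W s0 s0" by (rule frame_refl)
    show "I 0 s0 []" using s0 by (simp add: I_def)
    show "I i (s'(Gl SZ := j)) os'" if "I i s' os'" for i j s' os'
      using that by (simp add: I_def base_def)
    show "Q s' os'" if f: "frame W s0 s'" and I: "I (n + 1) s' os'" for s' os'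
    proof -
      obtain u where "good u" "u (Gl SZ) \<le> k" "os' = result u"
        using I k by (auto simp: I_def split: if_splits)
      then show ?thesis using Q[of u s'] by (auto simp: good_def k_def)
    qed
    fix i s' os' assume i: "i < n + 1" "frame W s0 s'" "s' (Gl SZ) = i" "I i s' os'"
    have b: "base s'" using i(4) by (simp add: I_def)
    have fs: "s' l = s0 l" if "(x, l) \<in> set ?ys" for x l
      using advice_props(2)[OF that] frameD[OF i(2), of l] nW by auto
    have "wp (enum_code ?ys (try_code T))
      (\<lambda>s'' os''. frame (scratch \<union> vars_of ?ys) s' s'' \<and> base s'' \<and>
        enum_outcome (works scratch ?ys s') s' os' s'' os'') s' os'"
      by (rule enum_code_ok[OF advice_props(1) advice_props(2) b])
    then show "wp (enum_code ?ys (try_code T))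
      (\<lambda>s'' os''. frame W s0 s'' \<and> s'' (Gl SZ) = i \<and> I (Suc i) s'' os'') s' os'"
    proof (rule wp_mono)
      fix s'' os'' assume s'': "frame (scratch \<union> vars_of ?ys) s' s'' \<and> base s'' \<and>
        enum_outcome (works scratch ?ys s') s' os' s'' os''"
      have "frame W s0 s''"
        by (rule frame_trans[OF i(2) conjunct1[OF s'']]) (auto simp: W_def)
      moreover have "s'' (Gl SZ) = i" using frameD[OF conjunct1[OF s''] sz] i(3) by simp
      moreover have "I (Suc i) s'' os''"
      proof (cases "s' (Gl DONE) = 1")
        case True
        then show ?thesis using s'' i(4) by (auto simp: I_def enum_outcome_def)
      next
        case False
        then have ik: "i \<le> k" "os' = []" using i(4) by (auto simp: I_def)
        have usz: "u (Gl SZ) = i" "good u" if "works scratch ?ys s' u" for u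
          using that frameD[of "scratch \<union> vars_of ?ys" s' u "Gl SZ"] sz i(3) by (auto simp: works_def)
        have "works scratch ?ys s' (tt i)" if "i = k"
        proof -
          have "frame (scratch \<union> vars_of ?ys) s' (tt i)"
            unfolding frame_def
          proof (intro allI impI)
            fix z assume z: "z \<notin> scratch \<union> vars_of ?ys"
            show "tt i z = s' z"
            proof (cases "z = Gl SZ")
              case True
              then show ?thesis using i(3) sz by (simp add: tt_def)
            next
              case False
              then have "z \<notin> W" using z by (simp add: W_def)
              then show ?thesis using frameD[OF i(2)] z False by (simp add: tt_def)
            qed
          qed
          moreover have "tt i x < s' l" if "(x, l) \<in> set ?ys" for x l
          proof -
            have "x \<in> vars_of ?ys" using that by (force simp: vars_of_def)
            then show ?thesis using fs[OF that] lim[OF that] by (simp add: tt_def)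
          qed
          moreover have "good (tt i)"
            using t(2) \<open>i = k\<close> sz unfolding good_def At by (simp add: tt_def k_def)
          ultimately show ?thesis by (auto simp: works_def)
        qed
        then have "s'' (Gl DONE) = 1 \<and> (\<exists>u. works scratch ?ys s' u \<and> os'' = result u) \<or>
          s'' (Gl DONE) = 0 \<and> os'' = [] \<and> i \<noteq> k"
          using s'' False ik by (auto simp: enum_outcome_def)
        then show ?thesis using s'' ik usz by (auto simp: I_def)
      qed
      ultimately show "frame W s0 s'' \<and> s'' (Gl SZ) = i \<and> I (Suc i) s'' os''" by simp
    qed
  qed
  then have fin: "wp (For one (Gl SZ) (Gl TOP) (enum_code ?ys (try_code T))) Q s1 []" if "s1 = s0" for s1
    unfolding that .
  have inw: "input_word w inp 0 = n" "input_word w inp 1 = length As"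
    using input_word_nth[of 0] input_word_nth[of 1] by (auto simp: inp)
  have le: "length As < n ^ wd (Gl g)" "n ^ kl < n ^ wd (Gl g)" "n ^ kv < n ^ wd (Gl g)" for g
    using entries(1)[of "length As" g] short(2)[of "Gl g"] vl(2)[of g] by (auto simp: inp kl)
  have "wp (pow_com (Gl CAP) kl ;; pow_com (Gl VL) kv ;; Set (Gl DONE) 0 ;; Bin Add (Gl TOP) (Gl NN) one ;;
     For one (Gl SZ) (Gl TOP) (enum_code ?ys (try_code T))) Q
     ((\<lambda>_. 0)(one := 1, Gl NN := n, Gl MM := length As)) []"
    using le const_less[of 0 "Gl DONE"] vl(4)[of TOP]
    by (intro wp_Seq pow_com_ok wp_Set wp_Add fin) (simp_all add: fun_eq_iff kl s0_def)
  then have *: "wp (pow_com (Gl CAP) kl ;; pow_com (Gl VL) kv ;; Set (Gl DONE) 0 ;; Bin Add (Gl TOP) (Gl NN) one ;;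
     For one (Gl SZ) (Gl TOP) (enum_code ?ys (try_code T))) Q s1 []"
    if "s1 = (\<lambda>_. 0)(one := 1, Gl NN := n, Gl MM := length As)" for s1
    unfolding that .
  show ?thesis
    unfolding main_code_def
    apply (rule wp_Seq, rule wp_Set, rule const_less, simp)
    apply (rule wp_Seq, rule wp_Set, rule const_less, simp)
    apply (rule wp_Seq, rule wp_Inp)
     apply (simp add: inw(1) short(1))
    apply (rule wp_Seq, rule wp_Inp)
     apply (simp add: inw(2)[simplified] le(1))
    apply (rule *)
    apply (simp add: fun_eq_iff inw inw(2)[simplified])
    done
qed

end

section \<open>Decision trees for small ground sets\<close>

text \<open>Jumps are absolute, so \<open>sub\<close> receives its own start address. On valid input
  a value in \<open>ys\<close> enters its subtree and never comes back, since leaves end in a jump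
  to \<open>fin\<close>. Any other value falls through to the end, which is how a large
  \<open>n\<close> reaches the algorithm.\<close>

primrec branch_code :: "nat \<Rightarrow> (nat \<Rightarrow> nat \<Rightarrow> instr list) \<Rightarrow> nat list \<Rightarrow> instr list" where
  "branch_code k sub [] = []"
| "branch_code k sub (y # ys) =
     [Const 2 y, JumpEq 1 2 (k + 3), Jump (k + 3 + length (sub (k + 3) y))] @
     sub (k + 3) y @ branch_code (k + 3 + length (sub (k + 3) y)) sub ys"

definition output_code :: "nat \<Rightarrow> nat list \<Rightarrow> instr list" where
  "output_code fin ys = concat (map (\<lambda>y. [Const 1 y, Output 1]) ys) @ [Jump fin]"

text \<open>
  The words read so far, \<open>pre\<close>, are kept in the program counter only; \<open>leaf\<close> recognises a
  complete input and names its output.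
\<close>

primrec tree_code ::
  "nat \<Rightarrow> (nat list \<Rightarrow> nat list option) \<Rightarrow> nat \<Rightarrow> nat \<Rightarrow> nat list \<Rightarrow> nat \<Rightarrow> instr list" where
  "tree_code fin leaf V 0 pre k = []"
| "tree_code fin leaf V (Suc f) pre k =
     (case leaf pre of
        Some ys \<Rightarrow> output_code fin ys
      | None \<Rightarrow> [Const 0 (length pre), Input 1 0] @
          branch_code (k + 2) (\<lambda>k y. tree_code fin leaf V f (pre @ [y]) k) [0..<V])"

lemma length_branch_code:
  assumes "\<And>k k' y. length (sub k y) = length (sub' k' y)"
  shows "length (branch_code k sub ys) = length (branch_code k' sub' ys)"
proof (induction ys arbitrary: k k')
  case (Cons y ys)
  show ?case using Cons assms[of "k + 3" y "k' + 3"] by simp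
qed simp

text \<open>This breaks a circle: the address \<open>fin\<close> is the length of the whole program,
  which includes the tree that jumps to it.\<close>

lemma length_tree_code: "length (tree_code fin leaf V f pre k) = length (tree_code fin' leaf V f pre k')"
proof (induction f arbitrary: pre k k')
  case (Suc f)
  have "length (branch_code (k + 2) (\<lambda>k y. tree_code fin leaf V f (pre @ [y]) k) [0..<V]) =
    length (branch_code (k' + 2) (\<lambda>k y. tree_code fin' leaf V f (pre @ [y]) k) [0..<V])"
    by (rule length_branch_code) (rule Suc)
  then show ?case by (simp add: output_code_def split: option.split)
qed simp

lemma relpowp_3: "(r ^^ 2) s s1 \<Longrightarrow> r s1 s2 \<Longrightarrow> (r ^^ 3) s s2"
  unfolding numeral_2_eq_2 numeral_3_eq_3 by (rule relpowp_Suc_I)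

lemma relpowp_trans: "(r ^^ a) s s1 \<Longrightarrow> (r ^^ b) s1 s2 \<Longrightarrow> (r ^^ (a + b)) s s2"
  by (auto simp: relpowp_add)

lemma branch_test:
  assumes "code_at P k [Const 2 y, JumpEq 1 2 l]" "pc s = k" "mem s 1 = v" "y < 2 ^ w" "3 \<le> m"
  shows "(gstep w P x m ^^ 2) s (s\<lparr>pc := (if v = y then l else k + 2), mem := (mem s)(2 := y)\<rparr>)"
proof -
  let ?s1 = "s\<lparr>pc := k + 1, mem := (mem s)(2 := y)\<rparr>"
  have "gstep w P x m s ?s1"
    using assms by (auto simp: gstep_def halted_def step_def code_at_Cons take_bit_nat_eq_self)
  moreover have "gstep w P x m ?s1 (s\<lparr>pc := (if v = y then l else k + 2), mem := (mem s)(2 := y)\<rparr>)"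
    using assms by (auto simp: gstep_def halted_def step_def code_at_Cons)
  ultimately show ?thesis by (auto simp: numeral_2_eq_2)
qed

lemma jump_step:
  assumes "code_at P k [Jump l]" "pc s = k" "s' = s\<lparr>pc := l\<rparr>"
  shows "gstep w P x m s s'"
  using assms by (auto simp: gstep_def halted_def step_def code_at_Cons)

lemma branch_code_Cons_at:
  assumes "code_at P k (branch_code k sub (y # ys))"
  defines "n \<equiv> length (sub (k + 3) y)"
  shows "code_at P k [Const 2 y, JumpEq 1 2 (k + 3)]" "code_at P (k + 2) [Jump (k + 3 + n)]"
    "code_at P (k + 3) (sub (k + 3) y)" "code_at P (k + 3 + n) (branch_code (k + 3 + n) sub ys)"
proof -
  have "code_at P k ([Const 2 y, JumpEq 1 2 (k + 3)] @ [Jump (k + 3 + n)] @ sub (k + 3) y @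
      branch_code (k + 3 + n) sub ys)"
    using assms(1) by (simp add: n_def)
  moreover have "k + length [Const 2 y, JumpEq 1 2 (k + 3)] = k + 2" "k + 2 + length [Jump (k + 3 + n)] = k + 3"
    by simp_all
  ultimately show "code_at P k [Const 2 y, JumpEq 1 2 (k + 3)]" "code_at P (k + 2) [Jump (k + 3 + n)]"
    "code_at P (k + 3) (sub (k + 3) y)" "code_at P (k + 3 + n) (branch_code (k + 3 + n) sub ys)"
    by (simp_all only: code_at_append n_def)
qed

lemma branch_code_miss:
  assumes "code_at P k (branch_code k sub ys)" "pc s = k" "mem s 1 = v" "v \<notin> set ys"
    "\<forall>y\<in>set ys. y < 2 ^ w" "3 \<le> m"
  shows "\<exists>z. (gstep w P x m ^^ (3 * length ys)) s
     (s\<lparr>pc := k + length (branch_code k sub ys), mem := (mem s)(2 := z)\<rparr>)"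
  using assms
proof (induction ys arbitrary: k s)
  case Nil
  have "s\<lparr>pc := k + length (branch_code k sub []), mem := (mem s)(2 := mem s 2)\<rparr> = s"
    using Nil.prems(2) by simp
  then have "(gstep w P x m ^^ (3 * length [])) s
     (s\<lparr>pc := k + length (branch_code k sub []), mem := (mem s)(2 := mem s 2)\<rparr>)" by simp
  then show ?case by blast
next
  case (Cons y ys)
  let ?n = "length (sub (k + 3) y)"
  let ?s1 = "s\<lparr>pc := k + 2, mem := (mem s)(2 := y)\<rparr>"
  let ?s2 = "s\<lparr>pc := k + 3 + ?n, mem := (mem s)(2 := y)\<rparr>"
  have at: "code_at P k [Const 2 y, JumpEq 1 2 (k + 3)]" "code_at P (k + 2) [Jump (k + 3 + ?n)]"
    "code_at P (k + 3 + ?n) (branch_code (k + 3 + ?n) sub ys)"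
    by (rule branch_code_Cons_at[OF Cons.prems(1)])+
  have "(gstep w P x m ^^ 2) s ?s1"
    using branch_test[OF at(1) Cons.prems(2,3), of w m x] Cons.prems by simp
  moreover have "gstep w P x m ?s1 ?s2" by (rule jump_step[OF at(2)]) simp_all
  ultimately have "(gstep w P x m ^^ 3) s ?s2" by (rule relpowp_3)
  then have 1: "(gstep w P x m ^^ 3) s ?s2" .
  have "\<exists>z. (gstep w P x m ^^ (3 * length ys)) ?s2
     (?s2\<lparr>pc := k + 3 + ?n + length (branch_code (k + 3 + ?n) sub ys), mem := (mem ?s2)(2 := z)\<rparr>)"
    by (rule Cons.IH[OF at(3)]) (use Cons.prems in auto)
  then obtain z where z: "(gstep w P x m ^^ (3 * length ys)) ?s2
     (?s2\<lparr>pc := k + 3 + ?n + length (branch_code (k + 3 + ?n) sub ys), mem := (mem ?s2)(2 := z)\<rparr>)"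
    by blast
  have e: "?s2\<lparr>pc := k + 3 + ?n + length (branch_code (k + 3 + ?n) sub ys), mem := (mem ?s2)(2 := z)\<rparr> =
     s\<lparr>pc := k + length (branch_code k sub (y # ys)), mem := (mem s)(2 := z)\<rparr>" by simp
  have "3 + 3 * length ys = 3 * length (y # ys)" by simp
  then show ?case using relpowp_trans[OF 1 z[unfolded e]] by metis
qed

lemma branch_code_hit:
  assumes "code_at P k (branch_code k sub [i..<V])" "pc s = k" "mem s 1 = v" "i \<le> v" "v < V" "v < 2 ^ w" "3 \<le> m"
  shows "\<exists>k'. code_at P k' (sub k' v) \<and> (gstep w P x m ^^ (3 * (v - i) + 2)) s
     (s\<lparr>pc := k', mem := (mem s)(2 := v)\<rparr>)"
  using assms
proof (induction "v - i" arbitrary: i k s)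
  case 0
  then have "i = v" by simp
  then have e: "[i..<V] = v # [Suc v..<V]" using 0 by (simp add: upt_rec)
  have at: "code_at P k [Const 2 v, JumpEq 1 2 (k + 3)]" "code_at P (k + 3) (sub (k + 3) v)"
    by (rule branch_code_Cons_at[OF 0(2)[unfolded e]])+
  have "(gstep w P x m ^^ 2) s (s\<lparr>pc := k + 3, mem := (mem s)(2 := v)\<rparr>)"
    using branch_test[OF at(1), of s v w m x] 0 by simp
  moreover have "3 * (v - i) + 2 = 2" using \<open>i = v\<close> by simp
  ultimately show ?case using at(2) by metis
next
  case (Suc d)
  then have iv: "i < v" by simp
  have "[i..<V] = i # [Suc i..<V]" using Suc.prems iv by (simp add: upt_rec)
  let ?n = "length (sub (k + 3) i)"
  let ?s1 = "s\<lparr>pc := k + 2, mem := (mem s)(2 := i)\<rparr>"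
  let ?s2 = "s\<lparr>pc := k + 3 + ?n, mem := (mem s)(2 := i)\<rparr>"
  have at: "code_at P k [Const 2 i, JumpEq 1 2 (k + 3)]" "code_at P (k + 2) [Jump (k + 3 + ?n)]"
    "code_at P (k + 3 + ?n) (branch_code (k + 3 + ?n) sub [Suc i..<V])"
    by (rule branch_code_Cons_at[OF Suc.prems(1)[unfolded \<open>[i..<V] = i # [Suc i..<V]\<close>]])+
  have "i < 2 ^ w" using Suc.prems iv by linarith
  then have "(gstep w P x m ^^ 2) s ?s1"
    using branch_test[OF at(1) Suc.prems(2,3), of w m x] Suc.prems iv by simp
  moreover have "gstep w P x m ?s1 ?s2" by (rule jump_step[OF at(2)]) simp_all
  ultimately have 1: "(gstep w P x m ^^ 3) s ?s2" by (rule relpowp_3)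
  obtain k' where k': "code_at P k' (sub k' v)" "(gstep w P x m ^^ (3 * (v - Suc i) + 2)) ?s2
     (?s2\<lparr>pc := k', mem := (mem ?s2)(2 := v)\<rparr>)"
  proof -
    have "\<exists>k'. code_at P k' (sub k' v) \<and> (gstep w P x m ^^ (3 * (v - Suc i) + 2)) ?s2
     (?s2\<lparr>pc := k', mem := (mem ?s2)(2 := v)\<rparr>)"
      by (rule Suc.hyps(1)[OF _ at(3)]) (use Suc.hyps(2) Suc.prems iv in auto)
    then show thesis using that by blast
  qed
  have "(gstep w P x m ^^ (3 + (3 * (v - Suc i) + 2))) s (s\<lparr>pc := k', mem := (mem s)(2 := v)\<rparr>)"
    using relpowp_trans[OF 1 k'(2)] by simp
  moreover have "3 + (3 * (v - Suc i) + 2) = 3 * (v - i) + 2" using iv by simp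
  ultimately show ?case using k'(1) by metis
qed

lemma output_code_exec:
  assumes "code_at P k (output_code fin ys)" "pc s = k" "\<forall>y\<in>set ys. y < 2 ^ w" "2 \<le> m"
  shows "\<exists>s'. (gstep w P x m ^^ (2 * length ys + 1)) s s' \<and> pc s' = fin \<and> out s' = out s @ ys"
  using assms
proof (induction ys arbitrary: k s)
  case Nil
  have "gstep w P x m s (s\<lparr>pc := fin\<rparr>)" using Nil by (intro jump_step) (simp_all add: output_code_def)
  then show ?case by (intro exI[of _ "s\<lparr>pc := fin\<rparr>"]) auto
next
  case (Cons y ys)
  let ?cs = "[Const 1 y, Output 1]"
  have c: "output_code fin (y # ys) = ?cs @ output_code fin ys" by (simp add: output_code_def)
  have "code_at P k ?cs \<and> code_at P (k + length ?cs) (output_code fin ys)"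
    using Cons.prems(1) unfolding c code_at_append .
  then have at: "code_at P k ?cs" "code_at P (k + 2) (output_code fin ys)" by simp_all
  let ?s1 = "fold (exec w x) ?cs s"
  have 1: "(gstep w P x m ^^ 2) s ?s1 \<and> pc ?s1 = k + 2"
    using straight_relpowp[OF at(1), of m s w x] Cons.prems by (auto simp: numeral_2_eq_2)
  have o: "out ?s1 = out s @ [y]" using Cons.prems by (simp add: take_bit_nat_eq_self)
  obtain s' where "(gstep w P x m ^^ (2 * length ys + 1)) ?s1 s'" "pc s' = fin" "out s' = out ?s1 @ ys"
    using Cons.IH[OF at(2), of ?s1] 1 Cons.prems by auto
  moreover from this have "(gstep w P x m ^^ (2 + (2 * length ys + 1))) s s'"
    by (intro relpowp_trans[OF conjunct1[OF 1]])
  ultimately show ?case using o by (intro exI[of _ s']) simp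
qed

text \<open>\<open>V\<close> is the number of branches fixed in the program, \<open>B\<close> bounds
  the words that actually occur. Branches are tried in increasing order, so reading and finding a
  word \<open>v\<close> costs \<open>2 + (3 * v + 2)\<close> steps. The time thus depends on
  \<open>B\<close>, later a power of \<open>n\<close>, and not on the cut-off.\<close>

lemma tree_code_exec:
  assumes "code_at P k (tree_code fin leaf V f (take i x) k)" "pc s = k" "i \<le> length x"
    "length x - i < f" "\<And>j. i \<le> j \<Longrightarrow> j < length x \<Longrightarrow> leaf (take j x) = None" "leaf x = Some ys"
    "\<forall>v\<in>set x. v < V \<and> v < 2 ^ w \<and> v \<le> B" "length x < 2 ^ w" "\<forall>y\<in>set ys. y < 2 ^ w" "3 \<le> m"
  shows "\<exists>t s'. (gstep w P x m ^^ t) s s' \<and> pc s' = fin \<and> out s' = out s @ ys \<and>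
    t \<le> (length x - i) * (3 * B + 4) + 2 * length ys + 1"
  using assms
proof (induction "length x - i" arbitrary: i f k s)
  case 0
  then obtain f' where f: "f = Suc f'" by (cases f) auto
  have "take i x = x" using 0 by simp
  then have "code_at P k (output_code fin ys)" using 0 f by simp
  then obtain s' where "(gstep w P x m ^^ (2 * length ys + 1)) s s' \<and> pc s' = fin \<and> out s' = out s @ ys"
    using output_code_exec[of P k fin ys s w m x] 0 by auto
  then show ?case by (intro exI[of _ "2 * length ys + 1"] exI[of _ s']) simp
next
  case (Suc l)
  then obtain f' where f: "f = Suc f'" by (cases f) auto
  have i: "i < length x" using Suc.hyps(2) by simp
  then have tk: "take i x @ [x ! i] = take (Suc i) x" by (simp add: take_Suc_conv_app_nth)
  let ?cs = "[Const 0 i, Input 1 0]"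
  let ?sub = "\<lambda>k y. tree_code fin leaf V f' (take i x @ [y]) k"
  have at: "code_at P k ?cs" "code_at P (k + 2) (branch_code (k + 2) ?sub [0..<V])"
    using Suc.prems(1) Suc.prems(5)[of i] i f by (auto simp: code_at_append code_at_Cons eval_nat_numeral)
  let ?s1 = "fold (exec w x) ?cs s"
  have 1: "(gstep w P x m ^^ 2) s ?s1 \<and> pc ?s1 = k + 2"
    using straight_relpowp[OF at(1), of m s w x] Suc.prems by (auto simp: numeral_2_eq_2)
  have xi: "x ! i \<in> set x" using i by simp
  have "take_bit w i = i" using i Suc.prems(8) by (intro take_bit_nat_eq_self) simp
  moreover have "take_bit w (x ! i) = x ! i" using xi Suc.prems(7) by (intro take_bit_nat_eq_self) simp
  ultimately have m1: "mem ?s1 1 = x ! i" and o1: "out ?s1 = out s"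
    using i by (auto simp: input_word_def)
  obtain k' where k': "code_at P k' (?sub k' (x ! i))"
    "(gstep w P x m ^^ (3 * (x ! i - 0) + 2)) ?s1 (?s1\<lparr>pc := k', mem := (mem ?s1)(2 := x ! i)\<rparr>)"
    using branch_code_hit[OF at(2) conjunct2[OF 1] m1, of w m x] Suc.prems xi by auto
  let ?s2 = "?s1\<lparr>pc := k', mem := (mem ?s1)(2 := x ! i)\<rparr>"
  have "code_at P k' (tree_code fin leaf V f' (take (Suc i) x) k')" using k'(1) tk by simp
  then obtain t s' where s': "(gstep w P x m ^^ t) ?s2 s'" "pc s' = fin" "out s' = out ?s2 @ ys"
    "t \<le> (length x - Suc i) * (3 * B + 4) + 2 * length ys + 1"
  proof -
    have "\<exists>t s'. (gstep w P x m ^^ t) ?s2 s' \<and> pc s' = fin \<and> out s' = out ?s2 @ ys \<and>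
      t \<le> (length x - Suc i) * (3 * B + 4) + 2 * length ys + 1"
    proof (rule Suc.hyps(1))
      show "l = length x - Suc i" using Suc.hyps(2) by simp
      show "code_at P k' (tree_code fin leaf V f' (take (Suc i) x) k')" by fact
      show "length x - Suc i < f'" using Suc.prems(4) f i by simp
    qed (use Suc.prems i in auto)
    then show thesis using that by blast
  qed
  have "(gstep w P x m ^^ (2 + (3 * (x ! i - 0) + 2) + t)) s s'"
    using relpowp_trans[OF relpowp_trans[OF conjunct1[OF 1] k'(2)] s'(1)] .
  moreover have "2 + (3 * (x ! i - 0) + 2) + t \<le> (length x - i) * (3 * B + 4) + 2 * length ys + 1"
  proof -
    have "x ! i \<le> B" using xi Suc.prems(7) by simp
    moreover have "length x - i = Suc (length x - Suc i)" using i by simp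
    ultimately show ?thesis using s'(4) by simp
  qed
  ultimately show ?case using s'(2,3) o1
    by (intro exI[of _ "2 + (3 * (x ! i - 0) + 2) + t"] exI[of _ s']) simp
qed

section \<open>Unique parsing of encodings\<close>

lemma listing_unique:
  assumes "listing As @ u = listing Bs @ v" "length As = length Bs"
  shows "As = Bs \<and> u = v"
  using assms
proof (induction As arbitrary: Bs)
  case (Cons A As)
  then obtain B Bs' where "Bs = B # Bs'" by (cases Bs) auto
  then show ?case using Cons by auto
qed simp

text \<open>The counts in front of all lists make the code self-delimiting, so the tree recognises
  the end of the input although its length is not given.\<close>

lemma encoding_prefix_free:
  assumes "x = n # length As # listing As" "take j x = n' # length Bs # listing Bs"
  shows "length x \<le> j"
proof -
  define u where "u = drop j x"
  have "x = (n' # length Bs # listing Bs) @ u"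
    unfolding u_def assms(2)[symmetric] by simp
  then have "listing As @ [] = listing Bs @ u" "length As = length Bs" using assms(1) by auto
  from listing_unique[OF this] show ?thesis by (simp add: u_def)
qed

section \<open>A pairwise independent hash family\<close>

lemma sum_shift_mod:
  fixes g :: "nat \<Rightarrow> 'a::comm_monoid_add"
  assumes "0 < M"
  shows "(\<Sum>a<M. g ((c + a) mod M)) = (\<Sum>a<M. g a)"
proof (rule sum.reindex_bij_betw)
  have "inj_on (\<lambda>a. (c + a) mod M) {..<M}"
  proof (rule inj_onI)
    fix a b assume ab: "a \<in> {..<M}" "b \<in> {..<M}" "(c + a) mod M = (c + b) mod M"
    then have "[c + a = c + b] (mod M)" by (simp add: cong_def)
    then have "[a = b] (mod M)" by (simp only: cong_add_lcancel_nat)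
    then show "a = b" using ab by (simp add: cong_def)
  qed
  moreover have "(\<lambda>a. (c + a) mod M) ` {..<M} \<subseteq> {..<M}" using assms by auto
  ultimately show "bij_betw (\<lambda>a. (c + a) mod M) {..<M} {..<M}"
    by (simp add: bij_betw_def endo_inj_surj)
qed

lemma sum_shift_mod_mult:
  fixes g :: "nat \<Rightarrow> 'a::comm_semiring_1"
  assumes "0 < M"
  shows "(\<Sum>a<k * M. g ((c + a) mod M)) = of_nat k * (\<Sum>a<M. g a)"
proof (induction k)
  case (Suc k)
  have "(\<Sum>a<Suc k * M. g ((c + a) mod M)) =
      (\<Sum>a<k * M. g ((c + a) mod M)) + (\<Sum>a=k * M..<k * M + M. g ((c + a) mod M))"
    by (simp add: lessThan_atLeast0 add.commute sum.atLeastLessThan_concat)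
  also have "(\<Sum>a=k * M..<k * M + M. g ((c + a) mod M)) = (\<Sum>a<M. g ((c + (k * M + a)) mod M))"
    using sum.shift_bounds_nat_ivl[of "\<lambda>a. g ((c + a) mod M)" 0 "k * M" M]
    by (simp add: lessThan_atLeast0 add_ac)
  also have "\<dots> = (\<Sum>a<M. g (((c + k * M) + a) mod M))" by (simp add: add.assoc)
  also have "\<dots> = (\<Sum>a<M. g a)" by (rule sum_shift_mod[OF assms])
  finally show ?case using Suc by (simp add: algebra_simps)
qed simp

lemma sum_mult_mod:
  fixes g :: "nat \<Rightarrow> 'a::comm_monoid_add"
  assumes "0 < M" "coprime c M"
  shows "(\<Sum>a<M. g (a * c mod M)) = (\<Sum>a<M. g a)"
proof (rule sum.reindex_bij_betw)
  have "inj_on (\<lambda>a. a * c mod M) {..<M}"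
  proof (rule inj_onI)
    fix a b assume ab: "a \<in> {..<M}" "b \<in> {..<M}" "a * c mod M = b * c mod M"
    then have "[a * c = b * c] (mod M)" by (simp add: cong_def)
    then have "[a = b] (mod M)" using assms(2) by (simp add: cong_mult_rcancel_nat)
    then show "a = b" using ab by (simp add: cong_def)
  qed
  moreover have "(\<lambda>a. a * c mod M) ` {..<M} \<subseteq> {..<M}" using assms by auto
  ultimately show "bij_betw (\<lambda>a. a * c mod M) {..<M} {..<M}"
    by (simp add: bij_betw_def endo_inj_surj)
qed

lemma two_power_times_odd:
  fixes D :: nat
  assumes "0 < D"
  shows "\<exists>s k. D = 2 ^ s * k \<and> odd k"
  using assms
proof (induction D rule: less_induct)
  case (less D)
  show ?case
  proof (cases "odd D")
    case True
    then have "D = 2 ^ 0 * D \<and> odd D" by simp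
    then show ?thesis by blast
  next
    case False
    then obtain D' where D': "D = 2 * D'" by (auto elim: evenE)
    then have "D' < D" "0 < D'" using less.prems by auto
    then obtain s k where "D' = 2 ^ s * k" "odd k" using less.IH by blast
    then have "D = 2 ^ Suc s * k \<and> odd k" using D' by simp
    then show ?thesis by blast
  qed
qed

text \<open>
  Hashing \<open>j \<mapsto> (a * j + b) mod 2 ^ m\<close>, with a key kept when its value is below \<open>2 ^ (m - l)\<close>.
  For keys below \<open>2 ^ u\<close> with \<open>u + l \<le> m\<close> this is pairwise independent although \<open>2 ^ m\<close> is
  not prime: the difference of two keys has 2-adic valuation less than \<open>u \<le> m - l\<close>.
\<close>

locale hashing =
  fixes u l m :: nat
  assumes ul: "u + l \<le> m"
begin

definition kept :: "nat \<Rightarrow> real" where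
  "kept z = of_bool (z mod 2 ^ m < 2 ^ (m - l))"

lemma kept_mod: "kept (z mod 2 ^ m) = kept z"
  by (simp add: kept_def)

lemma kept_total: "(\<Sum>b<2 ^ m. kept b) = 2 ^ (m - l)"
proof -
  have le: "(2::nat) ^ (m - l) \<le> 2 ^ m" by simp
  have "(\<Sum>b<2 ^ m. kept b) = (\<Sum>b<(2::nat) ^ m. of_bool (b < 2 ^ (m - l)))"
    by (rule sum.cong) (auto simp: kept_def)
  also have "\<dots> = real (card {b. b < (2::nat) ^ m \<and> b < 2 ^ (m - l)})"
    by (simp add: sum_of_bool_eq) (rule arg_cong[of _ _ card], auto)
  also have "{b. b < (2::nat) ^ m \<and> b < 2 ^ (m - l)} = {..<2 ^ (m - l)}"
    using le by (auto intro: less_le_trans)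
  finally show ?thesis by simp
qed

lemma kept_shift: "(\<Sum>b<2 ^ m. kept (c + b)) = 2 ^ (m - l)"
  using sum_shift_mod[of "2 ^ m" kept c] by (simp add: kept_mod kept_total)

text \<open>Write \<open>D = 2 ^ s * k\<close> with \<open>k\<close> odd. Multiplication by
  \<open>k\<close> permutes the residues, and as \<open>s < u \<le> m - l\<close> the cut-off
  \<open>2 ^ (m - l)\<close> is a multiple of \<open>2 ^ s\<close>. Whether a residue is kept then
  depends only on its quotient by \<open>2 ^ s\<close>, and these quotients run through all residues
  modulo \<open>2 ^ (m - s)\<close>, each \<open>2 ^ s\<close> times.\<close>

lemma kept_progression:
  assumes "0 < D" "D < 2 ^ u"
  shows "(\<Sum>a<2 ^ m. kept (c + a * D)) = 2 ^ (m - l)"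
proof -
  obtain s k where D: "D = 2 ^ s * k" "odd k"
    using two_power_times_odd[OF assms(1)] by blast
  have "2 ^ s \<le> D" using D assms(1) by (metis dvd_imp_le dvd_triv_left)
  then have "(2::nat) ^ s < 2 ^ u" using assms(2) by linarith
  then have s: "s < u" by simp
  let ?M = "2 ^ (m - s) :: nat"
  have Q: "(2::nat) ^ m = 2 ^ s * ?M" using s ul by (simp flip: power_add)
  have W: "(2::nat) ^ (m - l) = 2 ^ s * 2 ^ (m - l - s)" using s ul by (simp flip: power_add)
  have "(\<Sum>a<2 ^ m. kept (c + a * D)) = (\<Sum>a<2 ^ m. kept (c + (a * k mod 2 ^ m) * 2 ^ s))"
  proof (rule sum.cong)
    fix a
    have "(c + a * D) mod 2 ^ m = (c + (a * k mod 2 ^ m) * 2 ^ s) mod 2 ^ m"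
    proof -
      have "(c + (a * k mod 2 ^ m) * 2 ^ s) mod 2 ^ m = (c + (a * k) * 2 ^ s) mod 2 ^ m"
        by (metis mod_add_right_eq mod_mult_left_eq)
      then show ?thesis by (simp add: D mult_ac)
    qed
    then show "kept (c + a * D) = kept (c + (a * k mod 2 ^ m) * 2 ^ s)" by (simp add: kept_def)
  qed simp
  also have "\<dots> = (\<Sum>a<2 ^ m. kept (c + a * 2 ^ s))"
    using D(2) by (intro sum_mult_mod[where g = "\<lambda>a. kept (c + a * 2 ^ s)"]) auto
  also have "\<dots> = (\<Sum>a<2 ^ s * ?M. of_bool ((c div 2 ^ s + a) mod ?M < 2 ^ (m - l - s)))"
  proof (rule sum.cong)
    fix a
    have "(c + a * 2 ^ s) mod 2 ^ m div 2 ^ s = (c div 2 ^ s + a) mod ?M"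
      unfolding Q by (simp add: mod_mult2_eq add.commute)
    moreover have "z < 2 ^ (m - l) \<longleftrightarrow> z div 2 ^ s < 2 ^ (m - l - s)" for z :: nat
    proof -
      have "z div 2 ^ s < 2 ^ (m - l - s) \<longleftrightarrow> z < 2 ^ (m - l - s) * 2 ^ s"
        by (rule div_less_iff_less_mult) simp
      then show ?thesis unfolding W by (simp only: mult.commute)
    qed
    ultimately show "kept (c + a * 2 ^ s) = of_bool ((c div 2 ^ s + a) mod ?M < 2 ^ (m - l - s))"
      by (simp add: kept_def)
  qed (simp add: Q)
  also have "\<dots> = 2 ^ s * (\<Sum>a<?M. of_bool (a < 2 ^ (m - l - s)))"
    using sum_shift_mod_mult[of ?M "\<lambda>a. of_bool (a < 2 ^ (m - l - s))" "c div 2 ^ s" "2 ^ s"] by simp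
  also have "(\<Sum>a<?M. of_bool (a < 2 ^ (m - l - s))) = real (card {a. a < ?M \<and> a < 2 ^ (m - l - s)})"
    by (simp add: sum_of_bool_eq) (rule arg_cong[of _ _ card], auto)
  also have "{a. a < ?M \<and> a < 2 ^ (m - l - s)} = {..<2 ^ (m - l - s)}"
  proof -
    have "(2::nat) ^ (m - l - s) \<le> ?M" by (rule power_increasing) auto
    then have "a < ?M" if "a < 2 ^ (m - l - s)" for a :: nat using that by linarith
    then show ?thesis by (simp only: lessThan_def) blast
  qed
  also have "2 ^ s * real (card {..<(2::nat) ^ (m - l - s)}) = 2 ^ (m - l)"
    using s ul by (simp flip: power_add)
  finally show ?thesis .
qed

definition rate :: real where
  "rate = 1 / 2 ^ l"

lemma rate: "0 < rate" "rate \<le> 1" "2 ^ (m - l) = rate * 2 ^ m"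
  using ul by (auto simp: rate_def power_diff)

definition seeds :: "(nat \<times> nat) set" where
  "seeds = {..<2 ^ m} \<times> {..<2 ^ m}"

lemma single_moment: "(\<Sum>(a, b)\<in>seeds. kept (a * x + b)) = rate * (2 ^ m)\<^sup>2"
proof -
  have "(\<Sum>(a, b)\<in>seeds. kept (a * x + b)) = (\<Sum>a<2 ^ m. \<Sum>b<2 ^ m. kept (a * x + b))"
    by (simp add: seeds_def sum.cartesian_product)
  then show ?thesis by (simp add: kept_shift rate(3) power2_eq_square)
qed

lemma pair_moment_less:
  assumes "x < y" "y < 2 ^ u"
  shows "(\<Sum>(a, b)\<in>seeds. kept (a * x + b) * kept (a * y + b)) = (rate * 2 ^ m)\<^sup>2"
proof -
  define D where "D = y - x"
  have D: "0 < D" "D < 2 ^ u" "y = x + D" using assms by (auto simp: D_def)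
  have "(\<Sum>(a, b)\<in>seeds. kept (a * x + b) * kept (a * y + b)) =
      (\<Sum>a<2 ^ m. \<Sum>b<2 ^ m. kept (a * x + b) * kept (a * y + b))"
    by (simp add: seeds_def sum.cartesian_product)
  \<comment> \<open>For fixed \<open>a\<close> the shift of \<open>b\<close> by \<open>a * x\<close>
    permutes the residues and leaves the pair \<open>b\<close>, \<open>b + a * D\<close>. After
    exchanging the sums, \<open>a\<close> runs through a progression for fixed
    \<open>b\<close>.\<close>
  also have "\<dots> = (\<Sum>a<2 ^ m. \<Sum>b<2 ^ m. kept b * kept (b + a * D))"
  proof (rule sum.cong)
    fix a
    let ?g = "\<lambda>z. kept z * kept (z + a * D)"
    have "kept (a * x + b) * kept (a * y + b) = ?g ((a * x + b) mod 2 ^ m)" for b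
    proof -
      have "a * y + b = (a * x + b) + a * D" by (simp add: D algebra_simps)
      moreover have "kept ((a * x + b) mod 2 ^ m + a * D) = kept ((a * x + b) + a * D)"
        by (simp add: kept_def mod_simps)
      ultimately show ?thesis by (simp add: kept_mod ac_simps)
    qed
    then show "(\<Sum>b<2 ^ m. kept (a * x + b) * kept (a * y + b)) = (\<Sum>b<2 ^ m. ?g b)"
      using sum_shift_mod[of "2 ^ m" ?g "a * x"] by simp
  qed simp
  also have "\<dots> = (\<Sum>b<2 ^ m. kept b * (\<Sum>a<2 ^ m. kept (b + a * D)))"
    by (subst sum.swap) (simp add: sum_distrib_left)
  also have "\<dots> = (\<Sum>b<2 ^ m. kept b) * 2 ^ (m - l)"
    by (simp add: kept_progression[OF D(1,2)] sum_distrib_right)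
  finally show ?thesis by (simp add: kept_total rate(3) power2_eq_square)
qed

lemma pair_moment:
  assumes "x \<noteq> y" "x < 2 ^ u" "y < 2 ^ u"
  shows "(\<Sum>(a, b)\<in>seeds. kept (a * x + b) * kept (a * y + b)) = (rate * 2 ^ m)\<^sup>2"
  using pair_moment_less[of x y] pair_moment_less[of y x] assms
  by (cases x y rule: linorder_cases) (auto simp: mult.commute)

definition sampled :: "nat \<times> nat \<Rightarrow> nat set \<Rightarrow> real" where
  "sampled ab J = (\<Sum>j\<in>J. kept (fst ab * j + snd ab))"

text \<open>The factor \<open>1 - rate\<close> is kept because late phases use rate 1. It then
  vanishes, and no deviation is charged where nothing is sampled away.\<close>

lemma variance:
  assumes J: "finite J" "J \<subseteq> {..<2 ^ u}"
  shows "(\<Sum>ab\<in>seeds. (sampled ab J - rate * card J)\<^sup>2) = rate * (1 - rate) * card J * (2 ^ m)\<^sup>2"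
proof -
  let ?Q = "(2 ^ m)\<^sup>2 :: real"
  have fin: "finite seeds" and card: "real (card seeds) = ?Q"
    by (auto simp: seeds_def card_cartesian_product power2_eq_square)
  have s1: "(\<Sum>ab\<in>seeds. sampled ab J) = rate * card J * ?Q"
  proof -
    have "(\<Sum>ab\<in>seeds. sampled ab J) = (\<Sum>j\<in>J. \<Sum>(a, b)\<in>seeds. kept (a * j + b))"
      unfolding sampled_def by (subst sum.swap) (simp add: case_prod_beta)
    then show ?thesis by (simp add: single_moment)
  qed
  have "(\<Sum>ab\<in>seeds. (sampled ab J)\<^sup>2) =
      (\<Sum>x\<in>J. \<Sum>y\<in>J. \<Sum>(a, b)\<in>seeds. kept (a * x + b) * kept (a * y + b))"
  proof -
    have "(sampled ab J)\<^sup>2 = (\<Sum>x\<in>J. \<Sum>y\<in>J. kept (fst ab * x + snd ab) * kept (fst ab * y + snd ab))" for ab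
      by (simp add: sampled_def power2_eq_square sum_product)
    then have "(\<Sum>ab\<in>seeds. (sampled ab J)\<^sup>2) =
       (\<Sum>ab\<in>seeds. \<Sum>x\<in>J. \<Sum>y\<in>J. kept (fst ab * x + snd ab) * kept (fst ab * y + snd ab))" by simp
    also have "\<dots> = (\<Sum>x\<in>J. \<Sum>ab\<in>seeds. \<Sum>y\<in>J. kept (fst ab * x + snd ab) * kept (fst ab * y + snd ab))"
      by (rule sum.swap)
    also have "\<dots> = (\<Sum>x\<in>J. \<Sum>y\<in>J. \<Sum>ab\<in>seeds. kept (fst ab * x + snd ab) * kept (fst ab * y + snd ab))"
      by (intro sum.cong refl sum.swap)
    finally show ?thesis by (simp add: case_prod_beta)
  qed
  \<comment> \<open>The diagonal contributes \<open>rate\<close> because an indicator is its own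
    square; pairwise independence gives the square of \<open>rate\<close> elsewhere.\<close>
  also have "\<dots> = (\<Sum>x\<in>J. (\<Sum>y\<in>J. rate\<^sup>2 * ?Q) + (rate - rate\<^sup>2) * ?Q)"
  proof (rule sum.cong)
    fix x assume x: "x \<in> J"
    have kk: "kept z * kept z = kept z" for z by (simp add: kept_def)
    have "(\<Sum>y\<in>J. \<Sum>(a, b)\<in>seeds. kept (a * x + b) * kept (a * y + b)) =
        rate * ?Q + (\<Sum>y\<in>J - {x}. \<Sum>(a, b)\<in>seeds. kept (a * x + b) * kept (a * y + b))"
      using x J(1) by (subst sum.remove[OF J(1) x]) (simp add: kk single_moment)
    also have "(\<Sum>y\<in>J - {x}. \<Sum>(a, b)\<in>seeds. kept (a * x + b) * kept (a * y + b)) =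
        (\<Sum>y\<in>J - {x}. rate\<^sup>2 * ?Q)"
      using x J(2) by (intro sum.cong refl) (subst pair_moment, auto simp: power_mult_distrib)
    also have "\<dots> = (\<Sum>y\<in>J. rate\<^sup>2 * ?Q) - rate\<^sup>2 * ?Q"
      using sum.remove[OF J(1) x, of "\<lambda>_. rate\<^sup>2 * ?Q"] by linarith
    finally show "(\<Sum>y\<in>J. \<Sum>(a, b)\<in>seeds. kept (a * x + b) * kept (a * y + b)) =
      (\<Sum>y\<in>J. rate\<^sup>2 * ?Q) + (rate - rate\<^sup>2) * ?Q" by (simp add: algebra_simps)
  qed simp
  also have "\<dots> = card J * (card J * (rate\<^sup>2 * ?Q) + (rate - rate\<^sup>2) * ?Q)" by simp
  finally have s2: "(\<Sum>ab\<in>seeds. (sampled ab J)\<^sup>2) =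
     card J * (card J * (rate\<^sup>2 * ?Q) + (rate - rate\<^sup>2) * ?Q)" .
  have "(\<Sum>ab\<in>seeds. (sampled ab J - rate * card J)\<^sup>2) =
     (\<Sum>ab\<in>seeds. (sampled ab J)\<^sup>2 - 2 * (rate * card J) * sampled ab J + (rate * card J)\<^sup>2)"
    by (rule sum.cong) (auto simp: power2_eq_square algebra_simps)
  also have "\<dots> = (\<Sum>ab\<in>seeds. (sampled ab J)\<^sup>2) - 2 * (rate * card J) * (\<Sum>ab\<in>seeds. sampled ab J) +
      ?Q * (rate * card J)\<^sup>2"
    by (simp only: sum.distrib sum_subtractf sum_distrib_left sum_constant card)
  also have "\<dots> = rate * (1 - rate) * card J * ?Q"
    unfolding s1 s2 by (simp add: power2_eq_square algebra_simps)
  finally show ?thesis .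
qed

lemma chebyshev:
  assumes J: "finite J" "J \<subseteq> {..<2 ^ u}" and e: "0 < e"
  shows "real (card {ab\<in>seeds. e \<le> \<bar>sampled ab J - rate * card J\<bar>}) \<le>
     rate * (1 - rate) * card J / e\<^sup>2 * (2 ^ m)\<^sup>2"
proof -
  let ?B = "{ab\<in>seeds. e \<le> \<bar>sampled ab J - rate * card J\<bar>}"
  have fin: "finite seeds" by (simp add: seeds_def)
  have "real (card ?B) * e\<^sup>2 = (\<Sum>ab\<in>?B. e\<^sup>2)" by simp
  also have "\<dots> \<le> (\<Sum>ab\<in>?B. (sampled ab J - rate * card J)\<^sup>2)"
  proof (rule sum_mono)
    fix ab assume "ab \<in> ?B"
    then have "e\<^sup>2 \<le> \<bar>sampled ab J - rate * card J\<bar>\<^sup>2" using e by (intro power_mono) auto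
    then show "e\<^sup>2 \<le> (sampled ab J - rate * card J)\<^sup>2" by simp
  qed
  also have "\<dots> \<le> (\<Sum>ab\<in>seeds. (sampled ab J - rate * card J)\<^sup>2)"
    using fin by (intro sum_mono2) auto
  finally have "real (card ?B) \<le> (\<Sum>ab\<in>seeds. (sampled ab J - rate * card J)\<^sup>2) / e\<^sup>2"
    using e by (simp only: pos_le_divide_eq zero_less_power)
  also have "\<dots> = rate * (1 - rate) * card J / e\<^sup>2 * (2 ^ m)\<^sup>2"
    unfolding variance[OF J] by (simp only: times_divide_eq_left)
  finally show ?thesis .
qed

text \<open>Each event has its own tolerance \<open>e i\<close>, since decisions tolerate an error
  relative to a degree and the sample size an absolute one.\<close>

lemma good_seed:
  assumes K: "finite K" and J: "\<And>i. i \<in> K \<Longrightarrow> finite (J i) \<and> J i \<subseteq> {..<2 ^ u} \<and> 0 < e i"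
    and sum: "(\<Sum>i\<in>K. rate * (1 - rate) * card (J i) / (e i)\<^sup>2) < 1"
  shows "\<exists>ab\<in>seeds. \<forall>i\<in>K. \<bar>sampled ab (J i) - rate * card (J i)\<bar> < e i"
proof (rule ccontr)
  let ?B = "\<lambda>i. {ab\<in>seeds. e i \<le> \<bar>sampled ab (J i) - rate * card (J i)\<bar>}"
  assume "\<not> ?thesis"
  then have "seeds \<subseteq> (\<Union>i\<in>K. ?B i)" by (force simp: not_less)
  then have "card seeds \<le> card (\<Union>i\<in>K. ?B i)"
    using K by (intro card_mono) (auto simp: seeds_def)
  also have "\<dots> \<le> (\<Sum>i\<in>K. card (?B i))" by (rule card_UN_le[OF K])
  finally have "real (card seeds) \<le> real (\<Sum>i\<in>K. card (?B i))" by (simp only: of_nat_le_iff)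
  also have "\<dots> = (\<Sum>i\<in>K. real (card (?B i)))" by (rule of_nat_sum)
  also have "\<dots> \<le> (\<Sum>i\<in>K. rate * (1 - rate) * card (J i) / (e i)\<^sup>2 * (2 ^ m)\<^sup>2)"
    using J by (intro sum_mono chebyshev) auto
  also have "\<dots> < 1 * (2 ^ m)\<^sup>2"
    unfolding sum_distrib_right[symmetric] using sum by (intro mult_strict_right_mono) auto
  also have "\<dots> = real (card seeds)" by (simp add: seeds_def card_cartesian_product power2_eq_square)
  finally show False by simp
qed

end

section \<open>The exact thresholds and the existence of advice\<close>

definition deg :: "nat set list \<Rightarrow> nat set \<Rightarrow> nat \<Rightarrow> nat" where
  "deg Ss A v = card {j. j < length Ss \<and> v \<in> Ss ! j \<and> Ss ! j \<inter> A = {}}"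

text \<open>Origin of the factor 27: thresholds are sought between \<open>t\<close> and
  \<open>(1 + 3 / n) ^ n * t\<close>, which is at most \<open>exp 3 * t\<close>.\<close>

lemma exp_3_le: "exp (3::real) \<le> 27"
proof -
  have "exp (3::real) = exp 1 ^ 3" using exp_of_nat_mult[of 3 "1::real"] by simp
  also have "\<dots> \<le> 3 ^ 3" by (intro power_mono exp_le) auto
  finally show ?thesis by simp
qed

text \<open>There are more disjoint windows than values, so some window is free of values.\<close>

lemma threshold_gap:
  fixes f :: "nat \<Rightarrow> real" and n :: nat and t :: real
  assumes n: "3 \<le> n" and t: "0 < t"
  shows "\<exists>\<theta>. t \<le> \<theta> \<and> \<theta> \<le> 27 * t \<and> (\<forall>v<n. f v \<le> (1 - 1 / n) * \<theta> \<or> (1 + 1 / n) * \<theta> \<le> f v)"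
proof (rule ccontr)
  assume no: "\<not> ?thesis"
  \<comment> \<open>These are \<open>n + 1\<close> candidates in geometric progression. The ratio
    \<open>1 + 3 / n\<close> separates windows of relative half-width \<open>1 / n\<close> and keeps
    the total growth bounded.\<close>
  define th where "th i = t * (1 + 3 / n) ^ i" for i
  have th: "t \<le> th i" "th i \<le> 27 * t" "0 < th i" if "i \<le> n" for i
  proof -
    have "1 \<le> (1 + 3 / real n) ^ i" by (rule one_le_power) simp
    moreover from this have "0 < (1 + 3 / real n) ^ i" by linarith
    ultimately show "t \<le> th i" "0 < th i" using t by (simp_all add: th_def)
    have "(1 + 3 / real n) ^ i \<le> (1 + 3 / real n) ^ n"
      using that by (intro power_increasing) auto
    also have "\<dots> \<le> exp (3 / n) ^ n"
      by (intro power_mono) (auto simp: add.commute intro: exp_ge_add_one_self)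
    also have "\<dots> = exp 3" using exp_of_nat_mult[of n "3 / real n"] n by simp
    also have "\<dots> \<le> 27" by (rule exp_3_le)
    finally show "th i \<le> 27 * t" using t by (simp add: th_def)
  qed
  have "\<exists>v<n. (1 - 1 / n) * th i < f v \<and> f v < (1 + 1 / n) * th i" if "i \<le> n" for i
  proof -
    have "\<not> (\<forall>v<n. f v \<le> (1 - 1 / n) * th i \<or> (1 + 1 / n) * th i \<le> f v)"
      using no th(1,2)[OF that] by blast
    then show ?thesis by (auto simp: not_le)
  qed
  then obtain v where v: "\<And>i. i \<le> n \<Longrightarrow> v i < n \<and> (1 - 1 / n) * th i < f (v i) \<and> f (v i) < (1 + 1 / n) * th i"
    by metis
  have sep: "(1 + 1 / n) * th i \<le> (1 - 1 / n) * th j" if "i < j" "j \<le> n" for i j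
  proof -
    \<comment> \<open>The right side is \<open>1 + 2 / n - 3 / n ^ 2\<close>, so the inequality
      amounts to \<open>3 \<le> n\<close>.\<close>
    have "1 + 1 / n \<le> (1 - 1 / n) * (1 + 3 / real n)"
      using n by (simp add: field_simps)
    then have "(1 + 1 / n) * th i \<le> ((1 - 1 / n) * (1 + 3 / real n)) * th i"
      using th(3)[of i] that by (intro mult_right_mono) auto
    also have "\<dots> = (1 - 1 / n) * th (Suc i)" by (simp add: th_def)
    also have "\<dots> \<le> (1 - 1 / n) * th j"
    proof (rule mult_left_mono)
      show "th (Suc i) \<le> th j"
        using t that unfolding th_def by (intro mult_left_mono power_increasing) auto
    qed (use n in auto)
    finally show ?thesis .
  qed
  have "inj_on v {..n}"
  proof (rule inj_onI)
    have "False" if "i < j" "j \<le> n" "v i = v j" for i j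
      using v[of i] v[of j] sep[OF that(1,2)] that by simp
    then show "i = j" if "i \<in> {..n}" "j \<in> {..n}" "v i = v j" for i j
      using that by (metis atMost_iff linorder_neqE_nat)
  qed
  moreover have "v ` {..n} \<subseteq> {..<n}" using v by auto
  ultimately have "card {..n} \<le> card {..<n}" by (intro card_inj_on_le) auto
  then show False by simp
qed

text \<open>Within the cap the ranks enumerate the whole sample, and because of
  \<open>A \<subseteq> B\<close> a hashed set that avoids \<open>B\<close> belongs to the sample
  taken at \<open>A\<close>.\<close>

lemma hit_count_sample:
  assumes "length (sample h Ss A) \<le> L" "A \<subseteq> B"
  shows "hit_count L Ss (sample h Ss A) B v =
    card {j. j < length Ss \<and> h j \<and> v \<in> Ss ! j \<and> Ss ! j \<inter> B = {}}"
proof -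
  let ?T = "sample h Ss A" and ?P = "\<lambda>j. v \<in> Ss ! j \<and> Ss ! j \<inter> B = {}"
  have "hit_count L Ss ?T B v = card {i. i < length ?T \<and> ?P (?T ! i)}"
    using assms(1) unfolding hit_count_def by (intro arg_cong[of _ _ card]) auto
  also have "\<dots> = length (filter ?P ?T)" by (simp add: length_filter_conv_card)
  also have "\<dots> = card ({j. ?P j} \<inter> set ?T)"
    by (intro distinct_length_filter) (simp add: sample_def)
  also have "{j. ?P j} \<inter> set ?T = {j. j < length Ss \<and> h j \<and> v \<in> Ss ! j \<and> Ss ! j \<inter> B = {}}"
    using assms(2) by (auto simp: sample_def)
  finally show ?thesis .
qed

text \<open>\<open>54 \<le> n\<close> lets one factor \<open>n\<close> absorb 27 from the choice of
  thresholds times 2 from rounding the sampling rate to a power of two. \<open>8 * R \<le> n\<close>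
  keeps the union bound over the \<open>R * n\<close> decisions of a phase below 1.\<close>

locale exact_run =
  fixes n d R :: nat and g :: real and Ss :: "nat set list"
  assumes n: "54 \<le> n" "8 * R \<le> n" and g: "1 < g" "g ^ R = n" and R: "0 < R"
    and sets: "\<And>j. j < length Ss \<Longrightarrow> Ss ! j \<subseteq> {..<n} \<and> Ss ! j \<noteq> {} \<and> card (Ss ! j) \<le> d"
    and few: "length Ss \<le> n ^ (2 * d)"
begin

definition t :: "nat \<Rightarrow> real" where
  "t s = real n ^ (2 * d) / g ^ s"

text \<open>The gap is one of the degree sequence at \<open>A\<close>, so the threshold of a round
  depends on the set it starts from and not on \<open>s\<close> alone.\<close>

definition \<theta> :: "nat set \<Rightarrow> nat \<Rightarrow> real" where
  "\<theta> A s = (SOME x. t s \<le> x \<and> x \<le> 27 * t s \<and>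
     (\<forall>v<n. real (deg Ss A v) \<le> (1 - 1 / n) * x \<or> (1 + 1 / n) * x \<le> real (deg Ss A v)))"

primrec E :: "nat \<Rightarrow> nat set" where
  "E 0 = {}"
| "E (Suc s) = E s \<union> {v. v < n \<and> \<theta> (E s) s \<le> real (deg Ss (E s) v)}"

lemma t_pos: "0 < t s"
  using n g by (simp add: t_def)

lemma theta:
  "t s \<le> \<theta> A s" "\<theta> A s \<le> 27 * t s"
  "v < n \<Longrightarrow> real (deg Ss A v) \<le> (1 - 1 / n) * \<theta> A s \<or> (1 + 1 / n) * \<theta> A s \<le> real (deg Ss A v)"
proof -
  have "3 \<le> n" using n by simp
  from someI_ex[OF threshold_gap[OF this t_pos, of s "\<lambda>v. real (deg Ss A v)"]]
  show "t s \<le> \<theta> A s" "\<theta> A s \<le> 27 * t s"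
    "v < n \<Longrightarrow> real (deg Ss A v) \<le> (1 - 1 / n) * \<theta> A s \<or> (1 + 1 / n) * \<theta> A s \<le> real (deg Ss A v)"
    unfolding \<theta>_def by blast+
qed

lemma theta_pos: "0 < \<theta> A s"
  using theta(1)[of s A] t_pos[of s] by linarith

lemma E_mono: "s \<le> s' \<Longrightarrow> E s \<subseteq> E s'"
  by (induction s' rule: dec_induct) auto

lemma E_subset: "E s \<subseteq> {..<n}"
  by (induction s) auto

lemma deg_mono: "A \<subseteq> B \<Longrightarrow> deg Ss B v \<le> deg Ss A v"
  unfolding deg_def by (intro card_mono) auto

lemma deg_dead: "v \<in> A \<Longrightarrow> deg Ss A v = 0"
  unfolding deg_def by auto

lemma deg_outside: "n \<le> v \<Longrightarrow> deg Ss A v = 0"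
  using sets unfolding deg_def by (intro card_eq_0_iff[THEN iffD2] disjI1) force

lemma t_Suc: "t s = g * t (Suc s)"
  using g by (simp add: t_def)

lemma deg_less: "real (deg Ss (E (Suc s)) v) < \<theta> (E s) s"
proof (cases "v \<in> E (Suc s) \<or> n \<le> v")
  case True
  then show ?thesis using deg_dead deg_outside theta_pos by auto
next
  case False
  then have "real (deg Ss (E s) v) < \<theta> (E s) s" by auto
  moreover have "deg Ss (E (Suc s)) v \<le> deg Ss (E s) v" by (rule deg_mono) auto
  ultimately show ?thesis by linarith
qed

text \<open>After a round every degree is below its threshold, which is at most 27 times the
  \<open>t\<close> of that round, and \<open>t\<close> falls by a factor \<open>g\<close> per round.
  Before the first round the number of sets bounds all degrees.\<close>

lemma deg_bound: "real (deg Ss (E s) v) \<le> 27 * g * t s"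
proof (cases s)
  case 0
  have "deg Ss (E 0) v \<le> card {..<length Ss}" unfolding deg_def by (intro card_mono) auto
  also have "\<dots> \<le> n ^ (2 * d)" using few by simp
  finally have "real (deg Ss (E 0) v) \<le> real (n ^ (2 * d))" by (simp only: of_nat_le_iff)
  also have "\<dots> = 1 * t 0" by (simp add: t_def)
  also have "\<dots> \<le> 27 * g * t 0" using g t_pos[of 0] by (intro mult_right_mono) auto
  finally show ?thesis using 0 by simp
next
  case (Suc s')
  then show ?thesis using deg_less[of s' v] theta(2)[of "E s'" s'] t_Suc[of s'] by simp
qed

definition alive :: "nat set \<Rightarrow> nat set" where
  "alive A = {j. j < length Ss \<and> Ss ! j \<inter> A = {}}"

lemma finite_alive: "finite (alive A)"
  by (simp add: alive_def)

lemma sum_deg: "finite V \<Longrightarrow> (\<Sum>v\<in>V. deg Ss A v) = (\<Sum>j\<in>alive A. card (Ss ! j \<inter> V))"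
proof -
  assume V: "finite V"
  have "(\<Sum>v\<in>V. deg Ss A v) = (\<Sum>v\<in>V. \<Sum>j\<in>alive A. of_bool (v \<in> Ss ! j))"
  proof (rule sum.cong)
    fix v
    have "{j. j < length Ss \<and> v \<in> Ss ! j \<and> Ss ! j \<inter> A = {}} = {j \<in> alive A. v \<in> Ss ! j}"
      by (auto simp: alive_def)
    then show "deg Ss A v = (\<Sum>j\<in>alive A. of_bool (v \<in> Ss ! j))"
      using finite_alive[of A] by (simp add: deg_def sum_of_bool_eq Int_def)
  qed simp
  also have "\<dots> = (\<Sum>j\<in>alive A. \<Sum>v\<in>V. of_bool (v \<in> Ss ! j))" by (rule sum.swap)
  also have "\<dots> = (\<Sum>j\<in>alive A. card (Ss ! j \<inter> V))"
    using V by (intro sum.cong refl) (simp add: sum_of_bool_eq Int_def conj_commute)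
  finally show ?thesis .
qed

lemma alive_le_sum:
  assumes "finite V" "\<And>j. j < length Ss \<Longrightarrow> Ss ! j \<inter> V \<noteq> {}"
  shows "card (alive A) \<le> (\<Sum>v\<in>V. deg Ss A v)"
proof -
  have "card (alive A) = (\<Sum>j\<in>alive A. 1)" by simp
  also have "\<dots> \<le> (\<Sum>j\<in>alive A. card (Ss ! j \<inter> V))"
  proof (rule sum_mono)
    fix j assume "j \<in> alive A"
    then have "Ss ! j \<inter> V \<noteq> {}" using assms(2) by (auto simp: alive_def)
    then show "1 \<le> card (Ss ! j \<inter> V)" using assms(1) by (simp add: card_gt_0_iff Suc_le_eq)
  qed
  finally show ?thesis using sum_deg[OF assms(1)] by simp
qed

text \<open>Sets are nonempty, so each unhit set is counted in the degree of some vertex below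
  \<open>n\<close>.\<close>

lemma alive_bound: "real (card (alive (E s))) \<le> 27 * real n * g * t s"
proof -
  have "card (alive (E s)) \<le> (\<Sum>v<n. deg Ss (E s) v)"
    by (rule alive_le_sum) (use sets in force)+
  then have "real (card (alive (E s))) \<le> (\<Sum>v<n. real (deg Ss (E s) v))"
    by (metis of_nat_le_iff of_nat_sum)
  also have "\<dots> \<le> (\<Sum>v<n. 27 * g * t s)" by (intro sum_mono deg_bound)
  finally show ?thesis by (simp add: mult_ac)
qed

text \<open>Double counting of the unhit sets: each new vertex lies in at least \<open>t s\<close>
  of them and each of them contains at most \<open>d\<close> new vertices, while all of them are hit
  by \<open>H\<close>, whose vertices lie in at most \<open>27 * g * t s\<close> each.\<close>

lemma E_step_size:
  assumes H: "finite H" "\<And>j. j < length Ss \<Longrightarrow> Ss ! j \<inter> H \<noteq> {}"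
  shows "real (card (E (Suc s) - E s)) \<le> 27 * g * d * card H"
proof -
  let ?N = "E (Suc s) - E s"
  have fN: "finite ?N" using E_subset[of "Suc s"] finite_subset by blast
  have "card ?N * t s \<le> (\<Sum>v\<in>?N. real (deg Ss (E s) v))"
  proof -
    have "t s \<le> real (deg Ss (E s) v)" if "v \<in> ?N" for v
      using that theta(1)[of s "E s"] by auto
    then have "(\<Sum>v\<in>?N. t s) \<le> (\<Sum>v\<in>?N. real (deg Ss (E s) v))" by (intro sum_mono) auto
    then show ?thesis by simp
  qed
  also have "\<dots> = real (\<Sum>j\<in>alive (E s). card (Ss ! j \<inter> ?N))"
    unfolding sum_deg[OF fN, symmetric] by (rule of_nat_sum[symmetric])
  also have "\<dots> \<le> real (\<Sum>j\<in>alive (E s). d)"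
  proof -
    have "card (Ss ! j \<inter> ?N) \<le> d" if "j \<in> alive (E s)" for j
    proof -
      have "j < length Ss" using that by (simp add: alive_def)
      then have "finite (Ss ! j)" "card (Ss ! j) \<le> d" using sets[of j] finite_subset by blast+
      then show ?thesis by (meson card_mono inf_le1 le_trans)
    qed
    then show ?thesis by (intro of_nat_mono sum_mono) auto
  qed
  also have "\<dots> = d * real (card (alive (E s)))" by simp
  also have "\<dots> \<le> d * (\<Sum>h\<in>H. real (deg Ss (E s) h))"
    using alive_le_sum[OF H, of "E s"] by (intro mult_left_mono) (metis of_nat_le_iff of_nat_sum, simp)
  also have "\<dots> \<le> d * (\<Sum>h\<in>H. 27 * g * t s)"
    by (intro mult_left_mono sum_mono deg_bound) auto
  also have "\<dots> = (27 * g * d * card H) * t s" by simp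
  finally show ?thesis using t_pos[of s] by simp
qed

lemma E_size:
  assumes H: "finite H" "\<And>j. j < length Ss \<Longrightarrow> Ss ! j \<inter> H \<noteq> {}"
  shows "real (card (E s)) \<le> s * (27 * g * d * card H)"
proof (induction s)
  case (Suc s)
  have "card (E (Suc s)) \<le> card (E s) + card (E (Suc s) - E s)"
    using card_Un_le[of "E s" "E (Suc s) - E s"] by (simp add: Un_absorb1)
  then have "real (card (E (Suc s))) \<le> real (card (E s)) + real (card (E (Suc s) - E s))"
    by (metis of_nat_add of_nat_le_iff)
  then show ?case using Suc E_step_size[OF H, of s] by (simp add: algebra_simps)
qed simp

lemma g_pow: "g ^ (p * R) = real n ^ p"
  using g(2) by (metis mult.commute power_mult)

lemma t_phase:
  assumes "p * R \<le> s" "s < p * R + R"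
  shows "t s \<le> real n ^ (2 * d) / real n ^ p" "real n ^ (2 * d) / real n ^ Suc p \<le> t s"
proof -
  have "g ^ (p * R) \<le> g ^ s" using assms g by (intro power_increasing) auto
  then have "real n ^ p \<le> g ^ s" by (simp only: g_pow)
  then show "t s \<le> real n ^ (2 * d) / real n ^ p"
    using n g unfolding t_def by (intro divide_left_mono mult_pos_pos zero_less_power) auto
  have "g ^ s \<le> g ^ (Suc p * R)" using assms g by (intro power_increasing) auto
  then have "g ^ s \<le> real n ^ Suc p" by (simp only: g_pow)
  then show "real n ^ (2 * d) / real n ^ Suc p \<le> t s"
    using n g unfolding t_def by (intro divide_left_mono) auto
qed

text \<open>The last round belongs to phase \<open>2 * d + 2\<close>, where \<open>t\<close> is at
  most \<open>1 / n ^ 2\<close>. Its threshold is then at most 1, and the remaining degrees are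
  below it, hence 0. This fixes the number \<open>2 * d + 3\<close> of phases.\<close>

lemma E_hits:
  assumes "j < length Ss"
  shows "Ss ! j \<inter> E ((2 * d + 3) * R) \<noteq> {}"
proof
  assume dis: "Ss ! j \<inter> E ((2 * d + 3) * R) = {}"
  obtain s where s: "(2 * d + 3) * R = Suc s" using R by (cases "(2 * d + 3) * R") auto
  obtain v where v: "v \<in> Ss ! j" using sets[OF assms] by auto
  have "1 \<le> deg Ss (E (Suc s)) v"
    using assms v dis unfolding deg_def s by (simp add: card_gt_0_iff Suc_le_eq) blast
  then have "1 < 27 * t s" using deg_less[of s v] theta(2)[of "E s" s] by linarith
  moreover have "t s \<le> real n ^ (2 * d) / real n ^ (2 * d + 2)"
    by (rule t_phase) (use s R in \<open>auto simp: algebra_simps\<close>)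
  moreover have "real n ^ (2 * d) / real n ^ (2 * d + 2) = 1 / (real n)\<^sup>2"
    using n by (simp add: power_add power2_eq_square)
  moreover have "54 * 54 \<le> (real n)\<^sup>2"
    using n unfolding power2_eq_square by (intro mult_mono) auto
  then have "27 * (1 / (real n)\<^sup>2) \<le> 1"
    by (subst times_divide_eq_right, subst divide_le_eq_1_pos) linarith+
  ultimately show False by linarith
qed

section \<open>Sampling within one phase\<close>

lemma power_of_two_between:
  fixes N :: nat
  assumes "1 \<le> N"
  shows "\<exists>l. 2 ^ l \<le> N \<and> N < 2 * 2 ^ l"
proof -
  have "\<exists>l. N < 2 ^ l" using less_exp by blast
  then obtain k where k: "N < 2 ^ k" "\<And>i. i < k \<Longrightarrow> \<not> N < 2 ^ i" using exists_least_iff[of "\<lambda>l. N < 2 ^ l"] by auto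
  then obtain l where "k = Suc l" using assms by (cases k) auto
  then have "2 ^ l \<le> N \<and> N < 2 * 2 ^ l" using k(1) k(2)[of l] by simp
  then show ?thesis by blast
qed

lemma g_le_n: "g \<le> n"
  using g R self_le_power[of g R] by simp

definition threshold :: "nat \<Rightarrow> real" where
  "threshold s = \<theta> (E s) s"

text \<open>In phase \<open>p\<close> the thresholds lie between \<open>n ^ (2 * d - p - 1)\<close>
  and \<open>27 * n ^ (2 * d - p)\<close>. Dividing by about \<open>n ^ (2 * d - p - 6)\<close>
  leaves at least \<open>n ^ 5\<close>, enough for a relative error of \<open>1 / (2 * n)\<close>
  with failure probability \<open>4 / n ^ 3\<close> per decision. It also leaves at most a constant
  times \<open>n ^ 6\<close>, so that the sample, larger by a factor of order \<open>n * g\<close>,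
  stays within \<open>n ^ 10\<close>. Late phases, where the exponent would drop to 0, keep every
  set.\<close>

lemma phase_exists:
  assumes u: "n ^ (2 * d) \<le> 2 ^ u"
  shows "\<exists>a b l \<tau>. a < 2 ^ (2 * u) \<and> b < 2 ^ (2 * u) \<and> l \<le> u \<and>
    (\<forall>r<R. 0 < \<tau> r \<and> \<tau> r < n ^ 10) \<and>
    length (sample (\<lambda>j. (a * j + b) mod 2 ^ (2 * u) < (2::nat) ^ (2 * u - l)) Ss (E (p * R))) \<le> n ^ 10 \<and>
    (\<forall>r<R. \<forall>v<n. \<tau> r \<le> card {j. j < length Ss \<and> (a * j + b) mod 2 ^ (2 * u) < (2::nat) ^ (2 * u - l) \<and>
        v \<in> Ss ! j \<and> Ss ! j \<inter> E (p * R + r) = {}} \<longleftrightarrow>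
      threshold (p * R + r) \<le> real (deg Ss (E (p * R + r)) v))"
proof -
  \<comment> \<open>Truncated subtraction: in phases with \<open>2 * d \<le> p + 6\<close> this is
    0, hence \<open>l = 0\<close> and \<open>rate = 1\<close>.\<close>
  define e where "e = 2 * d - p - 6"
  have "1 \<le> n ^ e" using n by simp
  then obtain l where l: "2 ^ l \<le> n ^ e" "n ^ e < 2 * 2 ^ l" using power_of_two_between by blast
  have "n ^ e \<le> n ^ (2 * d)" using n by (intro power_increasing) (auto simp: e_def)
  then have "(2::nat) ^ l \<le> 2 ^ u" using l u by linarith
  then have lu: "l \<le> u" by simp
  interpret hashing u l "2 * u" using lu by unfold_locales simp
  have n0: "0 < real n" using n by simp
  have "real (2 ^ l) \<le> real (n ^ e)" "real (n ^ e) < real (2 * 2 ^ l)"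
    using l by (simp_all only: of_nat_le_iff of_nat_less_iff)
  then have lr: "2 ^ l \<le> real n ^ e" "real n ^ e < 2 * 2 ^ l" by simp_all
  have rate_ge: "1 / real n ^ e \<le> rate"
    unfolding rate_def using lr(1) n0 by (intro divide_left_mono) auto
  have rate_le: "rate * real n ^ e \<le> 2"
    unfolding rate_def using lr(2) by (simp add: field_simps)
  have big: "real n ^ 5 \<le> rate * t s" if "rate < 1" "p * R \<le> s" "s < p * R + R" for s
  proof -
    have "e \<noteq> 0"
    proof
      assume "e = 0"
      then have "(2::nat) ^ l \<le> 2 ^ 0" using l(1) by simp
      then have "l \<le> 0" by (rule power_le_imp_le_exp[rotated]) simp
      then show False using that(1) unfolding rate_def by simp
    qed
    then have e: "2 * d = (e + 5) + Suc p" by (simp add: e_def)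
    have "real n ^ 5 = (1 / real n ^ e) * real n ^ (e + 5)" using n0 by (simp add: power_add)
    also have "real n ^ (e + 5) = real n ^ (2 * d) / real n ^ Suc p"
      unfolding e power_add using n0 by simp
    also have "(1 / real n ^ e) * \<dots> \<le> rate * t s"
      using rate_ge t_phase(2)[OF that(2,3)] rate(1) n0 by (intro mult_mono) auto
    finally show ?thesis .
  qed
  have small: "rate * t s \<le> 2 * real n ^ 6" if "p * R \<le> s" "s < p * R + R" for s
  proof -
    have "2 * d \<le> p + (e + 6)" by (simp add: e_def)
    then have "real n ^ (2 * d) \<le> real n ^ (p + (e + 6))" using n by (intro power_increasing) auto
    then have "real n ^ (2 * d) / real n ^ p \<le> real n ^ (e + 6)"
      using n0 by (simp add: power_add field_simps)
    then have "t s \<le> real n ^ e * real n ^ 6"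
      using t_phase(1)[OF that] by (simp add: power_add)
    then have "rate * t s \<le> (rate * real n ^ e) * real n ^ 6"
      using rate(1) by (simp add: mult.assoc)
    also have "\<dots> \<le> 2 * real n ^ 6" using rate_le by (intro mult_right_mono) auto
    finally show ?thesis .
  qed
  define al where "al = alive (E (p * R))"
  have al: "rate * card al \<le> real n ^ 9"
  proof -
    have "rate * card al \<le> rate * (27 * real n * g * t (p * R))"
      unfolding al_def using rate(1) alive_bound by (intro mult_left_mono) auto
    also have "\<dots> = (27 * real n * g) * (rate * t (p * R))" by simp
    also have "\<dots> \<le> (27 * real n * real n) * (2 * real n ^ 6)"
    proof (rule mult_mono)
      show "27 * real n * g \<le> 27 * real n * real n" using g_le_n by (intro mult_left_mono) auto
      show "rate * t (p * R) \<le> 2 * real n ^ 6" using R by (intro small) auto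
    qed (use rate(1) t_pos[of "p * R"] in auto)
    also have "\<dots> = 54 * real n ^ 8" by (simp add: eval_nat_numeral)
    also have "\<dots> \<le> n * real n ^ 8" using n by (intro mult_right_mono) auto
    finally show ?thesis by (simp add: eval_nat_numeral)
  qed
  define th where "th r = threshold (p * R + r)" for r
  define D where "D r v = {j. j < length Ss \<and> v \<in> Ss ! j \<and> Ss ! j \<inter> E (p * R + r) = {}}" for r v
  have cardD: "card (D r v) = deg Ss (E (p * R + r)) v" for r v by (simp add: D_def deg_def)
  have th: "t (p * R + r) \<le> th r" "th r \<le> 27 * t (p * R + r)" "0 < th r"
    "v < n \<Longrightarrow> real (card (D r v)) \<le> (1 - 1 / n) * th r \<or> (1 + 1 / n) * th r \<le> real (card (D r v))" for r v
    unfolding th_def threshold_def cardD using theta theta_pos by auto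
  \<comment> \<open>The tolerance is relative to the larger of degree and threshold: taken relative
    to the degree alone, the Chebyshev bound deteriorates for small degrees, and relative to the
    threshold alone, for large ones.\<close>
  define mx where "mx r v = max (real (card (D r v))) (th r)" for r v
  define J where "J i = (if fst i < R then D (fst i) (snd i) else al)" for i :: "nat \<times> nat"
  define \<delta> where "\<delta> i = (if fst i < R then rate * mx (fst i) (snd i) / (2 * n) else real n ^ 9)" for i :: "nat \<times> nat"
  \<comment> \<open>The extra index \<open>(R, 0)\<close> stands for the size of the sample
    itself.\<close>
  define K where "K = insert (R, 0) ({..<R} \<times> {..<n})"
  have mx: "th r \<le> mx r v" "real (card (D r v)) \<le> mx r v" "0 < mx r v" for r v
    using th(3)[of r] by (auto simp: mx_def)
  have M: "{..<length Ss} \<subseteq> {..<2 ^ u}" using few u by auto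
  have term_le: "rate * (1 - rate) * card (J i) / (\<delta> i)\<^sup>2 \<le> 4 / real n ^ 3" if mem: "i \<in> {..<R} \<times> {..<n}" for i
  proof (cases "rate < 1")
    case True
    obtain r v where i: "i = (r, v)" "r < R" using mem by (elim SigmaE) auto
    have "rate * (1 - rate) * card (J i) / (\<delta> i)\<^sup>2 \<le> rate * 1 * mx r v / (\<delta> i)\<^sup>2"
      using rate(1,2) mx[of r v] i by (intro divide_right_mono mult_mono) (auto simp: J_def)
    also have "\<dots> = 4 * (real n)\<^sup>2 / (rate * mx r v)"
      using rate(1) mx(3)[of r v] n0 i by (simp add: \<delta>_def power2_eq_square)
    also have "\<dots> \<le> 4 * (real n)\<^sup>2 / real n ^ 5"
    proof (rule divide_left_mono)
      have "real n ^ 5 \<le> rate * t (p * R + r)" using True i(2) by (intro big) auto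
      also have "\<dots> \<le> rate * mx r v"
        using rate(1) th(1)[of r] mx(1)[of r v] by (intro mult_left_mono) auto
      finally show "real n ^ 5 \<le> rate * mx r v" .
    qed (use n0 rate(1) mx(3) in auto)
    also have "\<dots> = 4 / real n ^ 3" using n0 by (simp add: eval_nat_numeral)
    finally show ?thesis .
  next
    case False
    then have "rate = 1" using rate(2) by simp
    then show ?thesis using n0 by simp
  qed
  have "\<exists>ab\<in>seeds. \<forall>i\<in>K. \<bar>sampled ab (J i) - rate * card (J i)\<bar> < \<delta> i"
  proof (rule good_seed)
    show "finite K" by (simp add: K_def)
    show "finite (J i) \<and> J i \<subseteq> {..<2 ^ u} \<and> 0 < \<delta> i" for i
      using M rate(1) mx n0 by (auto simp: J_def D_def al_def alive_def \<delta>_def)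
    have "(\<Sum>i\<in>K. rate * (1 - rate) * card (J i) / (\<delta> i)\<^sup>2) =
       rate * (1 - rate) * card (J (R, 0)) / (\<delta> (R, 0))\<^sup>2 +
       (\<Sum>i\<in>{..<R} \<times> {..<n}. rate * (1 - rate) * card (J i) / (\<delta> i)\<^sup>2)"
      unfolding K_def by (subst sum.insert) auto
    also have "\<dots> \<le> 1 / real n ^ 9 + (\<Sum>i\<in>{..<R} \<times> {..<n}. 4 / real n ^ 3)"
    proof (intro add_mono sum_mono term_le)
      have "rate * (1 - rate) * card al \<le> real n ^ 9"
      proof -
        have "rate * (1 - rate) * card al \<le> rate * 1 * card al"
          using rate by (intro mult_right_mono mult_left_mono) auto
        then show ?thesis using al by simp
      qed
      then have "rate * (1 - rate) * card al / (real n ^ 9)\<^sup>2 \<le> real n ^ 9 / (real n ^ 9)\<^sup>2"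
        by (intro divide_right_mono) auto
      also have "\<dots> = 1 / real n ^ 9"
        unfolding power2_eq_square by (rule nonzero_divide_mult_cancel_left) (use n0 in simp)
      finally show "rate * (1 - rate) * card (J (R, 0)) / (\<delta> (R, 0))\<^sup>2 \<le> 1 / real n ^ 9"
        by (simp add: J_def \<delta>_def)
    qed
    also have "(\<Sum>i\<in>{..<R} \<times> {..<n}. 4 / real n ^ 3) = 4 * real R / (real n)\<^sup>2"
      using n0 by (simp add: card_cartesian_product eval_nat_numeral)
    also have "1 / real n ^ 9 + 4 * real R / (real n)\<^sup>2 \<le> 1 / real n + 1 / real n"
    proof (rule add_mono)
      have "real n ^ 1 \<le> real n ^ 9" using n by (intro power_increasing) auto
      then show "1 / real n ^ 9 \<le> 1 / real n" using n0 by (intro divide_left_mono) auto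
      have "4 * real R \<le> real n" using n(2) by linarith
      then have "4 * real R / (real n)\<^sup>2 \<le> real n / (real n)\<^sup>2" by (intro divide_right_mono) auto
      then show "4 * real R / (real n)\<^sup>2 \<le> 1 / real n" using n0 by (simp add: power2_eq_square)
    qed
    also have "\<dots> < 1" using n(1) by (simp add: field_simps)
    finally show "(\<Sum>i\<in>K. rate * (1 - rate) * card (J i) / (\<delta> i)\<^sup>2) < 1" .
  qed
  then obtain a b where ab: "(a, b) \<in> seeds"
    and dev: "\<And>i. i \<in> K \<Longrightarrow> \<bar>sampled (a, b) (J i) - rate * card (J i)\<bar> < \<delta> i"
    by (metis surj_pair)
  define h where "h j \<longleftrightarrow> (a * j + b) mod 2 ^ (2 * u) < (2::nat) ^ (2 * u - l)" for j
  have sampled: "sampled (a, b) I = card {j \<in> I. h j}" if "finite I" for I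
    using that by (simp add: sampled_def kept_def h_def sum_of_bool_eq Int_def)
  \<comment> \<open>Rounding up loses nothing: sample counts are integers, so they reach
    \<open>\<tau> r\<close> iff they reach the real number \<open>rate * th r\<close>.\<close>
  define \<tau> where "\<tau> r = nat \<lceil>rate * th r\<rceil>" for r
  have tau: "\<tau> r \<le> k \<longleftrightarrow> rate * th r \<le> real k" for r k
    by (simp add: \<tau>_def nat_le_iff ceiling_le_iff)
  have \<tau>: "0 < \<tau> r \<and> \<tau> r < n ^ 10" if r: "r < R" for r
  proof
    show "0 < \<tau> r" using rate(1) th(3)[of r] by (simp add: \<tau>_def)
    have "rate * th r \<le> rate * (27 * t (p * R + r))"
      using rate(1) th(2)[of r] by (intro mult_left_mono) auto
    also have "\<dots> \<le> 27 * (2 * real n ^ 6)" using small[of "p * R + r"] r by simp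
    also have "\<dots> \<le> n * real n ^ 6" using n by (simp add: mult_right_mono)
    also have "\<dots> = real (n ^ 7)" by (simp add: eval_nat_numeral)
    finally have "\<tau> r \<le> n ^ 7" by (simp only: tau)
    also have "\<dots> < n ^ 10" using n by (intro power_strict_increasing) auto
    finally show "\<tau> r < n ^ 10" .
  qed
  have len: "length (sample h Ss (E (p * R))) \<le> n ^ 10"
  proof -
    have "length (sample h Ss (E (p * R))) = card (set (sample h Ss (E (p * R))))"
      by (rule distinct_card[symmetric]) (simp add: sample_def)
    also have "set (sample h Ss (E (p * R))) = {j \<in> al. h j}"
      by (auto simp: sample_def al_def alive_def)
    finally have "real (length (sample h Ss (E (p * R)))) = sampled (a, b) al"
      using finite_alive by (simp add: sampled al_def)
    also have "\<dots> \<le> rate * card al + real n ^ 9" using dev[of "(R, 0)"] by (simp add: K_def J_def \<delta>_def)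
    also have "\<dots> \<le> 2 * real n ^ 9" using al by simp
    also have "\<dots> \<le> n * real n ^ 9" using n by (intro mult_right_mono) auto
    also have "\<dots> = real (n ^ 10)" by (simp add: eval_nat_numeral)
    finally show ?thesis by (simp only: of_nat_le_iff)
  qed
  have dec: "\<tau> r \<le> card {j. j < length Ss \<and> h j \<and> v \<in> Ss ! j \<and> Ss ! j \<inter> E (p * R + r) = {}} \<longleftrightarrow>
      threshold (p * R + r) \<le> real (deg Ss (E (p * R + r)) v)" if r: "r < R" and v: "v < n" for r v
  proof -
    have set: "{j. j < length Ss \<and> h j \<and> v \<in> Ss ! j \<and> Ss ! j \<inter> E (p * R + r) = {}} = {j \<in> D r v. h j}"
      by (auto simp: D_def)
    have fD: "finite (D r v)" by (simp add: D_def)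
    define c where "c = real (card (D r v))"
    define X where "X = real (card {j \<in> D r v. h j})"
    have Xdev: "\<bar>X - rate * c\<bar> < rate * mx r v / (2 * n)"
      using dev[of "(r, v)"] r v by (simp add: K_def J_def \<delta>_def sampled[OF fD] X_def c_def)
    have half: "0 < 1 / real n" "1 / real n \<le> 1" using n by auto
    have "rate * th r \<le> X \<longleftrightarrow> th r \<le> c"
    proof (cases "c \<le> (1 - 1 / n) * th r")
      case True
      then have le: "c \<le> th r - th r / n" by (simp add: algebra_simps)
      then have "c < th r" using th(3)[of r] n0 by (smt (verit) divide_pos_pos)
      then have m: "mx r v = th r" by (simp add: mx_def c_def)
      have "X < rate * c + rate * th r / (2 * n)" using Xdev unfolding m by linarith
      also have "\<dots> \<le> rate * (th r - th r / n) + rate * th r / (2 * n)"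
        using le rate(1) by (intro add_right_mono mult_left_mono) auto
      also have "\<dots> = rate * th r - rate * th r / (2 * n)" using n0 by (simp add: field_simps)
      also have "\<dots> < rate * th r" using rate(1) th(3)[of r] n0 by simp
      finally show ?thesis using \<open>c < th r\<close> by simp
    next
      case False
      then have ge: "(1 + 1 / n) * th r \<le> c" using th(4)[OF v, of r] by (simp add: c_def)
      have "th r \<le> (1 + 1 / n) * th r" using half th(3)[of r] by simp
      then have thc: "th r \<le> c" using ge by linarith
      then have m: "mx r v = c" by (simp add: mx_def c_def)
      \<comment> \<open>The gap of relative width \<open>1 / n\<close> outweighs the deviation
        \<open>1 / (2 * n)\<close>: the product is
        \<open>1 + 1 / (2 * n) - 1 / (2 * n ^ 2)\<close>.\<close>
      have "1 \<le> (1 - 1 / (2 * n)) * (1 + 1 / real n)" using n by (simp add: field_simps)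
      then have "th r \<le> (1 - 1 / (2 * n)) * (1 + 1 / real n) * th r"
        using th(3)[of r] by simp
      also have "\<dots> = (1 - 1 / (2 * n)) * ((1 + 1 / real n) * th r)" by simp
      also have "\<dots> \<le> (1 - 1 / (2 * n)) * c" using ge half by (intro mult_left_mono) auto
      finally have "rate * th r \<le> rate * ((1 - 1 / (2 * n)) * c)" using rate(1) by (intro mult_left_mono) auto
      also have "\<dots> = rate * c - rate * c / (2 * n)" by (simp add: algebra_simps)
      also have "\<dots> < X" using Xdev unfolding m by linarith
      finally show ?thesis using thc by simp
    qed
    then show ?thesis unfolding set tau by (simp add: X_def c_def th_def cardD)
  qed
  show ?thesis
    using ab lu \<tau> len dec unfolding seeds_def h_def
    by (intro exI[of _ a] exI[of _ b] exI[of _ l] exI[of _ \<tau>]) auto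
qed

text \<open>Agreement of all decisions makes the sampled and the exact run equal round by round.
  Positive \<open>\<tau>\<close> keeps out the numbers from \<open>n\<close> on, which lie in no set
  and have count 0.\<close>

lemma phases_set_eq:
  assumes "\<And>p. p < D \<Longrightarrow> length (sample (h p) Ss (E (p * R))) \<le> L"
    "\<And>p r. p < D \<Longrightarrow> r < R \<Longrightarrow> 0 < \<tau> p r"
    "\<And>p r v. p < D \<Longrightarrow> r < R \<Longrightarrow> v < n \<Longrightarrow>
      \<tau> p r \<le> card {j. j < length Ss \<and> h p j \<and> v \<in> Ss ! j \<and> Ss ! j \<inter> E (p * R + r) = {}} \<longleftrightarrow>
      threshold (p * R + r) \<le> real (deg Ss (E (p * R + r)) v)"
  shows "phases_set L Ss h \<tau> R D = E (D * R)"
  using assms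
proof (induction D)
  case (Suc p)
  then have IH: "phases_set L Ss h \<tau> R p = E (p * R)" by simp
  have len: "length (sample (h p) Ss (E (p * R))) \<le> L" using Suc.prems(1) by simp
  have pos: "0 < \<tau> p r" if "r < R" for r using Suc.prems(2) that by simp
  have dec: "\<tau> p r \<le> card {j. j < length Ss \<and> h p j \<and> v \<in> Ss ! j \<and> Ss ! j \<inter> E (p * R + r) = {}} \<longleftrightarrow>
      threshold (p * R + r) \<le> real (deg Ss (E (p * R + r)) v)" if "r < R" "v < n" for r v
    using Suc.prems(3)[of p r v] that by simp
  let ?T = "sample (h p) Ss (E (p * R))"
  have "rounds_set L Ss ?T (\<tau> p) (E (p * R)) r = E (p * R + r)" if "r \<le> R" for r
    using that
  proof (induction r)
    case (Suc r)
    then have r: "r < R" by simp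
    have hc: "hit_count L Ss ?T (E (p * R + r)) v =
       card {j. j < length Ss \<and> h p j \<and> v \<in> Ss ! j \<and> Ss ! j \<inter> E (p * R + r) = {}}" for v
      using len by (intro hit_count_sample E_mono) auto
    have "\<tau> p r \<le> hit_count L Ss ?T (E (p * R + r)) v \<longleftrightarrow>
       v < n \<and> threshold (p * R + r) \<le> real (deg Ss (E (p * R + r)) v)" for v
    proof (cases "v < n")
      case True
      then show ?thesis unfolding hc using dec[OF r True] by simp
    next
      case False
      then have "{j. j < length Ss \<and> h p j \<and> v \<in> Ss ! j \<and> Ss ! j \<inter> E (p * R + r) = {}} = {}"
        using sets by fastforce
      then have "hit_count L Ss ?T (E (p * R + r)) v = 0" unfolding hc by simp
      then show ?thesis using False pos[OF r] by simp
    qed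
    then show ?case using Suc by (simp add: threshold_def)
  qed simp
  from this[of R] show ?case by (simp add: IH add.commute)
qed simp

end

section \<open>Assembly\<close>

text \<open>This is evaluated when the program is built: the chosen list ends up as literals in a
  leaf of the decision tree, so the use of choice costs nothing at run time.\<close>

definition least_hitting_list :: "nat \<Rightarrow> nat set set \<Rightarrow> nat list" where
  "least_hitting_list n F = (SOME ys. distinct ys \<and> hitting_set {..<n} F (set ys) \<and>
     card (set ys) = min_hitting_size {..<n} F)"

lemma min_hitting_setE:
  fixes n :: nat
  assumes "\<exists>H. hitting_set {..<n} F H"
  obtains H where "hitting_set {..<n} F H" "card H = min_hitting_size {..<n} F" "finite H"
proof -
  have "\<exists>H. hitting_set {..<n} F H \<and> card H = min_hitting_size {..<n} F"
    unfolding min_hitting_size_def by (rule LeastI_ex) (use assms in blast)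
  then obtain H where H: "hitting_set {..<n} F H" "card H = min_hitting_size {..<n} F" by blast
  moreover have "finite H" using H(1) by (intro finite_subset[of H "{..<n}"]) (simp_all add: hitting_set_def)
  ultimately show thesis using that by simp
qed

lemma least_hitting_list:
  assumes "\<exists>H. hitting_set {..<n} F H"
  shows "distinct (least_hitting_list n F)" "hitting_set {..<n} F (set (least_hitting_list n F))"
    "card (set (least_hitting_list n F)) = min_hitting_size {..<n} F"
proof -
  obtain H where H: "hitting_set {..<n} F H" "card H = min_hitting_size {..<n} F" "finite H"
    using min_hitting_setE[OF assms] .
  obtain ys where "set ys = H" "distinct ys" using finite_distinct_list[OF H(3)] by blast
  then have "distinct ys \<and> hitting_set {..<n} F (set ys) \<and>
     card (set ys) = min_hitting_size {..<n} F" using H(1,2) by simp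
  then have "\<exists>ys. distinct ys \<and> hitting_set {..<n} F (set ys) \<and>
     card (set ys) = min_hitting_size {..<n} F" by (rule exI)
  from someI_ex[OF this] show "distinct (least_hitting_list n F)"
    "hitting_set {..<n} F (set (least_hitting_list n F))"
    "card (set (least_hitting_list n F)) = min_hitting_size {..<n} F"
    unfolding least_hitting_list_def by auto
qed

definition leaf :: "nat list \<Rightarrow> nat list option" where
  "leaf pre = (if \<exists>n As. pre = n # length As # listing As
     then Some (least_hitting_list (hd pre)
       (set ` set (SOME As. pre = hd pre # length As # listing As)))
     else None)"

lemma leaf_complete:
  assumes "x = n # length As # listing As"
  shows "leaf x = Some (least_hitting_list n (set ` set As))"
proof -
  have "(SOME Bs. x = hd x # length Bs # listing Bs) = As"
  proof (rule some_equality)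
    show "x = hd x # length As # listing As" using assms by simp
    fix Bs assume "x = hd x # length Bs # listing Bs"
    then have "listing Bs @ [] = listing As @ []" "length Bs = length As" using assms by auto
    from listing_unique[OF this] show "Bs = As" by simp
  qed
  moreover have "hd x = n" using assms by simp
  moreover have "\<exists>n As. x = n # length As # listing As" using assms by blast
  ultimately show ?thesis unfolding leaf_def by simp
qed

lemma leaf_prefix:
  assumes "x = n # length As # listing As" "j < length x"
  shows "leaf (take j x) = None"
proof -
  have "\<not> (\<exists>n' As'. take j x = n' # length As' # listing As')"
  proof
    assume "\<exists>n' As'. take j x = n' # length As' # listing As'"
    then obtain n' As' where "take j x = n' # length As' # listing As'" by blast
    from encoding_prefix_free[OF assms(1) this] assms(2) show False by simp
  qed
  then show ?thesis unfolding leaf_def by (simp only: if_False)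
qed

text \<open>11 digits hold numbers up to the sample cap \<open>n ^ 10\<close> inclusive. The largest
  long quantity is the hash \<open>a * j + b\<close>, at most \<open>2 * n ^ (6 * d + 2)\<close>,
  from parameters up to \<open>n ^ (4 * d + 2)\<close> and indices below \<open>n ^ (2 * d)\<close>;
  \<open>14 * d\<close> digits suffice for it when \<open>1 \<le> d\<close>.\<close>

definition width :: "nat \<Rightarrow> vr \<Rightarrow> nat" where
  "width d z = (case z of Tau p r \<Rightarrow> 11 | Rd p r c \<Rightarrow> 11 | _ \<Rightarrow> 14 * d)"

section \<open>Listing the variables and their total width\<close>

definition gls :: "vr list" where
  "gls = map Gl [One, NN, MM, CAP, VL, TOP, QQ, SZ, DONE, GOOD, CNT, GV, GF, GJ, GPOS, GSIZ, GE, GEL, HIT]"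

definition phase_vars :: "nat \<Rightarrow> nat \<Rightarrow> vr list" where
  "phase_vars R p = map (Adv p) [HA, HB, HT] @ map (Ph p) [PJ, PPOS, PC, PH, PSIZ, PE, PEL, PG, PAL] @
     map (Tau p) [0..<R] @ concat (map (\<lambda>r. map (Rd p r) [RI, RU, RG, ROK, RCNT]) [0..<R])"

definition all_vars :: "nat \<Rightarrow> nat \<Rightarrow> vr list" where
  "all_vars R D = gls @ concat (map (phase_vars R) [0..<D])"

lemma set_gls: "set gls = range Gl"
proof
  have "Gl g \<in> set gls" for g by (cases g) (simp_all add: gls_def)
  then show "range Gl \<subseteq> set gls" by blast
qed (auto simp: gls_def)

lemma set_phase_vars: "set (phase_vars R p) = range (Ph p) \<union> range (Adv p) \<union> Tau p ` {..<R} \<union>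
   (\<Union>r<R. range (Rd p r))"
proof -
  have "a \<in> {HA, HB, HT}" for a by (cases a) simp_all
  moreover have "a \<in> {PJ, PPOS, PC, PH, PSIZ, PE, PEL, PG, PAL}" for a by (cases a) simp_all
  moreover have "a \<in> {RI, RU, RG, ROK, RCNT}" for a by (cases a) simp_all
  ultimately have u: "UNIV = {HA, HB, HT}" "UNIV = {PJ, PPOS, PC, PH, PSIZ, PE, PEL, PG, PAL}"
    "UNIV = {RI, RU, RG, ROK, RCNT}" by (simp_all only: set_eq_iff UNIV_I simp_thms)
  show ?thesis unfolding u by (simp add: phase_vars_def lessThan_atLeast0)
qed

lemma set_all_vars: "set (all_vars R D) = range Gl \<union> (\<Union>p<D. range (Ph p) \<union> range (Adv p) \<union> Tau p ` {..<R} \<union>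
   (\<Union>r<R. range (Rd p r)))"
  by (simp add: all_vars_def set_gls set_phase_vars lessThan_atLeast0)

lemma in_all_vars:
  "Gl c1 \<in> set (all_vars R D)"
  "p < D \<Longrightarrow> Ph p c2 \<in> set (all_vars R D)" "p < D \<Longrightarrow> Adv p c3 \<in> set (all_vars R D)"
  "p < D \<Longrightarrow> r < R \<Longrightarrow> Tau p r \<in> set (all_vars R D)"
  "p < D \<Longrightarrow> r < R \<Longrightarrow> Rd p r c4 \<in> set (all_vars R D)"
  by (simp_all add: set_all_vars) (blast+)

lemma distinct_all_vars: "distinct (all_vars R D)"
proof -
  have r: "distinct (concat (map (\<lambda>r. map (Rd p r) [RI, RU, RG, ROK, RCNT]) [0..<k]))" for p k
    by (induction k) auto
  have p: "distinct (phase_vars R p)" for p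
    using r[of p R] by (auto simp: phase_vars_def distinct_map inj_on_def)
  have "distinct (concat (map (phase_vars R) [0..<k]))" for k
  proof (induction k)
    case (Suc k)
    have "set (concat (map (phase_vars R) [0..<k])) \<inter> set (phase_vars R k) = {}"
      by (auto simp: set_phase_vars)
    then show ?case using Suc p[of k] by simp
  qed simp
  moreover have "distinct gls" by (simp add: gls_def)
  moreover have "set gls \<inter> set (concat (map (phase_vars R) [0..<D])) = {}"
    by (auto simp: set_gls set_phase_vars)
  ultimately show ?thesis by (simp add: all_vars_def)
qed

lemma total_width_all_vars:
  "total_width (width d) (all_vars R D) = 14 * d * 19 + D * (14 * d * 12 + 66 * R)"
proof -
  have r: "sum_list (map (width d) (concat (map (\<lambda>r. map (Rd p r) [RI, RU, RG, ROK, RCNT]) [0..<k]))) = 55 * k" for p k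
    by (induction k) (simp_all add: width_def)
  have t: "sum_list (map (width d) (map (Tau p) [0..<k])) = 11 * k" for p k
    by (induction k) (simp_all add: width_def)
  have p: "sum_list (map (width d) (phase_vars R p)) = 14 * d * 12 + 66 * R" for p
    unfolding phase_vars_def map_append sum_list_append r t by (simp add: width_def)
  have "sum_list (map (width d) (concat (map (phase_vars R) [0..<k]))) = k * (14 * d * 12 + 66 * R)" for k
    by (induction k) (simp_all add: p)
  moreover have "sum_list (map (width d) gls) = 14 * d * 19" by (simp add: gls_def width_def)
  ultimately show ?thesis by (simp add: all_vars_def)
qed

lemma vars_For: "vars (For one x ub c) = {one, x, ub} \<union> vars c"
  by (auto simp: For_def)

lemma vars_mem_code:
  "vars (mem_code p T i u f) \<subseteq> {i, u, f} \<union> range Gl \<union> range (Adv p) \<union> range (Ph p) \<union> vars (T (Ph p PEL) (Ph p PG))"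
  by (auto simp: mem_code_def vars_For)

lemma vars_phase_code:
  assumes "p \<le> D"
  shows "vars (phase_code R p X Y) \<subseteq> {X, Y} \<union> set (all_vars R D)"
  using assms
proof (induction p arbitrary: X Y)
  case (Suc p)
  then have p: "p < D" and IH: "\<And>X Y. vars (phase_code R p X Y) \<subseteq> {X, Y} \<union> set (all_vars R D)" by auto
  let ?U = "set (all_vars R D)"
  have rng: "range Gl \<subseteq> ?U" "range (Adv p) \<subseteq> ?U" "range (Ph p) \<subseteq> ?U" using in_all_vars p by auto
  have m: "vars (mem_code p (phase_code R p) i u f) \<subseteq> {i, u, f} \<union> ?U" for i u f
  proof -
    have "vars (phase_code R p (Ph p PEL) (Ph p PG)) \<subseteq> ?U"
      using IH[of "Ph p PEL" "Ph p PG"] in_all_vars(2)[OF p] by (simp add: insert_absorb)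
    then show ?thesis using vars_mem_code[of p "phase_code R p" i u f] rng by blast
  qed
  have "vars (rounds_code p (phase_code R p) r X Y) \<subseteq> {X, Y} \<union> ?U" if "r \<le> R" for r
    using that
  proof (induction r arbitrary: X Y)
    case 0
    then show ?case using IH by simp
  next
    case (Suc r)
    then have r: "r < R" by simp
    have k: "Rd p r c \<in> ?U" for c using in_all_vars(5)[OF p r] .
    have g: "Gl c \<in> ?U" for c by (rule in_all_vars)
    have IHr: "vars (rounds_code p (phase_code R p) r X Y) \<subseteq> {X, Y} \<union> ?U" for X Y
      using Suc by simp
    have "vars (mem_code p (phase_code R p) (Rd p r RI) X (Rd p r ROK)) \<subseteq> {X, Y} \<union> ?U"
      "vars (mem_code p (phase_code R p) (Rd p r RI) (Rd p r RU) (Rd p r RG)) \<subseteq> {X, Y} \<union> ?U"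
      "vars (rounds_code p (phase_code R p) r (Rd p r RU) (Rd p r RG)) \<subseteq> {X, Y} \<union> ?U"
      using m[of "Rd p r RI" X "Rd p r ROK"] m[of "Rd p r RI" "Rd p r RU" "Rd p r RG"]
        IHr[of "Rd p r RU" "Rd p r RG"] k by auto
    then show ?case
      using IHr[of X Y] k g in_all_vars(4)[OF p r] by (simp add: round_code_def vars_For)
  qed
  then show ?case by simp
qed simp

lemma vars_enum_code: "vars (enum_code ys c) \<subseteq> range Gl \<union> fst ` set ys \<union> snd ` set ys \<union> vars c"
  by (induction ys) (auto simp: vars_For)

lemma vars_pow_com: "vars (pow_com x k) \<subseteq> {x, Gl NN}"
  by (induction k) auto

lemma vars_main_code: "vars (main_code D R kl kv) \<subseteq> set (all_vars R D)"
proof -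
  let ?U = "set (all_vars R D)"
  have g: "Gl c \<in> ?U" for c by (rule in_all_vars)
  have T: "vars (phase_code R D (Gl x) (Gl y)) \<subseteq> ?U" for x y
    using vars_phase_code[of D D R "Gl x" "Gl y"] by (simp add: insert_absorb g)
  have "vars (try_code (phase_code R D)) \<subseteq> ?U"
    using T g by (simp add: try_code_def check_code_def vars_For)
  moreover have "\<forall>y \<in> set (advice D R). fst y \<in> ?U \<and> snd y \<in> ?U"
    by (simp add: advice_def in_all_vars ball_Un)
  then have "fst ` set (advice D R) \<union> snd ` set (advice D R) \<subseteq> ?U"
    by (simp only: Un_subset_iff image_subset_iff ball_conj_distrib)
  moreover have "range Gl \<subseteq> ?U" by (simp add: image_subset_iff g)
  ultimately have "vars (enum_code (advice D R) (try_code (phase_code R D))) \<subseteq> ?U"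
    using vars_enum_code[of "advice D R" "try_code (phase_code R D)"]
    by (meson Un_subset_iff order_trans Un_least)
  moreover have "vars (pow_com (Gl x) k) \<subseteq> ?U" for x k
    by (rule order_trans[OF vars_pow_com]) (simp add: g)
  ultimately show ?thesis using g by (simp add: main_code_def vars_For)
qed

lemma pack_zero: "pack n wd vs (\<lambda>_. 0) = 0"
  by (induction vs) auto

section \<open>Size bounds for an instance\<close>

locale instance_bounds =
  fixes n d :: nat and F :: "nat set set" and x :: "nat list" and As :: "nat list list"
  assumes n: "2 \<le> n" and d: "1 \<le> d" and F: "F \<subseteq> Pow {..<n}" "\<And>A. A \<in> F \<Longrightarrow> card A \<le> d"
    and hs: "\<exists>H. hitting_set {..<n} F H"
    and x: "x = n # length As # listing As" and dist: "\<And>A. A \<in> set As \<Longrightarrow> distinct A"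
    "distinct (map set As)" and FAs: "set ` set As = F"
begin

text \<open>A set of at most \<open>d\<close> vertices is read off a list of length \<open>d\<close>
  over \<open>{..n}\<close>, where \<open>n\<close> serves as padding, and
  \<open>n + 1 \<le> n * n\<close> since \<open>2 \<le> n\<close>. This is the origin of the
  exponent \<open>2 * d\<close> in the thresholds.\<close>

lemma number_of_sets: "length As \<le> n ^ (2 * d)"
proof -
  let ?X = "{xs. set xs \<subseteq> {..n} \<and> length xs = d}"
  have "F \<subseteq> (\<lambda>xs. set xs \<inter> {..<n}) ` ?X"
  proof
    fix A assume A: "A \<in> F"
    then have An: "A \<subseteq> {..<n}" "card A \<le> d" using F by auto
    then have "finite A" using finite_subset by blast
    then obtain ys where ys: "set ys = A" "distinct ys" using finite_distinct_list by blast
    have "length ys \<le> d" using An(2) ys distinct_card[OF ys(2)] by simp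
    then have "ys @ replicate (d - length ys) n \<in> ?X" using ys An by auto
    moreover have "A = set (ys @ replicate (d - length ys) n) \<inter> {..<n}" using ys An by auto
    ultimately show "A \<in> (\<lambda>xs. set xs \<inter> {..<n}) ` ?X" by blast
  qed
  then have "card F \<le> card ?X" by (intro surj_card_le) (auto intro: finite_lists_length_eq)
  also have "\<dots> = (n + 1) ^ d" by (simp add: card_lists_length_eq)
  also have "\<dots> \<le> (n * n) ^ d"
  proof (rule power_mono)
    have "n + 1 \<le> 2 * n" using n by simp
    also have "\<dots> \<le> n * n" using n by (rule mult_right_mono) simp
    finally show "n + 1 \<le> n * n" .
  qed simp
  finally have "card F \<le> n ^ (2 * d)" by (simp add: power_mult power2_eq_square)
  moreover have "length As = card F"
    using distinct_card[OF dist(2)] FAs by simp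
  ultimately show ?thesis by simp
qed

lemma two_power_le: "2 ^ k \<le> n ^ k"
  using n by (intro power_mono) auto

lemma n_le: "n \<le> n ^ (2 * d)" "d \<le> n ^ (2 * d)"
proof -
  show "n \<le> n ^ (2 * d)" using power_increasing[of 1 "2 * d" n] n d by simp
  have "d \<le> 2 ^ d" by (simp add: less_imp_le)
  also have "\<dots> \<le> n ^ d" by (rule two_power_le)
  also have "\<dots> \<le> n ^ (2 * d)" using n by (intro power_increasing) auto
  finally show "d \<le> n ^ (2 * d)" .
qed

lemma set_list: "A \<in> set As \<Longrightarrow> set A \<subseteq> {..<n} \<and> length A \<le> d"
  using F FAs dist(1) distinct_card by fastforce

lemma entries_le: "v \<in> set x \<Longrightarrow> v \<le> n ^ (2 * d)"
proof -
  assume "v \<in> set x"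
  then consider "v = n" | "v = length As" | A where "A \<in> set As" "v = length A \<or> v \<in> set A"
    unfolding x by auto
  then show ?thesis
  proof cases
    case 3
    then have "v \<le> d \<or> v < n" using set_list by blast
    then show ?thesis using n_le by linarith
  qed (use n_le number_of_sets in auto)
qed

lemma length_x: "length x \<le> n ^ (3 * d + 1)"
proof -
  have "length (listing Bs) \<le> (d + 1) * length Bs" if "\<forall>A\<in>set Bs. length A \<le> d" for Bs :: "nat list list"
    using that by (induction Bs) auto
  then have "length x \<le> 2 + (d + 1) * length As" using set_list unfolding x by simp
  also have "\<dots> \<le> 2 + (d + 1) * n ^ (2 * d)"
    by (rule add_left_mono, rule mult_le_mono2) (rule number_of_sets)
  also have "\<dots> \<le> (d + 3) * n ^ (2 * d)"
  proof -
    have "1 \<le> n ^ (2 * d)" using n by simp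
    then show ?thesis by (simp add: algebra_simps)
  qed
  also have "\<dots> \<le> n ^ (d + 1) * n ^ (2 * d)"
  proof (rule mult_right_mono)
    have "d + 3 \<le> 2 ^ (d + 1)" using d by (induction d rule: dec_induct) auto
    then show "d + 3 \<le> n ^ (d + 1)" using two_power_le[of "d + 1"] by linarith
  qed simp
  also have "\<dots> = n ^ (3 * d + 1)" by (simp flip: power_add)
  finally show ?thesis .
qed

end

section \<open>The combined program\<close>

definition small_code :: "nat \<Rightarrow> nat \<Rightarrow> nat \<Rightarrow> prog" where
  "small_code fin d N =
     branch_code 1 (\<lambda>k y. tree_code fin leaf (N ^ (2 * d) + 1) (N ^ (3 * d + 1) + 2) [y] k) [0..<N]"

text \<open>The final address 0 is a placeholder: the real one is computed from this length, which
  by \<open>length_small_code\<close> is the same for every final address.\<close>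

definition large_start :: "nat \<Rightarrow> nat \<Rightarrow> nat" where
  "large_start d N = 1 + length (small_code 0 d N)"

text \<open>\<open>n ^ 10\<close> is the cap on the sample, \<open>n ^ (4 * d + 2)\<close> exceeds
  the hash modulus, and \<open>2 * d + 3\<close> phases are what \<open>E_hits\<close> asks
  for.\<close>

abbreviation large_com :: "nat \<Rightarrow> nat \<Rightarrow> vr com" where
  "large_com d R \<equiv> main_code (2 * d + 3) R 10 (4 * d + 2)"

definition large_code :: "nat \<Rightarrow> nat \<Rightarrow> nat \<Rightarrow> prog" where
  "large_code d R k = layout.code (width d) (all_vars R (2 * d + 3)) k (large_com d R)"

definition large_len :: "nat \<Rightarrow> nat \<Rightarrow> nat" where
  "large_len d R = layout.len (width d) (all_vars R (2 * d + 3)) (large_com d R)"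

definition program :: "nat \<Rightarrow> nat \<Rightarrow> nat \<Rightarrow> prog" where
  "program d R N = Input 1 0 # small_code (large_start d N + large_len d R) d N @ large_code d R (large_start d N)"

lemma length_small_code: "length (small_code fin d N) = length (small_code 0 d N)"
  unfolding small_code_def by (rule length_branch_code) (rule length_tree_code)

lemma length_large_code: "length (large_code d R k) = large_len d R"
  unfolding large_code_def large_len_def by (rule layout.length_code)

lemma length_program: "length (program d R N) = large_start d N + large_len d R"
  by (simp add: program_def large_start_def length_large_code length_small_code[of "Suc _"]
    length_small_code[of "_ + _"])

lemma code_at_program:
  "code_at (program d R N) 0 [Input 1 0]"
  "code_at (program d R N) 1 (small_code (length (program d R N)) d N)"
  "code_at (program d R N) (large_start d N) (large_code d R (large_start d N))"
proof -
  let ?fin = "large_start d N + large_len d R"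
  have "code_at (program d R N) 0 ([Input 1 0] @ small_code ?fin d N @ large_code d R (large_start d N))"
    unfolding code_at_def program_def by (intro exI[of _ "[]"]) simp
  then have "code_at (program d R N) 0 [Input 1 0] \<and> code_at (program d R N) 1 (small_code ?fin d N) \<and>
     code_at (program d R N) (1 + length (small_code ?fin d N)) (large_code d R (large_start d N))"
    unfolding code_at_append by simp
  moreover have "1 + length (small_code ?fin d N) = large_start d N"
    by (subst length_small_code) (simp add: large_start_def)
  ultimately show "code_at (program d R N) 0 [Input 1 0]"
    "code_at (program d R N) 1 (small_code (length (program d R N)) d N)"
    "code_at (program d R N) (large_start d N) (large_code d R (large_start d N))"
    by (simp_all only: length_program)
qed

lemma first_step:
  assumes "x = n # xs" "n < 2 ^ w" "2 \<le> m"
  shows "gstep w (program d R N) x m init_config \<lparr>pc = 1, mem = (\<lambda>_. 0)(1 := n), out = []\<rparr>"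
proof -
  have "0 < length (program d R N)" "program d R N ! 0 = Input 1 0"
    by (simp_all add: program_def)
  then show ?thesis using assms
    by (simp add: gstep_def halted_def step_def init_config_def input_word_def take_bit_nat_eq_self)
qed

lemma total_width_ge:
  assumes "1 \<le> d" "0 < R"
  shows "266 * d \<le> total_width (width d) (all_vars R (2 * d + 3))"
    "11 \<le> total_width (width d) (all_vars R (2 * d + 3))"
  unfolding total_width_all_vars using assms by simp_all

context instance_bounds
begin

abbreviation opt :: nat where
  "opt \<equiv> min_hitting_size {..<n} F"

text \<open>The first word \<open>n\<close> is matched by the outer chain of comparisons, so the
  tree starts with the prefix \<open>[n]\<close>. The time is a power of \<open>n\<close> and not of
  \<open>N\<close> because values are found after as many comparisons as they are large.\<close>

lemma small_run:
  assumes "n < N" "n ^ (3 * d + 1) < 2 ^ w"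
  shows "\<exists>ys t. computes w (program d R N) x ys t 6 \<and> distinct ys \<and> hitting_set {..<n} F (set ys) \<and>
    card (set ys) = opt \<and> t \<le> n ^ (3 * d + 1) * (3 * n ^ (2 * d) + 4) + 5 * n + 4"
proof -
  let ?P = "program d R N" and ?ys = "least_hitting_list n F"
  let ?s1 = "\<lparr>pc = 1, mem = (\<lambda>_. 0)(1 := n), out = []\<rparr>"
  let ?tree = "\<lambda>k y. tree_code (length ?P) leaf (N ^ (2 * d) + 1) (N ^ (3 * d + 1) + 2) [y] k"
  note ys = least_hitting_list[OF hs]
  have ysn: "set ?ys \<subseteq> {..<n}" using ys(2) by (simp add: hitting_set_def)
  have pw: "n ^ (2 * d) \<le> n ^ (3 * d + 1)" "n ^ 1 \<le> n ^ (3 * d + 1)"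
    using n by (intro power_increasing; simp)+
  have nw: "n < 2 ^ w" using pw(2) assms(2) unfolding power_one_right by linarith
  have ent: "v < 2 ^ w" "v < N ^ (2 * d) + 1" if "v \<in> set x" for v
  proof -
    have "n ^ (2 * d) \<le> N ^ (2 * d)" using assms(1) by (intro power_mono) auto
    then show "v < N ^ (2 * d) + 1" "v < 2 ^ w"
      using entries_le[OF that] pw assms(2) by linarith+
  qed
  have g1: "gstep w ?P x 6 init_config ?s1" by (rule first_step[OF x nw]) simp
  obtain k where k: "code_at ?P k (?tree k n)"
    "(gstep w ?P x 6 ^^ (3 * (n - 0) + 2)) ?s1 (?s1\<lparr>pc := k, mem := (mem ?s1)(2 := n)\<rparr>)"
    using branch_code_hit[of ?P 1 ?tree 0 N ?s1 n w 6 x] code_at_program(2)[of d R N] assms(1) nw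
    unfolding small_code_def by auto
  let ?s2 = "?s1\<lparr>pc := k, mem := (mem ?s1)(2 := n)\<rparr>"
  have lx: "length x \<le> N ^ (3 * d + 1)"
    using length_x power_mono[of n N "3 * d + 1"] assms(1) by linarith
  have tk: "take 1 x = [n]" and lx1: "1 \<le> length x" by (simp_all add: x)
  have "\<exists>t s'. (gstep w ?P x 6 ^^ t) ?s2 s' \<and> pc s' = length ?P \<and> out s' = out ?s2 @ ?ys \<and>
    t \<le> (length x - 1) * (3 * n ^ (2 * d) + 4) + 2 * length ?ys + 1"
  proof (rule tree_code_exec[where leaf = leaf and V = "N ^ (2 * d) + 1" and f = "N ^ (3 * d + 1) + 2" and k = k])
    show "code_at ?P k (tree_code (length ?P) leaf (N ^ (2 * d) + 1) (N ^ (3 * d + 1) + 2) (take 1 x) k)"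
      unfolding tk by (rule k(1))
    show "length x - 1 < N ^ (3 * d + 1) + 2" using lx by linarith
    show "leaf (take j x) = None" if "1 \<le> j" "j < length x" for j by (rule leaf_prefix[OF x that(2)])
    show "leaf x = Some ?ys" using leaf_complete[OF x] FAs by simp
    show "\<forall>v\<in>set x. v < N ^ (2 * d) + 1 \<and> v < 2 ^ w \<and> v \<le> n ^ (2 * d)" using ent entries_le by blast
    show "length x < 2 ^ w" using length_x assms(2) by linarith
    show "\<forall>y\<in>set ?ys. y < 2 ^ w"
    proof
      fix y assume "y \<in> set ?ys"
      then have "y < n" using ysn by auto
      then show "y < 2 ^ w" using nw by linarith
    qed
  qed (use lx1 in simp_all)
  then obtain t s' where t: "(gstep w ?P x 6 ^^ t) ?s2 s'" "pc s' = length ?P" "out s' = out ?s2 @ ?ys"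
    "t \<le> (length x - 1) * (3 * n ^ (2 * d) + 4) + 2 * length ?ys + 1" by blast
  have "(gstep w ?P x 6 ^^ (1 + ((3 * (n - 0) + 2) + t))) init_config s'"
    by (rule relpowp_trans[OF _ relpowp_trans[OF k(2) t(1)]]) (simp only: relpowp_1 g1)
  then have c: "computes w ?P x ?ys (1 + ((3 * (n - 0) + 2) + t)) 6"
    unfolding computes_iff_relpowp using t(2,3) by (intro exI[of _ s']) (simp add: halted_def)
  have "length ?ys \<le> n" using card_mono[OF _ ysn] distinct_card[OF ys(1)] by simp
  moreover have "(length x - 1) * (3 * n ^ (2 * d) + 4) \<le> n ^ (3 * d + 1) * (3 * n ^ (2 * d) + 4)"
    using length_x by (intro mult_right_mono) auto
  ultimately have "1 + ((3 * (n - 0) + 2) + t) \<le> n ^ (3 * d + 1) * (3 * n ^ (2 * d) + 4) + 5 * n + 4"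
    using t(4) by linarith
  then show ?thesis using c ys by blast
qed

lemma main_locale:
  assumes "54 \<le> n" "0 < R" "n ^ total_width (width d) (all_vars R (2 * d + 3)) < 2 ^ w"
  shows "main w n x (width d) As (n ^ 10) (n ^ (4 * d + 2))"
proof
  note tw = total_width_ge[OF d assms(2)]
  have le: "n ^ k \<le> n ^ l" if "k \<le> l" for k l using n that by (intro power_increasing) auto
  have less: "n ^ k < n ^ l" if "k < l" for k l using n that by (intro power_strict_increasing) auto
  have wd: "width d z = 11 \<or> width d z = 14 * d" for z by (simp add: width_def split: vr.split)
  have wl: "width d z = 14 * d" if "is_long z" for z using that by (cases z) (auto simp: width_def)
  \<comment> \<open>A common bound for all long quantities; one spare factor \<open>n\<close>
    absorbs the 2.\<close>
  have big: "l < n ^ (14 * d)" if "l \<le> 2 * n ^ (6 * d + 2)" for l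
  proof -
    have "2 * n ^ (6 * d + 2) < n * n ^ (6 * d + 2)" using assms(1) by (intro mult_strict_right_mono) auto
    also have "\<dots> = n ^ (6 * d + 3)" by (simp add: eval_nat_numeral)
    also have "\<dots> \<le> n ^ (14 * d)" using d by (intro le) auto
    finally show ?thesis using that by linarith
  qed
  have pos: "1 \<le> n ^ k" for k using n by simp
  show "n ^ width d z \<le> 2 ^ w" "0 < width d z" for z
  proof -
    have "width d z \<le> total_width (width d) (all_vars R (2 * d + 3))" using wd[of z] tw by linarith
    from le[OF this] show "n ^ width d z \<le> 2 ^ w" using assms(3) by linarith
    show "0 < width d z" using wd[of z] d by auto
  qed
  show "2 < n" using assms(1) by simp
  show "x = n # length As # listing As" by (rule x)
  show "length x + 1 < n ^ width d z" if "is_long z" for z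
  proof -
    have "length x + 1 \<le> 2 * n ^ (3 * d + 1)" using length_x pos[of "3 * d + 1"] by linarith
    also have "\<dots> \<le> 2 * n ^ (6 * d + 2)" by (intro mult_left_mono le) auto
    finally show ?thesis unfolding wl[OF that] by (rule big)
  qed
  show "v < n ^ width d z" if "is_long z" "v \<in> set x" for z v
    unfolding wl[OF that(1)] using entries_le[OF that(2)] le[of "2 * d" "6 * d + 2"] by (intro big) auto
  show "n < n ^ width d z" for z using less[of 1 "width d z"] wd[of z] d by auto
  show "n ^ 10 < n ^ width d z" for z by (rule less) (use wd[of z] d in auto)
  show "set A \<subseteq> {..<n}" if "A \<in> set As" for A using set_list[OF that] by simp
  have v: "n ^ (4 * d + 2) * length As \<le> n ^ (6 * d + 2)"
  proof -
    have "n ^ (4 * d + 2) * length As \<le> n ^ (4 * d + 2) * n ^ (2 * d)"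
      using number_of_sets by (intro mult_left_mono) auto
    also have "\<dots> = n ^ (6 * d + 2)" unfolding power_add[symmetric] by (rule arg_cong[where f = "(^) n"]) simp
    finally show ?thesis .
  qed
  have v2: "n ^ (4 * d + 2) \<le> n ^ (6 * d + 2)" by (rule le) simp
  show "n ^ (4 * d + 2) * length As + n ^ (4 * d + 2) < n ^ width d (Ph p PH)" for p
    unfolding wl[of "Ph p PH", simplified] using v v2 by (intro big) linarith
  have e: "width d (Gl g) = 14 * d" "width d (Adv p a) = 14 * d" for g p a by (simp_all add: width_def)
  show "n ^ (4 * d + 2) < n ^ width d (Gl g)" "n ^ (4 * d + 2) < n ^ width d (Adv p a)" for g p a
    unfolding e using v2 by (intro big; linarith)+
  have "n ^ 1 \<le> n ^ (6 * d + 2)" by (rule le) simp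
  then have "n + 1 \<le> 2 * n ^ (6 * d + 2)" using assms(1) unfolding power_one_right by linarith
  then show "n + 1 < n ^ width d (Gl g)" for g unfolding e by (rule big)
qed

lemma run_exists:
  assumes "54 \<le> n" "8 * R \<le> n" "0 < R" "1 < g" "g ^ R = real n"
  shows "exact_run n d R g (map set As)"
proof
  show "map set As ! j \<subseteq> {..<n} \<and> map set As ! j \<noteq> {} \<and> card (map set As ! j) \<le> d"
    if "j < length (map set As)" for j
  proof -
    have j: "As ! j \<in> set As" using that by simp
    then have "set (As ! j) \<in> set ` set As" by (rule imageI)
    then have F: "set (As ! j) \<in> F" unfolding FAs .
    obtain H where "hitting_set {..<n} F H" using hs by blast
    then have "set (As ! j) \<inter> H \<noteq> {}" using F unfolding hitting_set_def by blast
    then have "set (As ! j) \<noteq> {}" by (rule contrapos_nn) simp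
    moreover have "card (set (As ! j)) \<le> d" using set_list[OF j] card_length[of "As ! j"] by linarith
    ultimately show ?thesis using set_list[OF j] that by simp
  qed
  show "length (map set As) \<le> n ^ (2 * d)" using number_of_sets by simp
qed (use assms in auto)

lemma advice_exists:
  assumes "54 \<le> n" "8 * R \<le> n" "0 < R" "1 < g" "g ^ R = real n"
  shows "\<exists>t. t (Gl QQ) < n ^ (4 * d + 2) \<and> (\<forall>p c. t (Adv p c) < n ^ (4 * d + 2)) \<and>
     (\<forall>p. \<forall>r<R. t (Tau p r) < n ^ 10) \<and>
     phases_set (n ^ 10) (map set As) (hashed t) (\<lambda>p r. t (Tau p r)) R (2 * d + 3) =
     exact_run.E n d g (map set As) ((2 * d + 3) * R)"
proof -
  interpret exact_run n d R g "map set As" by (rule run_exists[OF assms])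
  let ?Ss = "map set As"
  have "1 \<le> n ^ (2 * d)" using n by simp
  then obtain l where l: "2 ^ l \<le> n ^ (2 * d)" "n ^ (2 * d) < 2 * 2 ^ l"
    using power_of_two_between by blast
  \<comment> \<open>\<open>2 ^ u\<close> exceeds the number of indices and is at most
    \<open>2 * n ^ (2 * d)\<close>, so the modulus \<open>2 ^ (2 * u)\<close> is at most
    \<open>4 * n ^ (4 * d)\<close>. Doubling the exponent leaves room for every
    \<open>l \<le> u\<close> in the hash family.\<close>
  define u where "u = l + 1"
  have u1: "n ^ (2 * d) \<le> 2 ^ u" using l by (simp add: u_def)
  have u2: "2 ^ (2 * u) < n ^ (4 * d + 2)"
  proof -
    have "(2::nat) ^ (2 * u) = 4 * (2 ^ l * 2 ^ l)" by (simp add: u_def power_add mult_2)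
    also have "\<dots> \<le> 4 * (n ^ (2 * d) * n ^ (2 * d))" using l(1) by (intro mult_le_mono) auto
    also have "\<dots> = 4 * n ^ (4 * d)" by (simp flip: power_add)
    also have "\<dots> < n ^ 2 * n ^ (4 * d)"
    proof (rule mult_strict_right_mono)
      have "(54::nat) ^ 2 \<le> n ^ 2" using assms(1) by (intro power_mono) auto
      then show "4 < n ^ 2" by simp
    qed (use n in simp)
    also have "\<dots> = n ^ (4 * d + 2)" by (simp add: power_add power2_eq_square)
    finally show ?thesis .
  qed
  define ok where "ok p a b l \<tau> \<longleftrightarrow> a < 2 ^ (2 * u) \<and> b < 2 ^ (2 * u) \<and> l \<le> u \<and>
    (\<forall>r<R. 0 < \<tau> r \<and> \<tau> r < n ^ 10) \<and>
    length (sample (\<lambda>j. (a * j + b) mod 2 ^ (2 * u) < (2::nat) ^ (2 * u - l)) ?Ss (E (p * R))) \<le> n ^ 10 \<and>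
    (\<forall>r<R. \<forall>v<n. \<tau> r \<le> card {j. j < length ?Ss \<and> (a * j + b) mod 2 ^ (2 * u) < (2::nat) ^ (2 * u - l) \<and>
        v \<in> ?Ss ! j \<and> ?Ss ! j \<inter> E (p * R + r) = {}} \<longleftrightarrow>
      threshold (p * R + r) \<le> real (deg ?Ss (E (p * R + r)) v))"
    for p a b l :: nat and \<tau> :: "nat \<Rightarrow> nat"
  have "\<forall>p. \<exists>a b l \<tau>. ok p a b l \<tau>" unfolding ok_def using phase_exists[OF u1] by blast
  then obtain a b l \<tau> where ok: "\<And>p. ok p (a p) (b p) (l p) (\<tau> p)" by metis
  define t where "t z = (case z of Gl c \<Rightarrow> if c = QQ then 2 ^ (2 * u) else 0
    | Adv p c \<Rightarrow> (case c of HA \<Rightarrow> a p | HB \<Rightarrow> b p | HT \<Rightarrow> 2 ^ (2 * u - l p))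
    | Tau p r \<Rightarrow> \<tau> p r | _ \<Rightarrow> 0)" for z
  have ts: "t (Gl QQ) = 2 ^ (2 * u)" "t (Adv p HA) = a p" "t (Adv p HB) = b p"
    "t (Adv p HT) = 2 ^ (2 * u - l p)" "t (Tau p r) = \<tau> p r" for p r by (simp_all add: t_def)
  have h: "hashed t p = (\<lambda>j. (a p * j + b p) mod 2 ^ (2 * u) < 2 ^ (2 * u - l p))" for p
    by (rule ext) (simp only: hashed_def ts)
  have "t (Adv p c) < n ^ (4 * d + 2)" for p c
  proof (cases c)
    case HT
    have "(2::nat) ^ (2 * u - l p) \<le> 2 ^ (2 * u)" by (intro power_increasing) auto
    then show ?thesis unfolding HT ts using u2 by linarith
  qed (use ok[of p] u2 ts in \<open>auto simp: ok_def\<close>)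
  moreover have "t (Gl QQ) < n ^ (4 * d + 2)" unfolding ts by (rule u2)
  moreover have "t (Tau p r) < n ^ 10" if "r < R" for p r
    unfolding ts using ok[of p] that unfolding ok_def by blast
  moreover have "phases_set (n ^ 10) ?Ss (hashed t) (\<lambda>p r. t (Tau p r)) R (2 * d + 3) = E ((2 * d + 3) * R)"
  proof (rule phases_set_eq)
    fix p
    show "length (sample (hashed t p) ?Ss (E (p * R))) \<le> n ^ 10"
      unfolding h using ok[of p] unfolding ok_def by blast
    fix r assume r: "r < R"
    show "0 < t (Tau p r)" unfolding ts using ok[of p] r unfolding ok_def by blast
    fix v assume "v < n"
    then show "t (Tau p r) \<le> card {j. j < length ?Ss \<and> hashed t p j \<and> v \<in> ?Ss ! j \<and>
        ?Ss ! j \<inter> E (p * R + r) = {}} \<longleftrightarrow> threshold (p * R + r) \<le> real (deg ?Ss (E (p * R + r)) v)"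
      unfolding h ts using ok[of p] r unfolding ok_def by blast
  qed
  ultimately show ?thesis by (intro exI[of _ t]) simp
qed

text \<open>Of the first \<open>1 + 3 * N\<close> steps, one reads \<open>n\<close> and three are
  spent on each comparison with a value below \<open>N\<close>. From then on the program counter
  stays in the code of the algorithm, and configurations over six words are counted.\<close>

lemma large_run:
  assumes nR: "54 \<le> n" "8 * R \<le> n" and R: "0 < R" and g: "1 < g" "g ^ R = real n" and N: "N \<le> n"
    and w: "n ^ total_width (width d) (all_vars R (2 * d + 3)) < 2 ^ w"
  shows "\<exists>ys t. computes w (program d R N) x ys t 6 \<and> distinct ys \<and> hitting_set {..<n} F (set ys) \<and>
    real (card (set ys)) \<le> real ((2 * d + 3) * R) * (27 * g * real d * real opt) \<and>
    t \<le> 1 + 3 * N + large_len d R * (2 ^ w) ^ 6"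
proof -
  let ?P = "program d R N" and ?vs = "all_vars R (2 * d + 3)" and ?k = "large_start d N"
  interpret exact_run n d R g "map set As" by (rule run_exists[OF nR R g])
  interpret M: main w n x "width d" As "n ^ 10" "n ^ (4 * d + 2)" "2 * d + 3" R
    by (rule main_locale[OF nR(1) R w])
  have nw: "n < 2 ^ w"
  proof -
    have "n ^ 1 \<le> n ^ total_width (width d) ?vs"
      by (rule power_increasing) (use n total_width_ge[OF d R] in auto)
    then show ?thesis using w by simp
  qed
  interpret K: compiler w n x "width d" ?vs 6 ?k ?P
    by unfold_locales (use n nw w distinct_all_vars in auto)
  obtain t where "t (Gl QQ) < n ^ (4 * d + 2)" "\<forall>p c. t (Adv p c) < n ^ (4 * d + 2)"
     "\<forall>p. \<forall>r<R. t (Tau p r) < n ^ 10" and At: "M.A t = E ((2 * d + 3) * R)"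
    using advice_exists[OF nR R g] by blast
  then have t: "M.okay t" "M.A t = E ((2 * d + 3) * R)" by (simp_all only: M.okay_def) simp
  define Q where "Q s' os' \<longleftrightarrow> (\<exists>u. (\<forall>j<length As. map set As ! j \<inter> M.A u \<noteq> {}) \<and>
    card {v. v < n \<and> v \<in> M.A u} \<le> card {v. v < n \<and> v \<in> M.A t} \<and> os' = M.result u)"
    for s' :: "vr \<Rightarrow> nat" and os'
  have "M.wp (large_com d R) Q (\<lambda>_. 0) []"
    by (rule M.main_code_ok[where t = t]) (use t E_hits in \<open>auto simp: Q_def\<close>)
  then obtain s' ys where big: "M.big (large_com d R) (\<lambda>_. 0) [] s' ys" and Q: "Q s' ys"
    unfolding M.wp_def by blast
  from Q obtain u where u: "\<forall>j<length As. map set As ! j \<inter> M.A u \<noteq> {}"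
    "card {v. v < n \<and> v \<in> M.A u} \<le> card {v. v < n \<and> v \<in> M.A t}" "ys = M.result u"
    unfolding Q_def by blast
  have set_ys: "set ys = {v. v < n \<and> v \<in> M.A u}" and dist_ys: "distinct ys"
    by (auto simp: u(3) M.result_def)
  have hit: "hitting_set {..<n} F (set ys)"
    unfolding hitting_set_def
  proof (intro conjI ballI)
    fix S assume "S \<in> F"
    then obtain j where j: "j < length As" "S = set (As ! j)" using FAs by (auto simp: in_set_conv_nth)
    then have "S \<inter> M.A u \<noteq> {}" "S \<subseteq> {..<n}" using u(1) set_list[of "As ! j"] by auto
    then show "S \<inter> set ys \<noteq> {}" unfolding set_ys by blast
  qed (auto simp: set_ys)
  obtain H where H: "hitting_set {..<n} F H" "card H = opt" "finite H"
    using min_hitting_setE[OF hs] .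
  have "{v. v < n \<and> v \<in> M.A t} = E ((2 * d + 3) * R)"
    unfolding t(2) using E_subset[of "(2 * d + 3) * R"] by auto
  then have "real (card (set ys)) \<le> real (card (E ((2 * d + 3) * R)))" using u(2) set_ys by simp
  also have "\<dots> \<le> real ((2 * d + 3) * R) * (27 * g * real d * real (card H))"
    by (rule E_size[OF H(3)]) (use H(1) FAs in \<open>auto simp: hitting_set_def\<close>)
  finally have size: "real (card (set ys)) \<le> real ((2 * d + 3) * R) * (27 * g * real d * real opt)"
    unfolding H(2) .
  let ?s1 = "\<lparr>pc = 1, mem = (\<lambda>_. 0)(1 := n), out = []\<rparr>"
  have "gstep w ?P x 6 init_config ?s1" by (rule first_step[OF x nw]) simp
  then have g1: "(gstep w ?P x 6 ^^ 1) init_config ?s1" by (simp only: relpowp_1)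
  let ?small = "small_code (length ?P) d N"
  have start: "1 + length ?small = ?k"
    unfolding large_start_def by (subst length_small_code) (rule refl)
  have "\<exists>z. (gstep w ?P x 6 ^^ (3 * length [0..<N])) ?s1
     (?s1\<lparr>pc := 1 + length ?small, mem := (mem ?s1)(2 := z)\<rparr>)"
    unfolding small_code_def
    by (rule branch_code_miss[where v = n]) (use code_at_program(2)[of d R N] N nw in \<open>simp_all add: small_code_def\<close>)
  then obtain z where z: "(gstep w ?P x 6 ^^ (3 * length [0..<N])) ?s1
     (?s1\<lparr>pc := ?k, mem := (mem ?s1)(2 := z)\<rparr>)"
    unfolding start by (rule exE)
  let ?s2 = "?s1\<lparr>pc := ?k, mem := (mem ?s1)(2 := z)\<rparr>"
  have r2: "(gstep w ?P x 6 ^^ (1 + 3 * N)) init_config ?s2"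
    using relpowp_trans[OF g1 z] by (simp only: length_upt diff_zero)
  \<comment> \<open>Word 0 is still 0 and so represents the state in which all variables are 0, and
    word 1 holds \<open>n\<close> since the first instruction.\<close>
  have rep: "K.rep (\<lambda>_. 0) [] ?s2" using n by (simp add: K.rep_def pack_zero)
  have "\<exists>cf. K.reaches ?s2 cf \<and> K.rep s' ys cf \<and> pc cf = ?k + large_len d R"
    unfolding large_len_def
    by (rule K.code_correct[OF big vars_main_code code_at_program(3)[unfolded large_code_def] _ rep])
      simp_all
  then obtain cf where cf: "K.reaches ?s2 cf" "K.rep s' ys cf" "pc cf = ?k + large_len d R" by blast
  have "halted ?P cf" "out cf = ys" using cf(2,3) by (simp_all add: halted_def length_program K.rep_def)
  then obtain T where "computes w ?P x ys T 6" "T \<le> 1 + 3 * N + (length ?P - ?k) * (2 ^ w) ^ 6"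
    using computes_from[OF r2 cf(1)] by blast
  then have "T \<le> 1 + 3 * N + large_len d R * (2 ^ w) ^ 6" by (simp add: length_program)
  then show ?thesis using \<open>computes w ?P x ys T 6\<close> dist_ys hit size by blast
qed

end

section \<open>Choice of the constants\<close>

lemma ceiling_log2:
  assumes "2 \<le> n"
  defines "l \<equiv> nat \<lceil>log 2 (real n)\<rceil>"
  shows "n \<le> 2 ^ l" "2 ^ l \<le> n ^ 2" "real l \<le> 2 * log 2 (real n)"
proof -
  have lg: "1 \<le> log 2 (real n)" using assms by (simp add: le_log_iff)
  then have l: "log 2 (real n) \<le> real l" "real l \<le> log 2 (real n) + 1"
    unfolding l_def by linarith+
  show l2: "real l \<le> 2 * log 2 (real n)" using l lg by linarith
  have "real n = 2 powr log 2 (real n)" using assms by simp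
  also have "\<dots> \<le> 2 powr real l" using l by (intro powr_mono) auto
  also have "\<dots> = real (2 ^ l)" by (simp add: powr_realpow)
  finally show "n \<le> 2 ^ l" by (simp only: of_nat_le_iff)
  have "real (2 ^ l) = 2 powr real l" by (simp add: powr_realpow)
  also have "\<dots> \<le> 2 powr (log 2 (real n) + log 2 (real n))" using l2 by (intro powr_mono) auto
  also have "\<dots> = real (n ^ 2)"
    unfolding powr_add using assms by (simp add: power2_eq_square)
  finally show "2 ^ l \<le> n ^ 2" by (simp only: of_nat_le_iff)
qed

lemma hitting_set_program:
  fixes \<epsilon> :: real and d :: nat
  assumes eps: "0 < \<epsilon>" "\<epsilon> \<le> 1" and d: "1 \<le> d"
  shows "\<exists>(P::prog) (c::nat). c > 0 \<and>
        (\<forall>(n::nat) (F::nat set set) (x::nat list).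
           2 \<le> n \<and> F \<subseteq> Pow {..<n} \<and> (\<forall>A\<in>F. card A \<le> d) \<and>
           (\<exists>H. hitting_set {..<n} F H) \<and> encodes x n F \<longrightarrow>
           (\<exists>w ys t m.
              w = c * nat \<lceil>log 2 (real n)\<rceil> \<and>
              computes w P x ys t m \<and>
              distinct ys \<and> hitting_set {..<n} F (set ys) \<and>
              real (card (set ys))
                \<le> 30000 * (real d / \<epsilon>) * real n powr \<epsilon> * real (min_hitting_size {..<n} F) \<and>
              real t \<le> real n powr (30000 * (real d ^ 2 + real d / \<epsilon>)) \<and>
              real (w * m) \<le> 30000 * (real d ^ 2 + real d / \<epsilon>) * log 2 (real n)))"
proof -
  define e where "e = nat \<lceil>1 / \<epsilon>\<rceil>"
  have "1 \<le> 1 / \<epsilon>" using eps by simp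
  then have e: "1 / \<epsilon> \<le> real e" "real e \<le> 2 * (1 / \<epsilon>)" "1 \<le> e" unfolding e_def by linarith+
  define R where "R = 2 * e"
  \<comment> \<open>All variables together have at most
    \<open>266 * d + 840 * d ^ 2 + 660 * d * e\<close> digits, which is below
    \<open>c\<close>.\<close>
  define c where "c = 1200 * (d ^ 2 + d * e)"
  define K where "K = real d ^ 2 + real d / \<epsilon>"
  define M where "M = real ((2 * d + 3) * R) * (27 * real d)"
  \<comment> \<open>\<open>large_len d R\<close> does not mention \<open>N\<close>, so this is not
    circular. The last summand yields \<open>M \<le> n powr (\<epsilon> / 2)\<close> for
    \<open>N \<le> n\<close>.\<close>
  define N where "N = 54 + 8 * R + large_len d R + nat \<lceil>M powr (2 / \<epsilon>)\<rceil>"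
  have R: "0 < R" using e by (simp add: R_def)
  have de: "1 \<le> real d / \<epsilon>" using eps d by (simp add: field_simps)
  have dd: "real d \<le> real d ^ 2" "1 \<le> real d" using d by (simp_all add: self_le_power)
  have K: "1 \<le> K" "real d \<le> K" using de dd unfolding K_def by linarith+
  have cK: "real c \<le> 2400 * K"
  proof -
    have "real d * real e \<le> real d * (2 * (1 / \<epsilon>))" using e(2) by (intro mult_left_mono) auto
    then have "real c \<le> 1200 * (real d ^ 2 + 2 * (real d / \<epsilon>))" by (simp add: c_def)
    also have "\<dots> \<le> 2400 * K" unfolding K_def by simp
    finally show ?thesis .
  qed
  have dsq: "d \<le> d ^ 2" using d by (simp add: self_le_power)
  have tw: "total_width (width d) (all_vars R (2 * d + 3)) < c"
  proof -
    have "(2 * d + 3) * (14 * d * 12 + 66 * R) \<le> (5 * d) * (14 * d * 12 + 66 * R)"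
      using d by (intro mult_right_mono) auto
    also have "\<dots> = 840 * d ^ 2 + 660 * (d * e)" by (simp add: R_def power2_eq_square algebra_simps)
    finally have "14 * d * 19 + (2 * d + 3) * (14 * d * 12 + 66 * R) \<le>
      14 * d * 19 + (840 * d ^ 2 + 660 * (d * e))" by (rule add_left_mono)
    also have "\<dots> < c" unfolding c_def using dsq d le0[of "d * e"] unfolding distrib_left by linarith
    finally show ?thesis unfolding total_width_all_vars .
  qed
  have c3: "3 * d + 1 < c" using dsq d le0[of "d * e"] unfolding c_def distrib_left by linarith
  show ?thesis
  proof (rule exI[of _ "program d R N"], rule exI[of _ c], intro conjI allI impI)
    show "0 < c" using c3 by simp
    fix n F x
    assume A: "2 \<le> n \<and> F \<subseteq> Pow {..<n} \<and> (\<forall>A\<in>F. card A \<le> d) \<and>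
           (\<exists>H. hitting_set {..<n} F H) \<and> encodes x n F"
    then have n: "2 \<le> n" by blast
    obtain As where As: "x = n # length As # listing As" "\<forall>A\<in>set As. distinct A"
      "distinct (map set As)" "set ` set As = F"
      using A unfolding encodes_def by blast
    interpret instance_bounds n d F x As
      by unfold_locales (use A d As in auto)
    define l where "l = nat \<lceil>log 2 (real n)\<rceil>"
    note l = ceiling_log2[OF n, folded l_def]
    have w1: "n ^ c \<le> 2 ^ (c * l)"
      using power_mono[OF l(1), of c] by (simp add: power_mult[symmetric] mult.commute)
    have w2: "2 ^ (c * l) \<le> n ^ (2 * c)"
      using power_mono[OF l(2), of c] by (simp add: power_mult[symmetric] mult.commute)
    have fits: "n ^ k < 2 ^ (c * l)" if "k < c" for k
      using power_strict_increasing[of k c n] that n w1 by linarith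
    have pows: "real (n ^ k) \<le> real n powr (30000 * K)" if "real k \<le> 30000 * K" for k
      using powr_mono[OF that, of "real n"] n by (simp add: powr_realpow)
    \<comment> \<open>Six words of \<open>c * l\<close> bits, with \<open>c \<le> 2400 * K\<close>
      and \<open>l \<le> 2 * log 2 n\<close>: the product 28800 is the origin of the constant
      30000.\<close>
    have space: "real (c * l * 6) \<le> 30000 * K * log 2 (real n)"
    proof -
      have "0 \<le> log 2 (real n)" using n by simp
      moreover have "real c * real l \<le> (2400 * K) * (2 * log 2 (real n))"
        using cK l(3) K by (intro mult_mono) auto
      moreover have "0 \<le> K * log 2 (real n)" using K \<open>0 \<le> log 2 (real n)\<close> by simp
      ultimately show ?thesis by simp
    qed
    have "\<exists>ys t. computes (c * l) (program d R N) x ys t 6 \<and> distinct ys \<and>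
       hitting_set {..<n} F (set ys) \<and>
       real (card (set ys)) \<le> 30000 * (real d / \<epsilon>) * real n powr \<epsilon> * real opt \<and>
       real t \<le> real n powr (30000 * K)"
    proof (cases "n < N")
      case True
      from small_run[OF True fits[OF c3], of R] obtain ys t where
        run: "computes (c * l) (program d R N) x ys t 6" "distinct ys" "hitting_set {..<n} F (set ys)"
          "card (set ys) = opt" "t \<le> n ^ (3 * d + 1) * (3 * n ^ (2 * d) + 4) + 5 * n + 4" by blast
      have "1 \<le> real n powr \<epsilon>" using n eps by (intro ge_one_powr_ge_zero) auto
      then have "1 * 1 \<le> 30000 * (real d / \<epsilon>) * real n powr \<epsilon>"
        using de by (intro mult_mono) auto
      from mult_right_mono[OF this, of "real opt"]
      have size: "real (card (set ys)) \<le> 30000 * (real d / \<epsilon>) * real n powr \<epsilon> * real opt"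
        unfolding run(4) by simp
      have p2: "4 \<le> n ^ 2" using power_mono[of 2 n 2] n by simp
      also have p2d: "n ^ 2 \<le> n ^ (2 * d)" using n d by (intro power_increasing) auto
      finally have "3 * n ^ (2 * d) + 4 \<le> 4 * n ^ (2 * d)" by simp
      also have "\<dots> \<le> n ^ 2 * n ^ (2 * d)" using p2 by (intro mult_right_mono) auto
      finally have "n ^ (3 * d + 1) * (3 * n ^ (2 * d) + 4) \<le> n ^ (3 * d + 1) * (n ^ 2 * n ^ (2 * d))"
        by (rule mult_left_mono) simp
      also have "\<dots> = n ^ (5 * d + 3)" unfolding power_add[symmetric] by (rule arg_cong[where f = "(^) n"]) simp
      finally have 1: "n ^ (3 * d + 1) * (3 * n ^ (2 * d) + 4) \<le> n ^ (5 * d + 3)" .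
      have "5 * n + 4 \<le> 4 * (2 * n)" using n by linarith
      also have "\<dots> \<le> n ^ 2 * (n * n)" using p2 n by (intro mult_mono) auto
      also have "\<dots> = n ^ 4" by (simp add: eval_nat_numeral)
      also have "\<dots> \<le> n ^ (5 * d + 3)" using n d by (intro power_increasing) auto
      finally have "t \<le> 2 * n ^ (5 * d + 3)" using run(5) 1 by linarith
      also have "\<dots> \<le> n * n ^ (5 * d + 3)" using n by (intro mult_right_mono) auto
      also have "\<dots> = n ^ (5 * d + 4)" by (simp add: eval_nat_numeral)
      finally have "real t \<le> real (n ^ (5 * d + 4))" by (simp only: of_nat_le_iff)
      also have "\<dots> \<le> real n powr (30000 * K)" by (rule pows) (use K in simp)
      finally show ?thesis using run size by blast
    next
      case False
      define g where "g = real n powr (1 / real R)"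
      have g: "1 < g" "g ^ R = real n"
        using n R unfolding g_def by (auto simp: powr_power)
      have Nn: "54 \<le> n" "8 * R \<le> n" "N \<le> n" "large_len d R \<le> n" using False unfolding N_def by linarith+
      from large_run[OF Nn(1,2) R g Nn(3) fits[OF tw]] obtain ys t where
        run: "computes (c * l) (program d R N) x ys t 6" "distinct ys" "hitting_set {..<n} F (set ys)"
          "real (card (set ys)) \<le> real ((2 * d + 3) * R) * (27 * g * real d * real opt)"
          "t \<le> 1 + 3 * N + large_len d R * (2 ^ (c * l)) ^ 6" by blast
      have "0 \<le> M" unfolding M_def by simp
      have gle: "g \<le> real n powr (\<epsilon> / 2)"
      proof -
        have "1 / real e \<le> \<epsilon>" using e eps by (simp add: field_simps)
        then show ?thesis unfolding g_def R_def using n by (intro powr_mono) auto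
      qed
      have Mle: "M \<le> real n powr (\<epsilon> / 2)"
      proof -
        have "M = (M powr (2 / \<epsilon>)) powr (\<epsilon> / 2)" using eps \<open>0 \<le> M\<close> by (simp add: powr_powr)
        also have "\<dots> \<le> real n powr (\<epsilon> / 2)"
        proof (rule powr_mono2)
          show "M powr (2 / \<epsilon>) \<le> real n" using False unfolding N_def by linarith
        qed (use eps in auto)
        finally show ?thesis .
      qed
      have "real (card (set ys)) \<le> (M * g) * real opt"
        using run(4) unfolding M_def by (simp only: mult_ac)
      also have "\<dots> \<le> (real n powr (\<epsilon> / 2) * real n powr (\<epsilon> / 2)) * real opt"
        using gle Mle g(1) by (intro mult_right_mono mult_mono) auto
      also have "\<dots> = real n powr \<epsilon> * real opt" by (simp flip: powr_add)
      also have "\<dots> = 1 * (real n powr \<epsilon> * real opt)" by simp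
      also have "\<dots> \<le> (30000 * (real d / \<epsilon>)) * (real n powr \<epsilon> * real opt)"
      proof (rule mult_right_mono)
        show "1 \<le> 30000 * (real d / \<epsilon>)" using de by linarith
      qed simp
      finally have size: "real (card (set ys)) \<le> 30000 * (real d / \<epsilon>) * real n powr \<epsilon> * real opt"
        by (simp only: mult.assoc)
      \<comment> \<open>The number of memories is at most \<open>n ^ (12 * c)\<close>, and the
        length of the algorithm's code costs one more factor \<open>n\<close>. By
        \<open>c \<le> 2400 * K\<close> and \<open>1 \<le> K\<close> the exponent
        \<open>12 * c + 2\<close> stays below \<open>30000 * K\<close>.\<close>
      have "(2 ^ (c * l)) ^ 6 \<le> (n ^ (2 * c)) ^ 6" using w2 by (rule power_mono) simp
      also have "\<dots> = n ^ (12 * c)" unfolding power_mult[symmetric] by (rule arg_cong[where f = "(^) n"]) simp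
      finally have "large_len d R * (2 ^ (c * l)) ^ 6 \<le> n * n ^ (12 * c)"
        using Nn(4) by (intro mult_mono) auto
      moreover have "1 + 3 * N \<le> n * n ^ (12 * c)"
      proof -
        have "1 + 3 * N \<le> n * 54" using Nn by linarith
        also have "\<dots> \<le> n * n ^ (12 * c)"
        proof (rule mult_left_mono)
          have "n ^ 1 \<le> n ^ (12 * c)" using n c3 by (intro power_increasing) auto
          then show "54 \<le> n ^ (12 * c)" using Nn(1) unfolding power_one_right by linarith
        qed simp
        finally show ?thesis .
      qed
      ultimately have "t \<le> 2 * (n * n ^ (12 * c))" using run(5) by linarith
      also have "\<dots> \<le> n * (n * n ^ (12 * c))" using n by (intro mult_right_mono) auto
      also have "\<dots> = n ^ (12 * c + 2)" by (simp add: eval_nat_numeral)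
      finally have "real t \<le> real (n ^ (12 * c + 2))" by (simp only: of_nat_le_iff)
      also have "\<dots> \<le> real n powr (30000 * K)" by (rule pows) (use K cK in simp)
      finally show ?thesis using run size by blast
    qed
    then show "\<exists>w ys t m.
              w = c * nat \<lceil>log 2 (real n)\<rceil> \<and>
              computes w (program d R N) x ys t m \<and>
              distinct ys \<and> hitting_set {..<n} F (set ys) \<and>
              real (card (set ys))
                \<le> 30000 * (real d / \<epsilon>) * real n powr \<epsilon> * real (min_hitting_size {..<n} F) \<and>
              real t \<le> real n powr (30000 * (real d ^ 2 + real d / \<epsilon>)) \<and>
              real (w * m) \<le> 30000 * (real d ^ 2 + real d / \<epsilon>) * log 2 (real n)"
      unfolding l_def[symmetric] K_def[symmetric] using space by blast
  qed
qed

theorem theorem6: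
  shows "\<exists>C::real. C > 0 \<and>
    (\<forall>(\<epsilon>::real) (d::nat). 0 < \<epsilon> \<and> \<epsilon> \<le> 1 \<longrightarrow>
      (\<exists>(P::prog) (c::nat). c > 0 \<and>
        (\<forall>(n::nat) (F::nat set set) (x::nat list).
           2 \<le> n \<and> F \<subseteq> Pow {..<n} \<and> (\<forall>A\<in>F. card A \<le> d) \<and>
           (\<exists>H. hitting_set {..<n} F H) \<and> encodes x n F \<longrightarrow>
           (\<exists>w ys t m.
              w = c * nat \<lceil>log 2 (real n)\<rceil> \<and>
              computes w P x ys t m \<and>
              distinct ys \<and> hitting_set {..<n} F (set ys) \<and>
              real (card (set ys))
                \<le> C * (real d / \<epsilon>) * real n powr \<epsilon> * real (min_hitting_size {..<n} F) \<and>
              real t \<le> real n powr (C * (real d ^ 2 + real d / \<epsilon>)) \<and>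
              real (w * m) \<le> C * (real d ^ 2 + real d / \<epsilon>) * log 2 (real n)))))"
proof (rule exI[of _ 30000], intro conjI allI impI)
  fix \<epsilon> :: real and d :: nat
  assume eps: "0 < \<epsilon> \<and> \<epsilon> \<le> 1"
  show "\<exists>(P::prog) (c::nat). c > 0 \<and>
        (\<forall>(n::nat) (F::nat set set) (x::nat list).
           2 \<le> n \<and> F \<subseteq> Pow {..<n} \<and> (\<forall>A\<in>F. card A \<le> d) \<and>
           (\<exists>H. hitting_set {..<n} F H) \<and> encodes x n F \<longrightarrow>
           (\<exists>w ys t m.
              w = c * nat \<lceil>log 2 (real n)\<rceil> \<and>
              computes w P x ys t m \<and>
              distinct ys \<and> hitting_set {..<n} F (set ys) \<and>
              real (card (set ys))
                \<le> 30000 * (real d / \<epsilon>) * real n powr \<epsilon> * real (min_hitting_size {..<n} F) \<and>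
              real t \<le> real n powr (30000 * (real d ^ 2 + real d / \<epsilon>)) \<and>
              real (w * m) \<le> 30000 * (real d ^ 2 + real d / \<epsilon>) * log 2 (real n)))"
  proof (cases "d = 0")
    \<comment> \<open>For \<open>d = 0\<close> the bounds on size and space are 0. A family of empty
      sets has a hitting set only if the family itself is empty, and then the empty program is
      correct.\<close>
    case True
    show ?thesis
    proof (rule exI[of _ "[]"], rule exI[of _ 1], intro conjI allI impI)
      fix n F and x :: "nat list"
      assume A: "2 \<le> n \<and> F \<subseteq> Pow {..<n} \<and> (\<forall>A\<in>F. card A \<le> d) \<and>
           (\<exists>H. hitting_set {..<n} F H) \<and> encodes x n F"
      have "A \<notin> F" for A
      proof
        assume AF: "A \<in> F"
        then have "finite A" using A finite_subset[of A "{..<n}"] by blast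
        moreover have "card A = 0" using A AF True by auto
        moreover obtain H where "hitting_set {..<n} F H" using A by blast
        ultimately show False using AF by (auto simp: hitting_set_def)
      qed
      then have "F = {}" by auto
      then have "1 * nat \<lceil>log 2 (real n)\<rceil> = 1 * nat \<lceil>log 2 (real n)\<rceil> \<and>
              computes (1 * nat \<lceil>log 2 (real n)\<rceil>) [] x [] 0 0 \<and>
              distinct ([] :: nat list) \<and> hitting_set {..<n} F (set []) \<and>
              real (card (set ([] :: nat list)))
                \<le> 30000 * (real d / \<epsilon>) * real n powr \<epsilon> * real (min_hitting_size {..<n} F) \<and>
              real 0 \<le> real n powr (30000 * (real d ^ 2 + real d / \<epsilon>)) \<and>
              real (1 * nat \<lceil>log 2 (real n)\<rceil> * 0) \<le> 30000 * (real d ^ 2 + real d / \<epsilon>) * log 2 (real n)"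
        using True by (simp add: computes_def run_def halted_def init_config_def hitting_set_def)
      then show "\<exists>w ys t m.
              w = 1 * nat \<lceil>log 2 (real n)\<rceil> \<and>
              computes w [] x ys t m \<and>
              distinct ys \<and> hitting_set {..<n} F (set ys) \<and>
              real (card (set ys))
                \<le> 30000 * (real d / \<epsilon>) * real n powr \<epsilon> * real (min_hitting_size {..<n} F) \<and>
              real t \<le> real n powr (30000 * (real d ^ 2 + real d / \<epsilon>)) \<and>
              real (w * m) \<le> 30000 * (real d ^ 2 + real d / \<epsilon>) * log 2 (real n)"
        by blast
    qed simp
  next
    case False
    then show ?thesis using eps by (intro hitting_set_program) auto
  qed
qed simp

end
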